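(* The category $\mathrm{CHausLoc}$ of compact Hausdorff locales is effective regular (that is, Barr-exact): it is a regular category in which every internal equivalence relation is effective, i.e. is the kernel pair of some morphism.
   Context: The category of locales is the opposite of the category of frames; a map of locales $f\colon X\to Y$ is given by a map $f^*\colon OY\to OX$ between the corresponding frames preserving finite infima and all suprema. A locale $X$ is Hausdorff if its diagonal $X\to X\times X$ is closed, and compact if whenever the top element of $OX$ is a directed supremum of elements, it equals one of these elements. $\mathrm{CHausLoc}$ is the full subcategory of the category of locales on the compact Hausdorff locales. *)

theory Defs
  imports "HOL-Algebra.Complete_Lattice" "HOL-Library.FuncSet" "HOL-Library.Equipollence"
begin

section \<open>Categories\<close>

text \<open>\<open>Comp C g f\<close> is \<open>g\<close> after \<open>f\<close>.\<close>

record ('o, 'm) cat =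
  Obj :: "'o set"
  Arr :: "'m set"
  Dom :: "'m \<Rightarrow> 'o"
  Cod :: "'m \<Rightarrow> 'o"
  Id :: "'o \<Rightarrow> 'm"
  Comp :: "'m \<Rightarrow> 'm \<Rightarrow> 'm"

definition hom :: "('o, 'm) cat \<Rightarrow> 'o \<Rightarrow> 'o \<Rightarrow> 'm set" where
  "hom C X Y = {f \<in> Arr C. Dom C f = X \<and> Cod C f = Y}"

locale category =
  fixes C :: "('o, 'm) cat"
  assumes Dom_Obj: "f \<in> Arr C \<Longrightarrow> Dom C f \<in> Obj C"
    and Cod_Obj: "f \<in> Arr C \<Longrightarrow> Cod C f \<in> Obj C"
    and Id_hom: "X \<in> Obj C \<Longrightarrow> Id C X \<in> hom C X X"
    and Comp_hom: "f \<in> hom C X Y \<Longrightarrow> g \<in> hom C Y Z \<Longrightarrow> Comp C g f \<in> hom C X Z"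
    and Id_left: "f \<in> hom C X Y \<Longrightarrow> Comp C (Id C Y) f = f"
    and Id_right: "f \<in> hom C X Y \<Longrightarrow> Comp C f (Id C X) = f"
    and Comp_assoc: "f \<in> hom C W X \<Longrightarrow> g \<in> hom C X Y \<Longrightarrow> h \<in> hom C Y Z \<Longrightarrow>
      Comp C (Comp C h g) f = Comp C h (Comp C g f)"

subsection \<open>Finite limits\<close>

definition is_functor ::
  "('i, 'j) cat \<Rightarrow> ('o, 'm) cat \<Rightarrow> ('i \<Rightarrow> 'o) \<Rightarrow> ('j \<Rightarrow> 'm) \<Rightarrow> bool" where
  "is_functor J C Fo Fa \<longleftrightarrow>
     (\<forall>i\<in>Obj J. Fo i \<in> Obj C) \<and>
     (\<forall>u\<in>Arr J. Fa u \<in> hom C (Fo (Dom J u)) (Fo (Cod J u))) \<and>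
     (\<forall>i\<in>Obj J. Fa (Id J i) = Id C (Fo i)) \<and>
     (\<forall>u\<in>Arr J. \<forall>v\<in>Arr J. Cod J u = Dom J v \<longrightarrow> Fa (Comp J v u) = Comp C (Fa v) (Fa u))"

definition is_cone ::
  "('i, 'j) cat \<Rightarrow> ('o, 'm) cat \<Rightarrow> ('i \<Rightarrow> 'o) \<Rightarrow> ('j \<Rightarrow> 'm) \<Rightarrow> 'o \<Rightarrow> ('i \<Rightarrow> 'm) \<Rightarrow> bool" where
  "is_cone J C Fo Fa L p \<longleftrightarrow>
     L \<in> Obj C \<and> (\<forall>i\<in>Obj J. p i \<in> hom C L (Fo i)) \<and>
     (\<forall>u\<in>Arr J. Comp C (Fa u) (p (Dom J u)) = p (Cod J u))"

definition is_limit ::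
  "('i, 'j) cat \<Rightarrow> ('o, 'm) cat \<Rightarrow> ('i \<Rightarrow> 'o) \<Rightarrow> ('j \<Rightarrow> 'm) \<Rightarrow> 'o \<Rightarrow> ('i \<Rightarrow> 'm) \<Rightarrow> bool" where
  "is_limit J C Fo Fa L p \<longleftrightarrow>
     is_cone J C Fo Fa L p \<and>
     (\<forall>M q. is_cone J C Fo Fa M q \<longrightarrow>
        (\<exists>!h. h \<in> hom C M L \<and> (\<forall>i\<in>Obj J. Comp C (p i) h = q i)))"

text \<open>Every finite category is isomorphic to one whose objects and arrows are natural numbers,
  so only such index categories are considered.\<close>

definition has_finite_limits :: "('o, 'm) cat \<Rightarrow> bool" where
  "has_finite_limits C \<longleftrightarrow>
     (\<forall>(J :: (nat, nat) cat) Fo Fa.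
        category J \<and> finite (Obj J) \<and> finite (Arr J) \<and> is_functor J C Fo Fa \<longrightarrow>
        (\<exists>L p. is_limit J C Fo Fa L p))"

subsection \<open>Regular categories\<close>

text \<open>The square \<open>Comp C f p = Comp C g q\<close> is a pullback.\<close>

definition is_pullback :: "('o, 'm) cat \<Rightarrow> 'm \<Rightarrow> 'm \<Rightarrow> 'm \<Rightarrow> 'm \<Rightarrow> bool" where
  "is_pullback C f g p q \<longleftrightarrow>
     f \<in> Arr C \<and> g \<in> Arr C \<and> p \<in> Arr C \<and> q \<in> Arr C \<and>
     Cod C f = Cod C g \<and> Dom C p = Dom C q \<and> Cod C p = Dom C f \<and> Cod C q = Dom C g \<and>
     Comp C f p = Comp C g q \<and>
     (\<forall>T. \<forall>a\<in>hom C T (Dom C f). \<forall>b\<in>hom C T (Dom C g). Comp C f a = Comp C g b \<longrightarrow>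
        (\<exists>!h. h \<in> hom C T (Dom C p) \<and> Comp C p h = a \<and> Comp C q h = b))"

definition is_kernel_pair :: "('o, 'm) cat \<Rightarrow> 'm \<Rightarrow> 'm \<Rightarrow> 'm \<Rightarrow> bool" where
  "is_kernel_pair C f d c \<longleftrightarrow> is_pullback C f f d c"

definition is_coequalizer :: "('o, 'm) cat \<Rightarrow> 'm \<Rightarrow> 'm \<Rightarrow> 'm \<Rightarrow> bool" where
  "is_coequalizer C d c q \<longleftrightarrow>
     d \<in> Arr C \<and> c \<in> Arr C \<and> q \<in> Arr C \<and>
     Dom C d = Dom C c \<and> Cod C d = Cod C c \<and> Dom C q = Cod C d \<and>
     Comp C q d = Comp C q c \<and>
     (\<forall>T. \<forall>a\<in>hom C (Cod C d) T. Comp C a d = Comp C a c \<longrightarrow>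
        (\<exists>!h. h \<in> hom C (Cod C q) T \<and> Comp C h q = a))"

definition regular_epi :: "('o, 'm) cat \<Rightarrow> 'm \<Rightarrow> bool" where
  "regular_epi C q \<longleftrightarrow> (\<exists>d c. is_coequalizer C d c q)"

definition regular_category :: "('o, 'm) cat \<Rightarrow> bool" where
  "regular_category C \<longleftrightarrow>
     category C \<and> has_finite_limits C \<and>
     (\<forall>f d c. is_kernel_pair C f d c \<longrightarrow> (\<exists>q. is_coequalizer C d c q)) \<and>
     (\<forall>f g p q. is_pullback C f g p q \<and> regular_epi C f \<longrightarrow> regular_epi C q)"

subsection \<open>Internal equivalence relations and Barr-exactness\<close>

definition jointly_monic :: "('o, 'm) cat \<Rightarrow> 'm \<Rightarrow> 'm \<Rightarrow> bool" where
  "jointly_monic C d c \<longleftrightarrow>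
     (\<forall>T. \<forall>a\<in>hom C T (Dom C d). \<forall>b\<in>hom C T (Dom C d).
        Comp C d a = Comp C d b \<and> Comp C c a = Comp C c b \<longrightarrow> a = b)"

text \<open>An internal equivalence relation on \<open>X\<close> is a jointly monic pair \<open>d, c : R \<rightarrow> X\<close> with
  a reflexivity map \<open>r : X \<rightarrow> R\<close>, a symmetry map \<open>s : R \<rightarrow> R\<close> and a transitivity map
  \<open>t : R \<times>\<^sub>X R \<rightarrow> R\<close>. The pullback \<open>R \<times>\<^sub>X R\<close> is that of \<open>c\<close> along \<open>d\<close>, with projections
  \<open>p, q\<close>; thus a generalized element of it is a pair \<open>(x R y, y R z)\<close>.\<close>

definition equivalence_relation :: "('o, 'm) cat \<Rightarrow> 'o \<Rightarrow> 'm \<Rightarrow> 'm \<Rightarrow> bool" where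
  "equivalence_relation C X d c \<longleftrightarrow>
     d \<in> Arr C \<and> c \<in> Arr C \<and> Dom C d = Dom C c \<and> Cod C d = X \<and> Cod C c = X \<and>
     jointly_monic C d c \<and>
     (\<exists>r\<in>hom C X (Dom C d). Comp C d r = Id C X \<and> Comp C c r = Id C X) \<and>
     (\<exists>s\<in>hom C (Dom C d) (Dom C d). Comp C d s = c \<and> Comp C c s = d) \<and>
     (\<exists>p q. is_pullback C c d p q \<and>
        (\<exists>t\<in>hom C (Dom C p) (Dom C d). Comp C d t = Comp C d p \<and> Comp C c t = Comp C c q))"

definition barr_exact :: "('o, 'm) cat \<Rightarrow> bool" where
  "barr_exact C \<longleftrightarrow>
     regular_category C \<and>
     (\<forall>X d c. equivalence_relation C X d c \<longrightarrow> (\<exists>f. is_kernel_pair C f d c))"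

section \<open>Frames and locales\<close>

text \<open>A locale \<open>X\<close> is represented by its frame \<open>OX\<close>, a complete lattice whose carrier is a set
  in some type. In the library, \<open>complete_lattice\<close> includes the requirement that the equality of
  the structure is HOL equality.\<close>

locale frame = complete_lattice +
  assumes inf_Sup_distrib:
    "a \<in> carrier L \<Longrightarrow> S \<subseteq> carrier L \<Longrightarrow> a \<sqinter> \<Squnion>S = \<Squnion>((\<lambda>s. a \<sqinter> s) ` S)"

definition frame_hom :: "'a gorder \<Rightarrow> 'b gorder \<Rightarrow> ('a \<Rightarrow> 'b) \<Rightarrow> bool" where
  "frame_hom L M h \<longleftrightarrow>
     h \<in> carrier L \<rightarrow>\<^sub>E carrier M \<and>
     h \<top>\<^bsub>L\<^esub> = \<top>\<^bsub>M\<^esub> \<and>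
     (\<forall>a\<in>carrier L. \<forall>b\<in>carrier L. h (a \<sqinter>\<^bsub>L\<^esub> b) = h a \<sqinter>\<^bsub>M\<^esub> h b) \<and>
     (\<forall>S\<subseteq>carrier L. h (\<Squnion>\<^bsub>L\<^esub>S) = \<Squnion>\<^bsub>M\<^esub>(h ` S))"

text \<open>A map of locales \<open>f : X \<rightarrow> Y\<close>, with \<open>pre f\<close> standing for \<open>f\<^sup>* : OY \<rightarrow> OX\<close>.\<close>

datatype ('a, 'b) locmap = LocMap (src: "'a gorder") (tgt: "'b gorder") (pre: "'b \<Rightarrow> 'a")

definition locale_map :: "('a, 'b) locmap \<Rightarrow> bool" where
  "locale_map f \<longleftrightarrow> frame (src f) \<and> frame (tgt f) \<and> frame_hom (tgt f) (src f) (pre f)"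

definition loc_id :: "'a gorder \<Rightarrow> ('a, 'a) locmap" where
  "loc_id X = LocMap X X (\<lambda>u\<in>carrier X. u)"

definition loc_comp :: "('b, 'c) locmap \<Rightarrow> ('a, 'b) locmap \<Rightarrow> ('a, 'c) locmap" where
  "loc_comp g f = LocMap (src f) (tgt g) (compose (carrier (tgt g)) (pre f) (pre g))"

subsection \<open>Compact locales\<close>

definition directed_in :: "'a gorder \<Rightarrow> 'a set \<Rightarrow> bool" where
  "directed_in L D \<longleftrightarrow>
     D \<subseteq> carrier L \<and> D \<noteq> {} \<and> (\<forall>a\<in>D. \<forall>b\<in>D. \<exists>c\<in>D. a \<sqsubseteq>\<^bsub>L\<^esub> c \<and> b \<sqsubseteq>\<^bsub>L\<^esub> c)"

definition compact_loc :: "'a gorder \<Rightarrow> bool" where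
  "compact_loc X \<longleftrightarrow> (\<forall>D. directed_in X D \<and> \<Squnion>\<^bsub>X\<^esub>D = \<top>\<^bsub>X\<^esub> \<longrightarrow> \<top>\<^bsub>X\<^esub> \<in> D)"

subsection \<open>Hausdorff locales\<close>

text \<open>The frame of the product locale \<open>X \<times> Y\<close>, i.e. the coproduct of the frames \<open>OX\<close> and \<open>OY\<close>:
  the elements are the down-closed subsets of \<open>OX \<times> OY\<close> that are closed under arbitrary
  suprema (including the empty one) in each variable separately. The open rectangle
  \<open>a \<times> b\<close> is the least element that contains \<open>(a, b)\<close>.\<close>

definition prod_loc :: "'a gorder \<Rightarrow> 'b gorder \<Rightarrow> ('a \<times> 'b) set gorder" where
  "prod_loc X Y =
     \<lparr>carrier = {U. U \<subseteq> carrier X \<times> carrier Y \<and>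
        (\<forall>(a, b)\<in>U. \<forall>a'\<in>carrier X. \<forall>b'\<in>carrier Y.
           a' \<sqsubseteq>\<^bsub>X\<^esub> a \<and> b' \<sqsubseteq>\<^bsub>Y\<^esub> b \<longrightarrow> (a', b') \<in> U) \<and>
        (\<forall>S\<subseteq>carrier X. \<forall>b\<in>carrier Y. S \<times> {b} \<subseteq> U \<longrightarrow> (\<Squnion>\<^bsub>X\<^esub>S, b) \<in> U) \<and>
        (\<forall>a\<in>carrier X. \<forall>S\<subseteq>carrier Y. {a} \<times> S \<subseteq> U \<longrightarrow> (a, \<Squnion>\<^bsub>Y\<^esub>S) \<in> U)},
      eq = (=),
      le = (\<subseteq>)\<rparr>"

text \<open>The map \<open>(f, g) : T \<rightarrow> X \<times> Y\<close> induced by \<open>f : T \<rightarrow> X\<close> and \<open>g : T \<rightarrow> Y\<close>; its inverse image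
  map sends the rectangle \<open>a \<times> b\<close> to \<open>f\<^sup>* a \<sqinter> g\<^sup>* b\<close>, and every element of the product frame is
  the supremum of the rectangles \<open>a \<times> b\<close> for its members \<open>(a, b)\<close>.\<close>

definition loc_pair ::
  "('t, 'a) locmap \<Rightarrow> ('t, 'b) locmap \<Rightarrow> ('t, ('a \<times> 'b) set) locmap" where
  "loc_pair f g = LocMap (src f) (prod_loc (tgt f) (tgt g))
     (\<lambda>U\<in>carrier (prod_loc (tgt f) (tgt g)).
        \<Squnion>\<^bsub>src f\<^esub>((\<lambda>(a, b). pre f a \<sqinter>\<^bsub>src f\<^esub> pre g b) ` U))"

definition diagonal :: "'a gorder \<Rightarrow> ('a, ('a \<times> 'a) set) locmap" where
  "diagonal X = loc_pair (loc_id X) (loc_id X)"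

text \<open>The closed sublocale of \<open>Y\<close> complementary to \<open>c \<in> OY\<close> is given by the surjection
  \<open>u \<mapsto> u \<squnion> c\<close> of \<open>OY\<close> onto the frame of elements above \<open>c\<close>. A map \<open>f\<close> is, up to isomorphism,
  the inclusion of this sublocale iff \<open>f\<^sup>*\<close> is a surjection with the same kernel.\<close>

definition closed_embedding :: "('a, 'b) locmap \<Rightarrow> bool" where
  "closed_embedding f \<longleftrightarrow>
     pre f ` carrier (tgt f) = carrier (src f) \<and>
     (\<exists>c\<in>carrier (tgt f). \<forall>u\<in>carrier (tgt f). \<forall>v\<in>carrier (tgt f).
        pre f u = pre f v \<longleftrightarrow> u \<squnion>\<^bsub>tgt f\<^esub> c = v \<squnion>\<^bsub>tgt f\<^esub> c)"

definition hausdorff_loc :: "'a gorder \<Rightarrow> bool" where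
  "hausdorff_loc X \<longleftrightarrow> closed_embedding (diagonal X)"

subsection \<open>Size\<close>

text \<open>The category of locales is relative to a universe of small sets, and HOL has no type of all
  frames: the elements of any type form a set, and the frames carried by subsets of a type
  \<open>'u\<close> are in general not closed under products, since a product of two locales may have more
  opens than \<open>'u\<close> has elements. The type \<open>'u\<close> is therefore used as a universe, in which a set
  is small if its powerset embeds in \<open>'u\<close>, and a locale is small if it has a small base.

  If \<open>'u\<close> has strong limit cardinality, e.g. that of a Grothendieck universe, then the small
  locales are exactly those whose frame has cardinality less than that of \<open>'u\<close>
  (\<open>small_loc_iff_strong_limit\<close>). Whatever the type \<open>'k\<close>, every locale whose frame is carried by a
  subset of \<open>'k\<close> is isomorphic to a small one carried by a subset of \<open>'k set\<close>
  (\<open>small_loc_copy\<close>), so that every frame in any type is covered by some choice of \<open>'u\<close>.\<close>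

definition is_base :: "'a gorder \<Rightarrow> 'a set \<Rightarrow> bool" where
  "is_base L B \<longleftrightarrow> B \<subseteq> carrier L \<and> (\<forall>a\<in>carrier L. \<exists>S\<subseteq>B. a = \<Squnion>\<^bsub>L\<^esub>S)"

definition small_loc :: "'u gorder \<Rightarrow> bool" where
  "small_loc X \<longleftrightarrow> (\<exists>B. is_base X B \<and> Pow B \<lesssim> (UNIV :: 'u set))"

lemma small_loc_iff_strong_limit:
  fixes X :: "'u gorder"
  assumes strong_limit: "\<And>A :: 'u set. A \<prec> (UNIV :: 'u set) \<Longrightarrow> Pow A \<prec> (UNIV :: 'u set)"
    and "frame X"
  shows "small_loc X \<longleftrightarrow> carrier X \<prec> (UNIV :: 'u set)"
proof
  assume "small_loc X"
  then obtain B where B: "is_base X B" and P: "Pow B \<lesssim> (UNIV :: 'u set)"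
    by (auto simp: small_loc_def)
  have "B \<prec> (UNIV :: 'u set)"
  proof (rule ccontr)
    assume "\<not> B \<prec> (UNIV :: 'u set)"
    then have "B \<approx> (UNIV :: 'u set)"
      by (simp add: lesspoll_def subset_imp_lepoll lepoll_antisym)
    then have "Pow B \<lesssim> B"
      using P eqpoll_sym lepoll_trans2 by blast
    then show False
      using lesspoll_Pow_self lesspoll_def lepoll_antisym by blast
  qed
  moreover have "carrier X \<lesssim> Pow B"
  proof -
    have "carrier X \<subseteq> (\<lambda>S. \<Squnion>\<^bsub>X\<^esub>S) ` Pow B"
      using B by (fastforce simp: is_base_def)
    then show ?thesis
      by (meson image_lepoll lepoll_trans subset_imp_lepoll)
  qed
  ultimately show "carrier X \<prec> (UNIV :: 'u set)"
    using strong_limit lesspoll_trans1 by blast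
next
  interpret frame X by fact
  assume "carrier X \<prec> (UNIV :: 'u set)"
  then have "Pow (carrier X) \<lesssim> (UNIV :: 'u set)"
    using strong_limit lesspoll_imp_lepoll by blast
  moreover have "is_base X (carrier X)"
    unfolding is_base_def
  proof (intro conjI ballI exI)
    fix a assume a: "a \<in> carrier X"
    show "{a} \<subseteq> carrier X" "a = \<Squnion>\<^bsub>X\<^esub>{a}"
      using a sup_of_singleton by auto
  qed auto
  ultimately show "small_loc X"
    by (auto simp: small_loc_def)
qed

lemma small_loc_copy:
  fixes X :: "'k gorder"
  assumes "frame X"
  shows "\<exists>(Y :: 'k set gorder) h. frame Y \<and> small_loc Y \<and>
    bij_betw h (carrier X) (carrier Y) \<and>
    (\<forall>a\<in>carrier X. \<forall>b\<in>carrier X. a \<sqsubseteq>\<^bsub>X\<^esub> b \<longleftrightarrow> h a \<sqsubseteq>\<^bsub>Y\<^esub> h b)"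
proof -
  interpret X: frame X by fact
  define h :: "'k \<Rightarrow> 'k set" where "h = (\<lambda>a. {a})"
  define Y :: "'k set gorder" where "Y = \<lparr>carrier = h ` carrier X, eq = (=),
    le = (\<lambda>A B. the_elem A \<sqsubseteq>\<^bsub>X\<^esub> the_elem B)\<rparr>"
  have cY: "carrier Y = h ` carrier X" and eqY: "eq Y = (=)"
    and le: "h a \<sqsubseteq>\<^bsub>Y\<^esub> h b \<longleftrightarrow> a \<sqsubseteq>\<^bsub>X\<^esub> b" for a b
    by (simp_all add: Y_def h_def)
  have inj: "inj h"
    by (simp add: h_def inj_def)
  have po: "partial_order Y"
    by unfold_locales (auto simp: cY eqY le intro: X.le_trans dest: X.le_antisym)
  interpret Y: partial_order Y by (rule po)
  have Upper_h: "Upper Y (h ` A) = h ` Upper X A" if "A \<subseteq> carrier X" for A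
  proof -
    have "Upper Y (h ` A) = {u \<in> h ` carrier X. \<forall>a\<in>A. h a \<sqsubseteq>\<^bsub>Y\<^esub> u}"
    proof -
      have "h ` A \<inter> h ` carrier X = h ` A"
        using image_mono[OF that, of h] by (rule Int_absorb2)
      then show ?thesis
        unfolding Upper_def cY by (simp add: Collect_conj_eq Int_commute flip: Ball_def)
    qed
    also have "\<dots> = h ` Upper X A"
    proof -
      have "A \<inter> carrier X = A"
        using that by (rule Int_absorb2)
      then show ?thesis
        unfolding Upper_def by (auto simp: le)
    qed
    finally show ?thesis .
  qed
  have Lower_h: "Lower Y (h ` A) = h ` Lower X A" if "A \<subseteq> carrier X" for A
  proof -
    have "Lower Y (h ` A) = {u \<in> h ` carrier X. \<forall>a\<in>A. u \<sqsubseteq>\<^bsub>Y\<^esub> h a}"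
    proof -
      have "h ` A \<inter> h ` carrier X = h ` A"
        using image_mono[OF that, of h] by (rule Int_absorb2)
      then show ?thesis
        unfolding Lower_def cY by (simp add: Collect_conj_eq Int_commute flip: Ball_def)
    qed
    also have "\<dots> = h ` Lower X A"
    proof -
      have "A \<inter> carrier X = A"
        using that by (rule Int_absorb2)
      then show ?thesis
        unfolding Lower_def by (auto simp: le)
    qed
    finally show ?thesis .
  qed
  have least_h: "least Y (h s) (h ` A)" if "least X s A" for s A
    using that by (auto simp: least_def cY le)
  have greatest_h: "greatest Y (h s) (h ` A)" if "greatest X s A" for s A
    using that by (auto simp: greatest_def cY le)
  have lub: "least Y (h (\<Squnion>\<^bsub>X\<^esub>A)) (Upper Y (h ` A))" if "A \<subseteq> carrier X" for A
    using least_h[OF X.supI[of A "\<lambda>l. least X l (Upper X A)", OF _ that]] Upper_h[OF that] by simp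
  have glb: "greatest Y (h (\<Sqinter>\<^bsub>X\<^esub>A)) (Lower Y (h ` A))" if "A \<subseteq> carrier X" for A
    using greatest_h[OF X.infI[of A "\<lambda>l. greatest X l (Lower X A)", OF _ that]] Lower_h[OF that] by simp
  have cl: "complete_lattice Y"
  proof
    fix A assume "A \<subseteq> carrier Y"
    then obtain A' where A': "A' \<subseteq> carrier X" "A = h ` A'"
      by (auto simp: cY subset_image_iff)
    show "\<exists>s. least Y s (Upper Y A)" "\<exists>i. greatest Y i (Lower Y A)"
      using lub[OF A'(1)] glb[OF A'(1)] A'(2) by blast+
  qed
  interpret Y: complete_lattice Y by (rule cl)
  have Sup_h: "\<Squnion>\<^bsub>Y\<^esub>(h ` A) = h (\<Squnion>\<^bsub>X\<^esub>A)" if "A \<subseteq> carrier X" for A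
  proof (rule Y.supI)
    show "l = h (\<Squnion>\<^bsub>X\<^esub>A)" if "least Y l (Upper Y (h ` A))" for l
      using Y.least_unique[OF that lub[OF \<open>A \<subseteq> carrier X\<close>]] .
  qed (use that cY in blast)
  have Inf_h: "\<Sqinter>\<^bsub>Y\<^esub>(h ` A) = h (\<Sqinter>\<^bsub>X\<^esub>A)" if "A \<subseteq> carrier X" for A
  proof (rule Y.infI)
    show "l = h (\<Sqinter>\<^bsub>X\<^esub>A)" if "greatest Y l (Lower Y (h ` A))" for l
      using Y.greatest_unique[OF that glb[OF \<open>A \<subseteq> carrier X\<close>]] .
  qed (use that cY in blast)
  have meet_h: "h a \<sqinter>\<^bsub>Y\<^esub> h b = h (a \<sqinter>\<^bsub>X\<^esub> b)" if "a \<in> carrier X" "b \<in> carrier X" for a b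
    using Inf_h[of "{a, b}"] that by (simp add: meet_def)
  have "frame Y"
  proof
    fix a S assume "a \<in> carrier Y" "S \<subseteq> carrier Y"
    then obtain a' S' where *: "a' \<in> carrier X" "S' \<subseteq> carrier X" "a = h a'" "S = h ` S'"
      by (auto simp: cY subset_image_iff)
    have "(\<lambda>s. a \<sqinter>\<^bsub>Y\<^esub> s) ` S = h ` ((\<lambda>s. a' \<sqinter>\<^bsub>X\<^esub> s) ` S')"
      unfolding * image_image by (rule image_cong) (use * meet_h in auto)
    moreover have "(\<lambda>s. a' \<sqinter>\<^bsub>X\<^esub> s) ` S' \<subseteq> carrier X"
      using * by auto
    ultimately show "a \<sqinter>\<^bsub>Y\<^esub> \<Squnion>\<^bsub>Y\<^esub>S = \<Squnion>\<^bsub>Y\<^esub>((\<lambda>s. a \<sqinter>\<^bsub>Y\<^esub> s) ` S)"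
      using * by (simp add: Sup_h meet_h X.inf_Sup_distrib)
  qed
  moreover have "small_loc Y"
    unfolding small_loc_def
  proof (intro exI conjI)
    show "is_base Y (carrier Y)"
      unfolding is_base_def
    proof (intro conjI ballI exI)
      fix a assume a: "a \<in> carrier Y"
      show "{a} \<subseteq> carrier Y" "a = \<Squnion>\<^bsub>Y\<^esub>{a}"
        using a Y.sup_of_singleton by auto
    qed auto
    show "Pow (carrier Y) \<lesssim> (UNIV :: 'k set set)"
    proof -
      have "Pow (carrier Y) \<subseteq> (\<lambda>A. h ` A) ` UNIV"
        unfolding cY by (blast elim: subset_imageE)
      then show ?thesis
        by (meson image_lepoll lepoll_trans subset_imp_lepoll)
    qed
  qed
  moreover have "bij_betw h (carrier X) (carrier Y)"
    using inj by (auto simp: bij_betw_def cY intro: inj_on_subset)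
  ultimately show ?thesis
    using le by blast
qed

section \<open>The category of compact Hausdorff locales\<close>

definition CHausLoc :: "('u gorder, ('u, 'u) locmap) cat" where
  "CHausLoc =
     (let Ob = {X. frame X \<and> compact_loc X \<and> hausdorff_loc X \<and> small_loc X} in
      \<lparr>Obj = Ob,
       Arr = {f. locale_map f \<and> src f \<in> Ob \<and> tgt f \<in> Ob},
       Dom = src,
       Cod = tgt,
       Id = loc_id,
       Comp = loc_comp\<rparr>)"

end

theory Submission
  imports Defs "HOL-Analysis.Urysohn"
begin

text \<open>
  With the axiom of choice, \<open>CHausLoc\<close> is equivalent to the category of those compact Hausdorff
  spaces that have a base \<open>B\<close> with \<open>Pow B\<close> embedded in the universe \<open>'u\<close>, and the theorem is
  proved by carrying the familiar arguments for compact Hausdorff spaces over this equivalence.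

  A compact locale with closed diagonal is regular: every open is the supremum of the opens well
  inside it (\<open>regular_frame_if_compact_hausdorff\<close>). For a compact regular frame, Zorn's lemma
  provides enough maximal elements below \<open>\<top>\<close>, and these are the points of the locale; so the frame
  is the frame of opens of a compact Hausdorff space of points
  (\<open>opens_at_subset_iff\<close>, \<open>compact_space_of\<close>, \<open>Hausdorff_space_of\<close>). Maps of locales correspond
  bijectively to continuous maps of these spaces (\<open>locmap_eqI\<close>, \<open>ex_locmap\<close>). As the points are
  themselves elements of the frame, all these spaces live on the type \<open>'u\<close>.

  Conversely, the opens of a compact Hausdorff space form a regular frame, and a regular frame has
  a closed diagonal (\<open>hausdorff_if_regular_frame\<close>). If the space has a base \<open>B\<close> with \<open>Pow B\<close>
  embedded in \<open>'u\<close>, then there are at most as many opens as elements of \<open>'u\<close>, and the frame can be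
  copied into \<open>'u\<close>, whatever the type of the points of the space (\<open>ex_locale_of_space\<close>).
  This smallness condition passes to subspaces, to finite products, and to Hausdorff quotients of
  compact spaces; the infinity of \<open>'u\<close> is what makes the cardinal arithmetic work.

  Barr-exactness is then checked on points. A finite limit is a closed subspace of a finite
  product. The image of a map is a closed subspace of the codomain, through which the map factors by
  a surjection, and a surjection is the coequalizer of its kernel pair because a continuous
  surjection of compact Hausdorff spaces is a quotient map. Hence the regular epimorphisms are
  exactly the maps that are surjective on points, and they are stable under pullback. Finally, an
  internal equivalence relation is, on points, a closed equivalence relation; its quotient space is
  again compact Hausdorff, and the relation is the kernel pair of the quotient map.
\<close>

section \<open>Frames\<close>

context frame
begin

lemma Sup_empty: "\<Squnion>{} = \<bottom>"
  using weak_sup_empty eq_is_equal by simp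

lemma join_eq_Sup: "\<Squnion>{a, b} = a \<squnion> b"
  by (simp add: join_def)

lemma le_top: "a \<in> carrier L \<Longrightarrow> a \<sqsubseteq> \<top>"
  by simp

lemma top_le_iff: "a \<in> carrier L \<Longrightarrow> \<top> \<sqsubseteq> a \<longleftrightarrow> a = \<top>"
  using le_antisym le_refl by auto

lemma le_bot_iff: "a \<in> carrier L \<Longrightarrow> a \<sqsubseteq> \<bottom> \<longleftrightarrow> a = \<bottom>"
  using le_antisym le_refl by auto

lemma le_meet_iff:
  "\<lbrakk>a \<in> carrier L; b \<in> carrier L; c \<in> carrier L\<rbrakk> \<Longrightarrow> c \<sqsubseteq> a \<sqinter> b \<longleftrightarrow> c \<sqsubseteq> a \<and> c \<sqsubseteq> b"
  by (meson le_trans meet_closed meet_le meet_left meet_right)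

lemma join_le_iff:
  "\<lbrakk>a \<in> carrier L; b \<in> carrier L; c \<in> carrier L\<rbrakk> \<Longrightarrow> a \<squnion> b \<sqsubseteq> c \<longleftrightarrow> a \<sqsubseteq> c \<and> b \<sqsubseteq> c"
  by (meson le_trans join_closed join_le join_left join_right)

lemma Sup_le_iff:
  "\<lbrakk>S \<subseteq> carrier L; c \<in> carrier L\<rbrakk> \<Longrightarrow> \<Squnion>S \<sqsubseteq> c \<longleftrightarrow> (\<forall>s\<in>S. s \<sqsubseteq> c)"
  by (meson le_trans subsetD sup_closed sup_least sup_upper)

lemma Sup_mono:
  "\<lbrakk>S \<subseteq> T; T \<subseteq> carrier L\<rbrakk> \<Longrightarrow> \<Squnion>S \<sqsubseteq> \<Squnion>T"
  by (rule sup_least) (auto intro: sup_upper)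

lemma meet_mono:
  "\<lbrakk>a \<sqsubseteq> a'; b \<sqsubseteq> b'; a \<in> carrier L; a' \<in> carrier L; b \<in> carrier L; b' \<in> carrier L\<rbrakk>
    \<Longrightarrow> a \<sqinter> b \<sqsubseteq> a' \<sqinter> b'"
  by (rule meet_le) (auto intro: le_trans[OF meet_left] le_trans[OF meet_right])

lemma join_mono:
  "\<lbrakk>a \<sqsubseteq> a'; b \<sqsubseteq> b'; a \<in> carrier L; a' \<in> carrier L; b \<in> carrier L; b' \<in> carrier L\<rbrakk>
    \<Longrightarrow> a \<squnion> b \<sqsubseteq> a' \<squnion> b'"
  by (rule join_le) (auto intro: le_trans[OF _ join_left] le_trans[OF _ join_right])

lemma meet_absorb: "\<lbrakk>a \<sqsubseteq> b; a \<in> carrier L; b \<in> carrier L\<rbrakk> \<Longrightarrow> a \<sqinter> b = a"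
  using le_iff_join by simp

lemma meet_top: "a \<in> carrier L \<Longrightarrow> a \<sqinter> \<top> = a"
  by (simp add: meet_absorb)

lemma meet_bot: "a \<in> carrier L \<Longrightarrow> a \<sqinter> \<bottom> = \<bottom>"
  by (metis bottom_closed bottom_lower meet_absorb meet_comm)

lemma join_bot: "a \<in> carrier L \<Longrightarrow> a \<squnion> \<bottom> = a"
  by (metis bottom_closed bottom_lower join_comm le_iff_meet)

lemma bot_join: "a \<in> carrier L \<Longrightarrow> \<bottom> \<squnion> a = a"
  by (simp add: join_comm[of _ \<bottom>] join_bot)

lemma bot_meet: "a \<in> carrier L \<Longrightarrow> \<bottom> \<sqinter> a = \<bottom>"
  by (simp add: meet_comm[of _ \<bottom>] meet_bot)

lemma join_top: "a \<in> carrier L \<Longrightarrow> a \<squnion> \<top> = \<top>"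
  by (metis top_closed le_top le_iff_meet)

lemma meet_join_distrib:
  assumes "a \<in> carrier L" "b \<in> carrier L" "c \<in> carrier L"
  shows "a \<sqinter> (b \<squnion> c) = (a \<sqinter> b) \<squnion> (a \<sqinter> c)"
  using inf_Sup_distrib[of a "{b, c}"] assms by (simp add: join_eq_Sup)

lemma Sup_meet_le:
  assumes "a \<in> carrier L" "S \<subseteq> carrier L" "c \<in> carrier L" "\<And>s. s \<in> S \<Longrightarrow> a \<sqinter> s \<sqsubseteq> c"
  shows "a \<sqinter> \<Squnion>S \<sqsubseteq> c"
proof -
  have "(\<lambda>s. a \<sqinter> s) ` S \<subseteq> carrier L"
    using assms by auto
  then show ?thesis
    using assms by (simp add: inf_Sup_distrib Sup_le_iff)
qed

lemma join_eq_top_mono: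
  "\<lbrakk>a \<squnion> b = \<top>; a \<sqsubseteq> a'; b \<sqsubseteq> b'; a \<in> carrier L; a' \<in> carrier L; b \<in> carrier L; b' \<in> carrier L\<rbrakk>
    \<Longrightarrow> a' \<squnion> b' = \<top>"
  using join_mono[of a a' b b'] top_le_iff[of "a' \<squnion> b'"] by simp

lemma meet_eq_bot_mono:
  "\<lbrakk>a \<sqinter> b = \<bottom>; a' \<sqsubseteq> a; b' \<sqsubseteq> b; a \<in> carrier L; a' \<in> carrier L; b \<in> carrier L; b' \<in> carrier L\<rbrakk>
    \<Longrightarrow> a' \<sqinter> b' = \<bottom>"
  using meet_mono[of a' a b' b] le_bot_iff[of "a' \<sqinter> b'"] by simp

end

lemma directed_finite_Sups:
  assumes "frame X" "S \<subseteq> carrier X"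
  defines "D \<equiv> {\<Squnion>\<^bsub>X\<^esub>F |F. finite F \<and> F \<subseteq> S}"
  shows "directed_in X D" "\<Squnion>\<^bsub>X\<^esub>D = \<Squnion>\<^bsub>X\<^esub>S"
proof -
  interpret frame X by fact
  have sub: "F \<subseteq> carrier X" if "F \<subseteq> S" for F
    using that assms by blast
  then have D: "D \<subseteq> carrier X"
    by (auto simp: D_def)
  show "directed_in X D"
    unfolding directed_in_def
  proof (intro conjI ballI D)
    fix a b assume "a \<in> D" "b \<in> D"
    then obtain F G where "finite F" "F \<subseteq> S" "a = \<Squnion>\<^bsub>X\<^esub>F" "finite G" "G \<subseteq> S" "b = \<Squnion>\<^bsub>X\<^esub>G"
      unfolding D_def by blast
    then show "\<exists>c\<in>D. a \<sqsubseteq>\<^bsub>X\<^esub> c \<and> b \<sqsubseteq>\<^bsub>X\<^esub> c"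
      using sub[of "F \<union> G"]
      by (intro bexI[of _ "\<Squnion>\<^bsub>X\<^esub>(F \<union> G)"]) (auto simp: D_def intro!: Sup_mono)
  qed (auto simp: D_def)
  have "s \<sqsubseteq>\<^bsub>X\<^esub> \<Squnion>\<^bsub>X\<^esub>D" if "s \<in> S" for s
  proof (rule sup_upper[OF D])
    have "\<Squnion>\<^bsub>X\<^esub>{s} = s"
      using that assms by auto
    then show "s \<in> D"
      unfolding D_def using that by (intro CollectI exI[of _ "{s}"]) auto
  qed
  then have "\<Squnion>\<^bsub>X\<^esub>S \<sqsubseteq>\<^bsub>X\<^esub> \<Squnion>\<^bsub>X\<^esub>D"
    using D assms by (simp add: Sup_le_iff)
  moreover have "\<Squnion>\<^bsub>X\<^esub>D \<sqsubseteq>\<^bsub>X\<^esub> \<Squnion>\<^bsub>X\<^esub>S"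
    using D assms(2) by (subst Sup_le_iff) (auto simp: D_def intro!: Sup_mono)
  ultimately show "\<Squnion>\<^bsub>X\<^esub>D = \<Squnion>\<^bsub>X\<^esub>S"
    using D assms(2) le_antisym by auto
qed

lemma compact_loc_finite_subcover:
  assumes "frame X" "compact_loc X" "S \<subseteq> carrier X" "\<Squnion>\<^bsub>X\<^esub>S = \<top>\<^bsub>X\<^esub>"
  obtains F where "finite F" "F \<subseteq> S" "\<Squnion>\<^bsub>X\<^esub>F = \<top>\<^bsub>X\<^esub>"
proof -
  interpret frame X by fact
  have "\<top>\<^bsub>X\<^esub> \<in> {\<Squnion>\<^bsub>X\<^esub>F |F. finite F \<and> F \<subseteq> S}"
    by (rule assms(2)[unfolded compact_loc_def, rule_format])
      (use directed_finite_Sups[OF assms(1,3)] assms(4) in simp)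
  then show thesis
    using that by auto
qed

section \<open>Regular frames\<close>

text \<open>The open \<open>w\<close> is well inside \<open>a\<close>: the closure of \<open>w\<close> is contained in \<open>a\<close>. Instead of the
  pseudocomplement of \<open>w\<close>, any \<open>t\<close> disjoint from \<open>w\<close> may witness this.\<close>

definition well_inside :: "'a gorder \<Rightarrow> 'a \<Rightarrow> 'a \<Rightarrow> bool" where
  "well_inside X w a \<longleftrightarrow> w \<in> carrier X \<and>
     (\<exists>t\<in>carrier X. w \<sqinter>\<^bsub>X\<^esub> t = \<bottom>\<^bsub>X\<^esub> \<and> t \<squnion>\<^bsub>X\<^esub> a = \<top>\<^bsub>X\<^esub>)"

text \<open>Every open is covered by the opens well inside it; the converse inequality always holds.\<close>

definition regular_frame :: "'a gorder \<Rightarrow> bool" where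
  "regular_frame X \<longleftrightarrow> (\<forall>a\<in>carrier X. a \<sqsubseteq>\<^bsub>X\<^esub> \<Squnion>\<^bsub>X\<^esub>{w. well_inside X w a})"

lemma well_inside_le:
  assumes "frame X" "well_inside X w a" "a \<in> carrier X"
  shows "w \<sqsubseteq>\<^bsub>X\<^esub> a"
proof -
  interpret frame X by fact
  obtain t where t: "t \<in> carrier X" "w \<sqinter>\<^bsub>X\<^esub> t = \<bottom>\<^bsub>X\<^esub>" "t \<squnion>\<^bsub>X\<^esub> a = \<top>\<^bsub>X\<^esub>" and w: "w \<in> carrier X"
    using assms by (auto simp: well_inside_def)
  have "w = w \<sqinter>\<^bsub>X\<^esub> (t \<squnion>\<^bsub>X\<^esub> a)"
    using t w by (simp add: meet_top)
  also have "\<dots> = w \<sqinter>\<^bsub>X\<^esub> a"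
    using t w assms(3) meet_join_distrib[of w t a] by (simp only: bot_join meet_closed)
  finally show ?thesis
    using meet_right[of w a] w assms(3) by simp
qed

lemma regular_frame_separates:
  assumes "frame X" "regular_frame X" "a \<in> carrier X" "b \<in> carrier X" "\<not> a \<sqsubseteq>\<^bsub>X\<^esub> b"
  obtains w where "well_inside X w a" "\<not> w \<sqsubseteq>\<^bsub>X\<^esub> b"
proof -
  interpret frame X by fact
  have W: "{w. well_inside X w a} \<subseteq> carrier X"
    by (auto simp: well_inside_def)
  have "\<not> \<Squnion>\<^bsub>X\<^esub>{w. well_inside X w a} \<sqsubseteq>\<^bsub>X\<^esub> b"
    using assms le_trans[of a "\<Squnion>\<^bsub>X\<^esub>{w. well_inside X w a}" b] W
    unfolding regular_frame_def by auto
  then show thesis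
    using that W assms(4) by (auto simp: Sup_le_iff)
qed

subsection \<open>The product locale\<close>

text \<open>The opens of the product locale.\<close>

abbreviation prod_elements :: "'a gorder \<Rightarrow> 'b gorder \<Rightarrow> ('a \<times> 'b) set set" where
  "prod_elements X Y \<equiv> carrier (prod_loc X Y)"

lemma prod_elements_down:
  "\<lbrakk>U \<in> prod_elements X Y; (a, b) \<in> U; a' \<sqsubseteq>\<^bsub>X\<^esub> a; b' \<sqsubseteq>\<^bsub>Y\<^esub> b; a' \<in> carrier X; b' \<in> carrier Y\<rbrakk>
    \<Longrightarrow> (a', b') \<in> U"
  unfolding prod_loc_def by auto

lemma prod_elements_Sup_left:
  "\<lbrakk>U \<in> prod_elements X Y; S \<subseteq> carrier X; b \<in> carrier Y; \<And>s. s \<in> S \<Longrightarrow> (s, b) \<in> U\<rbrakk>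
    \<Longrightarrow> (\<Squnion>\<^bsub>X\<^esub>S, b) \<in> U"
  unfolding prod_loc_def by (simp add: subset_iff)

lemma prod_elements_Sup_right:
  "\<lbrakk>U \<in> prod_elements X Y; S \<subseteq> carrier Y; a \<in> carrier X; \<And>s. s \<in> S \<Longrightarrow> (a, s) \<in> U\<rbrakk>
    \<Longrightarrow> (a, \<Squnion>\<^bsub>Y\<^esub>S) \<in> U"
  unfolding prod_loc_def by (simp add: subset_iff)

lemma prod_elements_subset: "U \<in> prod_elements X Y \<Longrightarrow> U \<subseteq> carrier X \<times> carrier Y"
  unfolding prod_loc_def by simp

lemma prod_elementsI:
  assumes "U \<subseteq> carrier X \<times> carrier Y"
    and "\<And>a b a' b'. \<lbrakk>(a, b) \<in> U; a' \<in> carrier X; b' \<in> carrier Y; a' \<sqsubseteq>\<^bsub>X\<^esub> a; b' \<sqsubseteq>\<^bsub>Y\<^esub> b\<rbrakk> \<Longrightarrow> (a', b') \<in> U"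
    and "\<And>S b. \<lbrakk>S \<subseteq> carrier X; b \<in> carrier Y; \<And>s. s \<in> S \<Longrightarrow> (s, b) \<in> U\<rbrakk> \<Longrightarrow> (\<Squnion>\<^bsub>X\<^esub>S, b) \<in> U"
    and "\<And>a S. \<lbrakk>a \<in> carrier X; S \<subseteq> carrier Y; \<And>s. s \<in> S \<Longrightarrow> (a, s) \<in> U\<rbrakk> \<Longrightarrow> (a, \<Squnion>\<^bsub>Y\<^esub>S) \<in> U"
  shows "U \<in> prod_elements X Y"
proof -
  have "\<forall>(a, b)\<in>U. \<forall>a'\<in>carrier X. \<forall>b'\<in>carrier Y. a' \<sqsubseteq>\<^bsub>X\<^esub> a \<and> b' \<sqsubseteq>\<^bsub>Y\<^esub> b \<longrightarrow> (a', b') \<in> U"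
    using assms(2) by blast
  moreover have "\<forall>S\<subseteq>carrier X. \<forall>b\<in>carrier Y. S \<times> {b} \<subseteq> U \<longrightarrow> (\<Squnion>\<^bsub>X\<^esub>S, b) \<in> U"
    using assms(3) by (simp add: subset_iff)
  moreover have "\<forall>a\<in>carrier X. \<forall>S\<subseteq>carrier Y. {a} \<times> S \<subseteq> U \<longrightarrow> (a, \<Squnion>\<^bsub>Y\<^esub>S) \<in> U"
    using assms(4) by (simp add: subset_iff)
  ultimately show ?thesis
    using assms(1) by (simp add: prod_loc_def)
qed

lemma prod_elements_Inter:
  assumes "\<U> \<noteq> {}" "\<U> \<subseteq> prod_elements X Y"
  shows "\<Inter>\<U> \<in> prod_elements X Y"
proof (rule prod_elementsI)
  show "\<Inter>\<U> \<subseteq> carrier X \<times> carrier Y"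
    using assms prod_elements_subset by blast
next
  fix a b a' b'
  assume *: "(a, b) \<in> \<Inter>\<U>" "a' \<in> carrier X" "b' \<in> carrier Y" "a' \<sqsubseteq>\<^bsub>X\<^esub> a" "b' \<sqsubseteq>\<^bsub>Y\<^esub> b"
  show "(a', b') \<in> \<Inter>\<U>"
  proof
    fix U assume "U \<in> \<U>"
    then show "(a', b') \<in> U"
      using * assms(2) prod_elements_down[of U X Y a b a' b'] by auto
  qed
next
  fix S b assume *: "S \<subseteq> carrier X" "b \<in> carrier Y" "\<And>s. s \<in> S \<Longrightarrow> (s, b) \<in> \<Inter>\<U>"
  show "(\<Squnion>\<^bsub>X\<^esub>S, b) \<in> \<Inter>\<U>"
  proof
    fix U assume "U \<in> \<U>"
    then show "(\<Squnion>\<^bsub>X\<^esub>S, b) \<in> U"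
      using * assms(2) prod_elements_Sup_left[of U X Y S b] by auto
  qed
next
  fix a S assume *: "a \<in> carrier X" "S \<subseteq> carrier Y" "\<And>s. s \<in> S \<Longrightarrow> (a, s) \<in> \<Inter>\<U>"
  show "(a, \<Squnion>\<^bsub>Y\<^esub>S) \<in> \<Inter>\<U>"
  proof
    fix U assume "U \<in> \<U>"
    then show "(a, \<Squnion>\<^bsub>Y\<^esub>S) \<in> U"
      using * assms(2) prod_elements_Sup_right[of U X Y S a] by auto
  qed
qed

lemma prod_elements_full:
  assumes "frame X" "frame Y"
  shows "carrier X \<times> carrier Y \<in> prod_elements X Y"
proof -
  interpret X: frame X by fact
  interpret Y: frame Y by fact
  show ?thesis
    by (rule prod_elementsI) auto
qed

text \<open>The product elements are closed under intersections, so the join of two of them is the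
  least product element containing both.\<close>

lemma prod_join:
  assumes "frame X" "frame Y" "U \<in> prod_elements X Y" "V \<in> prod_elements X Y"
  defines "J \<equiv> \<Inter>{W \<in> prod_elements X Y. U \<subseteq> W \<and> V \<subseteq> W}"
  shows "J \<in> prod_elements X Y" "U \<squnion>\<^bsub>prod_loc X Y\<^esub> V = J"
proof -
  let ?P = "prod_loc X Y"
  have le: "le ?P = (\<subseteq>)"
    by (simp add: prod_loc_def)
  show J: "J \<in> carrier ?P"
    unfolding J_def
  proof (rule prod_elements_Inter)
    show "{W \<in> prod_elements X Y. U \<subseteq> W \<and> V \<subseteq> W} \<noteq> {}"
      using prod_elements_full[OF assms(1,2)] assms(3,4) prod_elements_subset by blast
  qed blast
  have Upper: "Upper ?P {U, V} = {W \<in> carrier ?P. U \<subseteq> W \<and> V \<subseteq> W}"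
    using assms(3,4) by (auto simp: Upper_def le)
  have "J \<in> Upper ?P {U, V}"
    using J unfolding Upper J_def by blast
  moreover have "J \<subseteq> W" if "W \<in> Upper ?P {U, V}" for W
    using that unfolding Upper J_def by blast
  ultimately have "least ?P W (Upper ?P {U, V}) \<longleftrightarrow> W = J" for W
    unfolding least_def le by (auto simp: Upper)
  then show "U \<squnion>\<^bsub>prod_loc X Y\<^esub> V = J"
    by (simp add: join_def sup_def)
qed

lemma prod_join_upper:
  assumes "frame X" "frame Y" "U \<in> prod_elements X Y" "V \<in> prod_elements X Y"
  shows "U \<subseteq> U \<squnion>\<^bsub>prod_loc X Y\<^esub> V" "V \<subseteq> U \<squnion>\<^bsub>prod_loc X Y\<^esub> V"
    "U \<squnion>\<^bsub>prod_loc X Y\<^esub> V \<in> prod_elements X Y"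
  using prod_join(1)[OF assms] unfolding prod_join(2)[OF assms] by blast+

lemma prod_join_least:
  assumes "frame X" "frame Y" "U \<in> prod_elements X Y" "V \<in> prod_elements X Y"
    "W \<in> prod_elements X Y" "U \<subseteq> W" "V \<subseteq> W"
  shows "U \<squnion>\<^bsub>prod_loc X Y\<^esub> V \<subseteq> W"
  unfolding prod_join(2)[OF assms(1-4)] using assms by blast

lemma diagonal_simps:
  "src (diagonal X) = X" "tgt (diagonal X) = prod_loc X X"
  by (simp_all add: diagonal_def loc_pair_def loc_id_def)

lemma pre_diagonal:
  assumes "U \<in> prod_elements X X"
  shows "pre (diagonal X) U = \<Squnion>\<^bsub>X\<^esub>{a \<sqinter>\<^bsub>X\<^esub> b |a b. (a, b) \<in> U}"
proof -
  have "(\<lambda>(a, b). pre (loc_id X) a \<sqinter>\<^bsub>X\<^esub> pre (loc_id X) b) ` U = {a \<sqinter>\<^bsub>X\<^esub> b |a b. (a, b) \<in> U}"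
    using prod_elements_subset[OF assms] by (force simp: loc_id_def image_def)
  then show ?thesis
    using assms by (simp add: diagonal_def loc_pair_def) (simp add: loc_id_def)
qed

text \<open>The open rectangles \<open>a \<times> 1\<close> and \<open>1 \<times> a\<close>. Pulling back either of them along the diagonal
  gives \<open>a\<close>.\<close>

lemma strip_left_element:
  assumes "frame X" "a \<in> carrier X"
  defines "U \<equiv> {(x, y) \<in> carrier X \<times> carrier X. x \<sqsubseteq>\<^bsub>X\<^esub> a \<or> y = \<bottom>\<^bsub>X\<^esub>}"
  shows "U \<in> prod_elements X X" "pre (diagonal X) U = a"
proof -
  interpret frame X by fact
  show U: "U \<in> prod_elements X X"
  proof (rule prod_elementsI)
    fix S b assume S: "S \<subseteq> carrier X" "b \<in> carrier X" "\<And>s. s \<in> S \<Longrightarrow> (s, b) \<in> U"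
    then show "(\<Squnion>\<^bsub>X\<^esub>S, b) \<in> U"
      using assms(2) by (auto simp: U_def Sup_le_iff)
  next
    fix x S assume S: "x \<in> carrier X" "S \<subseteq> carrier X" "\<And>s. s \<in> S \<Longrightarrow> (x, s) \<in> U"
    show "(x, \<Squnion>\<^bsub>X\<^esub>S) \<in> U"
    proof (cases "x \<sqsubseteq>\<^bsub>X\<^esub> a")
      case False
      then have "\<Squnion>\<^bsub>X\<^esub>S \<sqsubseteq>\<^bsub>X\<^esub> \<bottom>\<^bsub>X\<^esub>"
        using S by (auto simp: U_def Sup_le_iff)
      then show ?thesis
        using S le_bot_iff by (simp add: U_def)
    qed (use S in \<open>simp add: U_def\<close>)
  qed (use assms(2) le_trans le_bot_iff in \<open>auto simp: U_def\<close>)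
  have sub: "{x \<sqinter>\<^bsub>X\<^esub> y |x y. (x, y) \<in> U} \<subseteq> carrier X"
    by (auto simp: U_def)
  have "\<Squnion>\<^bsub>X\<^esub>{x \<sqinter>\<^bsub>X\<^esub> y |x y. (x, y) \<in> U} \<sqsubseteq>\<^bsub>X\<^esub> a"
    unfolding Sup_le_iff[OF sub assms(2)]
    using assms(2) by (auto simp: U_def meet_bot intro: le_trans[OF meet_left])
  moreover have "a \<sqsubseteq>\<^bsub>X\<^esub> \<Squnion>\<^bsub>X\<^esub>{x \<sqinter>\<^bsub>X\<^esub> y |x y. (x, y) \<in> U}"
  proof (rule sup_upper[OF sub])
    show "a \<in> {x \<sqinter>\<^bsub>X\<^esub> y |x y. (x, y) \<in> U}"
      using assms(2) meet_top[of a]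
      by (intro CollectI exI[of _ a] exI[of _ "\<top>\<^bsub>X\<^esub>"]) (simp add: U_def)
  qed
  ultimately show "pre (diagonal X) U = a"
    unfolding pre_diagonal[OF U] using assms(2) sub le_antisym by simp
qed

lemma strip_right_element:
  assumes "frame X" "a \<in> carrier X"
  defines "U \<equiv> {(x, y) \<in> carrier X \<times> carrier X. x = \<bottom>\<^bsub>X\<^esub> \<or> y \<sqsubseteq>\<^bsub>X\<^esub> a}"
  shows "U \<in> prod_elements X X" "pre (diagonal X) U = a"
proof -
  interpret frame X by fact
  show U: "U \<in> prod_elements X X"
  proof (rule prod_elementsI)
    fix x S assume S: "x \<in> carrier X" "S \<subseteq> carrier X" "\<And>s. s \<in> S \<Longrightarrow> (x, s) \<in> U"
    then show "(x, \<Squnion>\<^bsub>X\<^esub>S) \<in> U"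
      using assms(2) by (auto simp: U_def Sup_le_iff)
  next
    fix S b assume S: "S \<subseteq> carrier X" "b \<in> carrier X" "\<And>s. s \<in> S \<Longrightarrow> (s, b) \<in> U"
    show "(\<Squnion>\<^bsub>X\<^esub>S, b) \<in> U"
    proof (cases "b \<sqsubseteq>\<^bsub>X\<^esub> a")
      case False
      then have "\<Squnion>\<^bsub>X\<^esub>S \<sqsubseteq>\<^bsub>X\<^esub> \<bottom>\<^bsub>X\<^esub>"
        using S by (auto simp: U_def Sup_le_iff)
      then show ?thesis
        using S le_bot_iff by (simp add: U_def)
    qed (use S in \<open>simp add: U_def\<close>)
  qed (use assms(2) le_trans le_bot_iff in \<open>auto simp: U_def\<close>)
  have sub: "{x \<sqinter>\<^bsub>X\<^esub> y |x y. (x, y) \<in> U} \<subseteq> carrier X"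
    by (auto simp: U_def)
  have "\<Squnion>\<^bsub>X\<^esub>{x \<sqinter>\<^bsub>X\<^esub> y |x y. (x, y) \<in> U} \<sqsubseteq>\<^bsub>X\<^esub> a"
    unfolding Sup_le_iff[OF sub assms(2)]
    using assms(2) by (auto simp: U_def bot_meet intro: le_trans[OF meet_right])
  moreover have "a \<sqsubseteq>\<^bsub>X\<^esub> \<Squnion>\<^bsub>X\<^esub>{x \<sqinter>\<^bsub>X\<^esub> y |x y. (x, y) \<in> U}"
  proof (rule sup_upper[OF sub])
    show "a \<in> {x \<sqinter>\<^bsub>X\<^esub> y |x y. (x, y) \<in> U}"
      using assms(2) meet_top[of a] meet_comm[of X a]
      by (intro CollectI exI[of _ "\<top>\<^bsub>X\<^esub>"] exI[of _ a]) (simp add: U_def)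
  qed
  ultimately show "pre (diagonal X) U = a"
    unfolding pre_diagonal[OF U] using assms(2) sub le_antisym by simp
qed

text \<open>The largest open of \<open>X \<times> X\<close> whose pullback along the diagonal is at most \<open>c\<close>. For
  \<open>c = \<bottom>\<close> it is the complement of the diagonal.\<close>

lemma meet_le_element:
  assumes "frame X" "c \<in> carrier X"
  shows "{(x, y) \<in> carrier X \<times> carrier X. x \<sqinter>\<^bsub>X\<^esub> y \<sqsubseteq>\<^bsub>X\<^esub> c} \<in> prod_elements X X" (is "?U \<in> _")
proof -
  interpret frame X by fact
  show ?thesis
  proof (rule prod_elementsI)
    fix a b a' b'
    assume "(a, b) \<in> ?U" "a' \<in> carrier X" "b' \<in> carrier X" "a' \<sqsubseteq>\<^bsub>X\<^esub> a" "b' \<sqsubseteq>\<^bsub>X\<^esub> b"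
    then show "(a', b') \<in> ?U"
      using assms(2) le_trans[OF meet_mono[of a' a b' b]] by simp
  next
    fix S b assume "S \<subseteq> carrier X" "b \<in> carrier X" "\<And>s. s \<in> S \<Longrightarrow> (s, b) \<in> ?U"
    then show "(\<Squnion>\<^bsub>X\<^esub>S, b) \<in> ?U"
      using Sup_meet_le[of b S c] assms(2) meet_comm[of X b] by auto
  next
    fix a S assume "a \<in> carrier X" "S \<subseteq> carrier X" "\<And>s. s \<in> S \<Longrightarrow> (a, s) \<in> ?U"
    then show "(a, \<Squnion>\<^bsub>X\<^esub>S) \<in> ?U"
      using Sup_meet_le[of a S c] assms(2) by auto
  qed auto
qed

lemma pre_diagonal_le_iff:
  assumes "frame X" "c \<in> carrier X" "U \<in> prod_elements X X"
  shows "pre (diagonal X) U \<sqsubseteq>\<^bsub>X\<^esub> c \<longleftrightarrow> (\<forall>(a, b)\<in>U. a \<sqinter>\<^bsub>X\<^esub> b \<sqsubseteq>\<^bsub>X\<^esub> c)"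
proof -
  interpret frame X by fact
  have "{a \<sqinter>\<^bsub>X\<^esub> b |a b. (a, b) \<in> U} \<subseteq> carrier X"
    using prod_elements_subset[OF assms(3)] by auto
  then show ?thesis
    unfolding pre_diagonal[OF assms(3)] by (subst Sup_le_iff) (use assms(2) in blast)+
qed

lemma pre_diagonal_closed:
  assumes "frame X" "U \<in> prod_elements X X"
  shows "pre (diagonal X) U \<in> carrier X"
proof -
  interpret frame X by fact
  have "{a \<sqinter>\<^bsub>X\<^esub> b |a b. (a, b) \<in> U} \<subseteq> carrier X"
    using prod_elements_subset[OF assms(2)] by auto
  then show ?thesis
    unfolding pre_diagonal[OF assms(2)] by simp
qed


subsection \<open>Compact Hausdorff locales are regular\<close>

text \<open>Let \<open>c\<close> be the open complement of the diagonal. As \<open>a \<times> 1\<close> and \<open>1 \<times> a\<close> agree on the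
  diagonal, \<open>a \<times> 1 \<subseteq> (1 \<times> a) \<squnion> c\<close>. It therefore suffices to find an open \<open>V\<close> of \<open>X \<times> X\<close> that
  contains \<open>1 \<times> a\<close> and \<open>c\<close>, and in which \<open>(a, \<top>)\<close> can only lie if \<open>a\<close> is covered by the opens
  well inside it. With \<open>\<psi> e\<close> the supremum of the opens well inside \<open>e \<squnion> a\<close>, let \<open>V\<close> consist of the
  \<open>(x, y)\<close> such that \<open>x \<sqinter> \<psi> (y \<squnion> e) \<sqsubseteq> \<psi> e\<close> for all \<open>e\<close>. Compactness of \<open>X\<close> is what makes \<open>V\<close>
  closed under suprema in the second variable.\<close>

theorem regular_frame_if_compact_hausdorff:
  assumes "frame X" "compact_loc X" "hausdorff_loc X"
  shows "regular_frame X"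
  unfolding regular_frame_def
proof
  interpret frame X by fact
  fix a assume a: "a \<in> carrier X"
  let ?P = "prod_loc X X" and ?\<Delta> = "pre (diagonal X)"
  let ?bot = "\<bottom>\<^bsub>X\<^esub>" and ?top = "\<top>\<^bsub>X\<^esub>"
  obtain c where c: "c \<in> prod_elements X X"
    and c_iff: "\<And>U V. \<lbrakk>U \<in> prod_elements X X; V \<in> prod_elements X X\<rbrakk>
      \<Longrightarrow> ?\<Delta> U = ?\<Delta> V \<longleftrightarrow> U \<squnion>\<^bsub>?P\<^esub> c = V \<squnion>\<^bsub>?P\<^esub> c"
    using assms(3) unfolding hausdorff_loc_def closed_embedding_def diagonal_simps by blast
  define A where "A = {(x, y) \<in> carrier X \<times> carrier X. x \<sqsubseteq>\<^bsub>X\<^esub> a \<or> y = ?bot}"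
  define B where "B = {(x, y) \<in> carrier X \<times> carrier X. x = ?bot \<or> y \<sqsubseteq>\<^bsub>X\<^esub> a}"
  define Z where "Z = {(x, y) \<in> carrier X \<times> carrier X. x \<sqsubseteq>\<^bsub>X\<^esub> ?bot \<or> y = ?bot}"
  have A: "A \<in> prod_elements X X" "?\<Delta> A = a"
    unfolding A_def using strip_left_element[OF assms(1) a] by blast+
  have B: "B \<in> prod_elements X X" "?\<Delta> B = a"
    unfolding B_def using strip_right_element[OF assms(1) a] by blast+
  have Z: "Z \<in> prod_elements X X" "?\<Delta> Z = ?bot"
    unfolding Z_def using strip_left_element[OF assms(1) bottom_closed] by blast+

  \<comment> \<open>The complement of the diagonal contains only rectangles with disjoint sides.\<close>
  have c_disjoint: "x \<sqinter>\<^bsub>X\<^esub> y = ?bot" if "(x, y) \<in> c" for x y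
  proof -
    have xy: "x \<in> carrier X" "y \<in> carrier X"
      using that prod_elements_subset[OF c] by auto
    have "Z \<subseteq> c"
    proof
      fix z assume "z \<in> Z"
      then obtain x y where z: "z = (x, y)" "x \<in> carrier X" "y \<in> carrier X" "x = ?bot \<or> y = ?bot"
        by (auto simp: Z_def le_bot_iff)
      have "(?bot, y) \<in> c" "(x, ?bot) \<in> c"
        using prod_elements_Sup_left[OF c, of "{}" y] prod_elements_Sup_right[OF c, of "{}" x] z
        by (simp_all add: Sup_empty)
      then show "z \<in> c"
        using z by auto
    qed
    then have "Z \<squnion>\<^bsub>?P\<^esub> c = c" "c \<squnion>\<^bsub>?P\<^esub> c = c"
      using prod_join_upper(2)[OF assms(1,1) Z(1) c] prod_join_least[OF assms(1,1) Z(1) c c]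
        prod_join_upper(2)[OF assms(1,1) c c] prod_join_least[OF assms(1,1) c c c] by auto
    then have "?\<Delta> c = ?bot"
      using c_iff[OF c Z(1)] Z(2) by simp
    then have "x \<sqinter>\<^bsub>X\<^esub> y \<sqsubseteq>\<^bsub>X\<^esub> ?bot"
      using pre_diagonal_le_iff[OF assms(1) bottom_closed c] that by auto
    then show ?thesis
      using le_bot_iff xy by simp
  qed

  define W where "W e = {w \<in> carrier X. \<exists>t\<in>carrier X. w \<sqinter>\<^bsub>X\<^esub> t = ?bot \<and> t \<squnion>\<^bsub>X\<^esub> (e \<squnion>\<^bsub>X\<^esub> a) = ?top}" for e
  define \<psi> where "\<psi> e = \<Squnion>\<^bsub>X\<^esub>W e" for e
  have W: "W e \<subseteq> carrier X" for e
    by (auto simp: W_def)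
  have \<psi>: "\<psi> e \<in> carrier X" for e
    unfolding \<psi>_def using W by simp
  have W_mono: "W e \<subseteq> W e'" if "e \<squnion>\<^bsub>X\<^esub> a \<sqsubseteq>\<^bsub>X\<^esub> e' \<squnion>\<^bsub>X\<^esub> a" "e \<in> carrier X" "e' \<in> carrier X" for e e'
    using that a join_eq_top_mono[OF _ le_refl that(1)] by (auto simp: W_def)
  have \<psi>_mono: "\<psi> e \<sqsubseteq>\<^bsub>X\<^esub> \<psi> e'" if "e \<squnion>\<^bsub>X\<^esub> a \<sqsubseteq>\<^bsub>X\<^esub> e' \<squnion>\<^bsub>X\<^esub> a" "e \<in> carrier X" "e' \<in> carrier X" for e e'
    unfolding \<psi>_def using W_mono[OF that] W by (rule Sup_mono)
  have le_\<psi>I: "x \<sqinter>\<^bsub>X\<^esub> \<psi> e \<sqsubseteq>\<^bsub>X\<^esub> d" if "x \<in> carrier X" "d \<in> carrier X"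
    "\<And>w. w \<in> W e \<Longrightarrow> x \<sqinter>\<^bsub>X\<^esub> w \<sqsubseteq>\<^bsub>X\<^esub> d" for x e d
    unfolding \<psi>_def using Sup_meet_le[OF that(1) W that(2)] that(3) by simp

  define V where "V = {(x, y) \<in> carrier X \<times> carrier X.
    \<forall>e\<in>carrier X. x \<sqinter>\<^bsub>X\<^esub> \<psi> (y \<squnion>\<^bsub>X\<^esub> e) \<sqsubseteq>\<^bsub>X\<^esub> \<psi> e}"
  have V: "V \<in> prod_elements X X"
  proof (rule prod_elementsI)
    show "V \<subseteq> carrier X \<times> carrier X"
      by (auto simp: V_def)
  next
    fix x y x' y'
    assume *: "(x, y) \<in> V" "x' \<in> carrier X" "y' \<in> carrier X" "x' \<sqsubseteq>\<^bsub>X\<^esub> x" "y' \<sqsubseteq>\<^bsub>X\<^esub> y"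
    then have xy: "x \<in> carrier X" "y \<in> carrier X"
      by (auto simp: V_def)
    have "x' \<sqinter>\<^bsub>X\<^esub> \<psi> (y' \<squnion>\<^bsub>X\<^esub> e) \<sqsubseteq>\<^bsub>X\<^esub> \<psi> e" if e: "e \<in> carrier X" for e
    proof -
      have "\<psi> (y' \<squnion>\<^bsub>X\<^esub> e) \<sqsubseteq>\<^bsub>X\<^esub> \<psi> (y \<squnion>\<^bsub>X\<^esub> e)"
        using * xy e a by (intro \<psi>_mono join_mono) auto
      then have "x' \<sqinter>\<^bsub>X\<^esub> \<psi> (y' \<squnion>\<^bsub>X\<^esub> e) \<sqsubseteq>\<^bsub>X\<^esub> x \<sqinter>\<^bsub>X\<^esub> \<psi> (y \<squnion>\<^bsub>X\<^esub> e)"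
        using * xy \<psi> by (intro meet_mono) auto
      moreover have "x \<sqinter>\<^bsub>X\<^esub> \<psi> (y \<squnion>\<^bsub>X\<^esub> e) \<sqsubseteq>\<^bsub>X\<^esub> \<psi> e"
        using * e by (auto simp: V_def)
      ultimately show ?thesis
        using le_trans[of "x' \<sqinter>\<^bsub>X\<^esub> \<psi> (y' \<squnion>\<^bsub>X\<^esub> e)" "x \<sqinter>\<^bsub>X\<^esub> \<psi> (y \<squnion>\<^bsub>X\<^esub> e)" "\<psi> e"] *(2) xy \<psi> by simp
    qed
    then show "(x', y') \<in> V"
      using * by (auto simp: V_def)
  next
    fix S y assume *: "S \<subseteq> carrier X" "y \<in> carrier X" "\<And>s. s \<in> S \<Longrightarrow> (s, y) \<in> V"
    have "\<Squnion>\<^bsub>X\<^esub>S \<sqinter>\<^bsub>X\<^esub> \<psi> (y \<squnion>\<^bsub>X\<^esub> e) \<sqsubseteq>\<^bsub>X\<^esub> \<psi> e" if e: "e \<in> carrier X" for e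
      using Sup_meet_le[OF \<psi> *(1) \<psi>, of "y \<squnion>\<^bsub>X\<^esub> e" e] *(3) e
      by (auto simp: V_def meet_comm[of X "\<psi> (y \<squnion>\<^bsub>X\<^esub> e)"])
    then show "(\<Squnion>\<^bsub>X\<^esub>S, y) \<in> V"
      using * by (auto simp: V_def)
  next
    fix x S assume *: "x \<in> carrier X" "S \<subseteq> carrier X" "\<And>s. s \<in> S \<Longrightarrow> (x, s) \<in> V"
    \<comment> \<open>Finite suprema are handled by absorbing one member of \<open>F\<close> after the other into \<open>e\<close>.\<close>
    have fin: "x \<sqinter>\<^bsub>X\<^esub> \<psi> (\<Squnion>\<^bsub>X\<^esub>F \<squnion>\<^bsub>X\<^esub> e) \<sqsubseteq>\<^bsub>X\<^esub> \<psi> e" if "finite F" "F \<subseteq> S" "e \<in> carrier X" for F e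
      using that
    proof (induction F arbitrary: e rule: finite_induct)
      case empty
      then show ?case
        using *(1) \<psi> meet_right by (simp add: Sup_empty bot_join)
    next
      case (insert s F)
      have F: "F \<subseteq> carrier X" and s: "s \<in> carrier X" and sV: "(x, s) \<in> V"
        using insert *(2,3) by auto
      let ?e = "s \<squnion>\<^bsub>X\<^esub> e"
      have e: "?e \<in> carrier X"
        using s insert by simp
      have "\<Squnion>\<^bsub>X\<^esub>insert s F = s \<squnion>\<^bsub>X\<^esub> \<Squnion>\<^bsub>X\<^esub>F"
        using weak_sup_insert[OF s F] eq_is_equal by simp
      then have eq: "\<Squnion>\<^bsub>X\<^esub>insert s F \<squnion>\<^bsub>X\<^esub> e = \<Squnion>\<^bsub>X\<^esub>F \<squnion>\<^bsub>X\<^esub> ?e"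
        using join_assoc[of "\<Squnion>\<^bsub>X\<^esub>F" s e] join_comm[of X s "\<Squnion>\<^bsub>X\<^esub>F"] s F insert.prems(2) by simp
      have cl: "x \<sqinter>\<^bsub>X\<^esub> \<psi> (\<Squnion>\<^bsub>X\<^esub>F \<squnion>\<^bsub>X\<^esub> ?e) \<in> carrier X"
        using *(1) \<psi> by simp
      have "x \<sqinter>\<^bsub>X\<^esub> \<psi> (\<Squnion>\<^bsub>X\<^esub>F \<squnion>\<^bsub>X\<^esub> ?e) \<sqsubseteq>\<^bsub>X\<^esub> x \<sqinter>\<^bsub>X\<^esub> \<psi> ?e"
        using insert.IH[OF _ e] insert.prems *(1) \<psi> cl by (simp add: le_meet_iff meet_left)
      also have "x \<sqinter>\<^bsub>X\<^esub> \<psi> ?e \<sqsubseteq>\<^bsub>X\<^esub> \<psi> e"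
        using sV insert.prems by (auto simp: V_def)
      finally show ?case
        unfolding eq using cl *(1) \<psi> by simp
    qed
    have "x \<sqinter>\<^bsub>X\<^esub> \<psi> (\<Squnion>\<^bsub>X\<^esub>S \<squnion>\<^bsub>X\<^esub> e) \<sqsubseteq>\<^bsub>X\<^esub> \<psi> e" if e: "e \<in> carrier X" for e
    proof (rule le_\<psi>I[OF *(1) \<psi>])
      fix w assume "w \<in> W (\<Squnion>\<^bsub>X\<^esub>S \<squnion>\<^bsub>X\<^esub> e)"
      then obtain t where w: "w \<in> carrier X" and t: "t \<in> carrier X" "w \<sqinter>\<^bsub>X\<^esub> t = ?bot"
        and top: "t \<squnion>\<^bsub>X\<^esub> ((\<Squnion>\<^bsub>X\<^esub>S \<squnion>\<^bsub>X\<^esub> e) \<squnion>\<^bsub>X\<^esub> a) = ?top"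
        by (auto simp: W_def)
      \<comment> \<open>The open \<open>r\<close> and the members of \<open>S\<close> cover \<open>X\<close>, so finitely many members of \<open>S\<close> suffice.\<close>
      define r where "r = t \<squnion>\<^bsub>X\<^esub> (e \<squnion>\<^bsub>X\<^esub> a)"
      have r: "r \<in> carrier X"
        using t e a by (simp add: r_def)
      have "\<Squnion>\<^bsub>X\<^esub>insert r S = ?top"
      proof -
        have "t \<squnion>\<^bsub>X\<^esub> ((\<Squnion>\<^bsub>X\<^esub>S \<squnion>\<^bsub>X\<^esub> e) \<squnion>\<^bsub>X\<^esub> a) \<sqsubseteq>\<^bsub>X\<^esub> r \<squnion>\<^bsub>X\<^esub> \<Squnion>\<^bsub>X\<^esub>S"
          using t e a *(2) join_left[of r "\<Squnion>\<^bsub>X\<^esub>S"] join_right[of r "\<Squnion>\<^bsub>X\<^esub>S"] r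
          by (auto simp: join_le_iff r_def)
        then show ?thesis
          using weak_sup_insert[OF r *(2)] eq_is_equal top r *(2) by (simp add: top_le_iff)
      qed
      then obtain F where F: "finite F" "F \<subseteq> insert r S" "\<Squnion>\<^bsub>X\<^esub>F = ?top"
        using compact_loc_finite_subcover[OF assms(1,2)] r *(2) by (metis insert_subset)
      define G where "G = F - {r}"
      have G: "finite G" "G \<subseteq> S" "G \<subseteq> carrier X"
        using F *(2) by (auto simp: G_def)
      have "\<Squnion>\<^bsub>X\<^esub>F \<sqsubseteq>\<^bsub>X\<^esub> \<Squnion>\<^bsub>X\<^esub>insert r G"
        using F *(2) r G by (intro Sup_mono) (auto simp: G_def)
      then have "r \<squnion>\<^bsub>X\<^esub> \<Squnion>\<^bsub>X\<^esub>G = ?top"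
        using weak_sup_insert[OF r G(3)] eq_is_equal F(3) r G by (simp add: top_le_iff)
      moreover have "r \<squnion>\<^bsub>X\<^esub> \<Squnion>\<^bsub>X\<^esub>G \<sqsubseteq>\<^bsub>X\<^esub> t \<squnion>\<^bsub>X\<^esub> ((\<Squnion>\<^bsub>X\<^esub>G \<squnion>\<^bsub>X\<^esub> e) \<squnion>\<^bsub>X\<^esub> a)" (is "_ \<sqsubseteq>\<^bsub>X\<^esub> ?q")
      proof -
        have q: "?q \<in> carrier X"
          using t e a G by simp
        have "t \<sqsubseteq>\<^bsub>X\<^esub> ?q \<and> (\<Squnion>\<^bsub>X\<^esub>G \<squnion>\<^bsub>X\<^esub> e) \<squnion>\<^bsub>X\<^esub> a \<sqsubseteq>\<^bsub>X\<^esub> ?q"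
          using t e a G by (intro conjI join_left join_right) auto
        moreover have "(\<Squnion>\<^bsub>X\<^esub>G \<squnion>\<^bsub>X\<^esub> e) \<squnion>\<^bsub>X\<^esub> a \<sqsubseteq>\<^bsub>X\<^esub> ?q \<longleftrightarrow> (\<Squnion>\<^bsub>X\<^esub>G \<sqsubseteq>\<^bsub>X\<^esub> ?q \<and> e \<sqsubseteq>\<^bsub>X\<^esub> ?q) \<and> a \<sqsubseteq>\<^bsub>X\<^esub> ?q"
          using e a G q by (simp only: join_le_iff join_closed sup_closed)
        ultimately show ?thesis
          using t e a G q r by (simp only: join_le_iff r_def join_closed sup_closed)
      qed
      ultimately have "?q = ?top"
        using t e a G by (simp add: top_le_iff)
      then have "w \<in> W (\<Squnion>\<^bsub>X\<^esub>G \<squnion>\<^bsub>X\<^esub> e)"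
        using w t by (auto simp: W_def)
      then have "w \<sqsubseteq>\<^bsub>X\<^esub> \<psi> (\<Squnion>\<^bsub>X\<^esub>G \<squnion>\<^bsub>X\<^esub> e)"
        unfolding \<psi>_def using W by (rule sup_upper[rotated])
      then have "x \<sqinter>\<^bsub>X\<^esub> w \<sqsubseteq>\<^bsub>X\<^esub> x \<sqinter>\<^bsub>X\<^esub> \<psi> (\<Squnion>\<^bsub>X\<^esub>G \<squnion>\<^bsub>X\<^esub> e)"
        using w *(1) \<psi> by (intro meet_mono) auto
      then show "x \<sqinter>\<^bsub>X\<^esub> w \<sqsubseteq>\<^bsub>X\<^esub> \<psi> e"
        using le_trans[OF _ fin[OF G(1,2) e]] w *(1) \<psi> by simp
    qed
    then show "(x, \<Squnion>\<^bsub>X\<^esub>S) \<in> V"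
      using * by (auto simp: V_def)
  qed
  have "B \<subseteq> V"
  proof
    fix z assume "z \<in> B"
    then obtain x y where z: "z = (x, y)" "x \<in> carrier X" "y \<in> carrier X" "x = ?bot \<or> y \<sqsubseteq>\<^bsub>X\<^esub> a"
      by (auto simp: B_def)
    have "x \<sqinter>\<^bsub>X\<^esub> \<psi> (y \<squnion>\<^bsub>X\<^esub> e) \<sqsubseteq>\<^bsub>X\<^esub> \<psi> e" if e: "e \<in> carrier X" for e
    proof (cases "x = ?bot")
      case False
      then have "\<psi> (y \<squnion>\<^bsub>X\<^esub> e) \<sqsubseteq>\<^bsub>X\<^esub> \<psi> e"
        using z e a le_trans[OF _ join_right[of e a]] by (intro \<psi>_mono)
          (auto simp: join_le_iff join_left join_right)
      then show ?thesis
        using z(2) \<psi> le_trans[OF meet_right] by simp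
    qed (use \<psi> in \<open>simp add: bot_meet\<close>)
    then show "z \<in> V"
      using z by (auto simp: V_def)
  qed
  moreover have "c \<subseteq> V"
  proof
    fix z assume z: "z \<in> c"
    then obtain x y where xy: "z = (x, y)" "x \<in> carrier X" "y \<in> carrier X" "x \<sqinter>\<^bsub>X\<^esub> y = ?bot"
      using prod_elements_subset[OF c] c_disjoint by auto
    have "x \<sqinter>\<^bsub>X\<^esub> \<psi> (y \<squnion>\<^bsub>X\<^esub> e) \<sqsubseteq>\<^bsub>X\<^esub> \<psi> e" if e: "e \<in> carrier X" for e
    proof (rule le_\<psi>I[OF xy(2) \<psi>])
      fix w assume "w \<in> W (y \<squnion>\<^bsub>X\<^esub> e)"
      then obtain t where w: "w \<in> carrier X" and t: "t \<in> carrier X" "w \<sqinter>\<^bsub>X\<^esub> t = ?bot"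
        and top: "t \<squnion>\<^bsub>X\<^esub> ((y \<squnion>\<^bsub>X\<^esub> e) \<squnion>\<^bsub>X\<^esub> a) = ?top"
        by (auto simp: W_def)
      \<comment> \<open>As \<open>x\<close> is disjoint from \<open>y\<close>, the witness \<open>t\<close> for \<open>w\<close> can be enlarged by \<open>y\<close> for \<open>x \<sqinter> w\<close>.\<close>
      let ?u = "x \<sqinter>\<^bsub>X\<^esub> w"
      have u: "?u \<in> carrier X"
        using xy w by simp
      have "?u \<sqinter>\<^bsub>X\<^esub> y = ?bot"
        by (rule meet_eq_bot_mono[OF xy(4)]) (use xy w in \<open>auto simp: meet_left\<close>)
      moreover have "?u \<sqinter>\<^bsub>X\<^esub> t = ?bot"
        by (rule meet_eq_bot_mono[OF t(2)]) (use xy w t in \<open>auto simp: meet_right\<close>)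
      ultimately have "?u \<sqinter>\<^bsub>X\<^esub> (t \<squnion>\<^bsub>X\<^esub> y) = ?bot"
        using u t xy by (simp add: meet_join_distrib join_bot)
      moreover have "(t \<squnion>\<^bsub>X\<^esub> y) \<squnion>\<^bsub>X\<^esub> (e \<squnion>\<^bsub>X\<^esub> a) = ?top"
        using top t xy e a by (simp add: join_assoc)
      ultimately have "?u \<in> W e"
        using u t xy by (auto simp: W_def)
      then show "?u \<sqsubseteq>\<^bsub>X\<^esub> \<psi> e"
        unfolding \<psi>_def using W by (rule sup_upper[rotated])
    qed
    then show "z \<in> V"
      using xy by (auto simp: V_def)
  qed
  moreover have "A \<subseteq> B \<squnion>\<^bsub>?P\<^esub> c"
    using c_iff[OF A(1) B(1)] A(2) B(2) prod_join_upper(1)[OF assms(1,1) A(1) c] by simp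
  moreover have "(a, ?top) \<in> A"
    using a by (simp add: A_def)
  ultimately have "(a, ?top) \<in> V"
    using prod_join_least[OF assms(1,1) B(1) c V] by blast
  then have "a \<sqinter>\<^bsub>X\<^esub> \<psi> (?top \<squnion>\<^bsub>X\<^esub> ?bot) \<sqsubseteq>\<^bsub>X\<^esub> \<psi> ?bot"
    by (auto simp: V_def)
  moreover have "\<psi> ?top = ?top"
  proof -
    have "?top \<in> W ?top"
      using a by (auto simp: W_def meet_bot bot_join join_comm[of X ?top] join_top intro!: bexI[of _ ?bot])
    then have "?top \<sqsubseteq>\<^bsub>X\<^esub> \<psi> ?top"
      unfolding \<psi>_def using W by (rule sup_upper[rotated])
    then show ?thesis
      using \<psi> by (simp add: top_le_iff)
  qed
  moreover have "W ?bot = {w. well_inside X w a}"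
    using a by (auto simp: W_def well_inside_def bot_join)
  ultimately show "a \<sqsubseteq>\<^bsub>X\<^esub> \<Squnion>\<^bsub>X\<^esub>{w. well_inside X w a}"
    using a by (simp add: join_bot meet_top \<psi>_def)
qed

subsection \<open>Regular frames are Hausdorff\<close>

text \<open>The complement \<open>N\<close> of the diagonal consists of the \<open>(x, y)\<close> with \<open>x \<sqinter> y = \<bottom>\<close>. Two opens of
  \<open>X \<times> X\<close> that agree on the diagonal must be shown to agree after joining them with \<open>N\<close>. By
  regularity this can be tested on rectangles with one side well inside a given open, and these
  split into a rectangle in \<open>N\<close> and one near the diagonal.\<close>

theorem hausdorff_if_regular_frame:
  assumes "frame X" "regular_frame X"
  shows "hausdorff_loc X"
proof -
  interpret frame X by fact
  let ?P = "prod_loc X X" and ?\<Delta> = "pre (diagonal X)" and ?bot = "\<bottom>\<^bsub>X\<^esub>"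
  define N where "N = {(x, y) \<in> carrier X \<times> carrier X. x \<sqinter>\<^bsub>X\<^esub> y \<sqsubseteq>\<^bsub>X\<^esub> ?bot}"
  have N: "N \<in> prod_elements X X"
    unfolding N_def by (rule meet_le_element) (use assms in auto)
  have mem_N: "(x, y) \<in> N" if "x \<in> carrier X" "y \<in> carrier X" "x \<sqinter>\<^bsub>X\<^esub> y = ?bot" for x y
    using that by (simp add: N_def)
  have reg: "(x, y) \<in> W" if W: "W \<in> prod_elements X X" and xy: "x \<in> carrier X" "y \<in> carrier X"
    and *: "\<And>w. well_inside X w y \<Longrightarrow> (x, w) \<in> W" for W x y
  proof -
    have sub: "{w. well_inside X w y} \<subseteq> carrier X"
      by (auto simp: well_inside_def)
    have "(x, \<Squnion>\<^bsub>X\<^esub>{w. well_inside X w y}) \<in> W"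
      using prod_elements_Sup_right[OF W sub xy(1)] * by blast
    then show ?thesis
      using prod_elements_down[OF W, of x _ x y] xy assms(2) unfolding regular_frame_def by auto
  qed
  have reg': "(x, y) \<in> W" if W: "W \<in> prod_elements X X" and xy: "x \<in> carrier X" "y \<in> carrier X"
    and *: "\<And>w. well_inside X w x \<Longrightarrow> (w, y) \<in> W" for W x y
  proof -
    have sub: "{w. well_inside X w x} \<subseteq> carrier X"
      by (auto simp: well_inside_def)
    have "(\<Squnion>\<^bsub>X\<^esub>{w. well_inside X w x}, y) \<in> W"
      using prod_elements_Sup_left[OF W sub xy(2)] * by blast
    then show ?thesis
      using prod_elements_down[OF W, of _ y x y] xy assms(2) unfolding regular_frame_def by auto
  qed
  have join_left_mem: "(x \<squnion>\<^bsub>X\<^esub> x', y) \<in> W"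
    if "W \<in> prod_elements X X" "x \<in> carrier X" "x' \<in> carrier X" "y \<in> carrier X" "(x, y) \<in> W"
      "(x', y) \<in> W" for W x x' y
    using prod_elements_Sup_left[OF that(1), of "{x, x'}" y] that by (auto simp: join_eq_Sup)
  have join_right_mem: "(x, y \<squnion>\<^bsub>X\<^esub> y') \<in> W"
    if "W \<in> prod_elements X X" "x \<in> carrier X" "y \<in> carrier X" "y' \<in> carrier X" "(x, y) \<in> W"
      "(x, y') \<in> W" for W x y y'
    using prod_elements_Sup_right[OF that(1), of "{y, y'}" x] that by (auto simp: join_eq_Sup)
  have key: "U \<subseteq> V \<squnion>\<^bsub>?P\<^esub> N" if UV: "U \<in> prod_elements X X" "V \<in> prod_elements X X"
    "?\<Delta> U \<sqsubseteq>\<^bsub>X\<^esub> ?\<Delta> V" for U V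
  proof
    let ?W = "V \<squnion>\<^bsub>?P\<^esub> N"
    note W = prod_join_upper[OF assms(1,1) UV(2) N]
    \<comment> \<open>Modulo \<open>N\<close>, a rectangle \<open>x \<times> y\<close> contains the whole strip over \<open>x \<sqinter> y\<close>.\<close>
    have top: "(x \<sqinter>\<^bsub>X\<^esub> y, \<top>\<^bsub>X\<^esub>) \<in> ?W" if "(x, y) \<in> V" for x y
    proof -
      have xy: "x \<in> carrier X" "y \<in> carrier X"
        using that prod_elements_subset[OF UV(2)] by auto
      show ?thesis
      proof (rule reg'[OF W(3)])
        fix w assume w: "well_inside X w (x \<sqinter>\<^bsub>X\<^esub> y)"
        then obtain t where t: "w \<in> carrier X" "t \<in> carrier X" "w \<sqinter>\<^bsub>X\<^esub> t = ?bot"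
          "t \<squnion>\<^bsub>X\<^esub> (x \<sqinter>\<^bsub>X\<^esub> y) = \<top>\<^bsub>X\<^esub>"
          by (auto simp: well_inside_def)
        have "w \<sqsubseteq>\<^bsub>X\<^esub> x \<sqinter>\<^bsub>X\<^esub> y"
          using well_inside_le[OF assms(1) w] xy by simp
        then have "(w, x \<sqinter>\<^bsub>X\<^esub> y) \<in> ?W"
          using prod_elements_down[OF W(3), of x y w "x \<sqinter>\<^bsub>X\<^esub> y"] W(1) that xy t
            by (auto simp: le_meet_iff meet_right)
        moreover have "(w, t) \<in> ?W"
          using mem_N t W(2) by blast
        ultimately show "(w, \<top>\<^bsub>X\<^esub>) \<in> ?W"
          using join_right_mem[OF W(3), of w t "x \<sqinter>\<^bsub>X\<^esub> y"] t xy by simp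
      qed (use xy in auto)
    qed
    fix z assume "z \<in> U"
    then obtain a b where z: "z = (a, b)" "(a, b) \<in> U" "a \<in> carrier X" "b \<in> carrier X"
      using prod_elements_subset[OF UV(1)] by auto
    have D: "?\<Delta> U \<in> carrier X" "?\<Delta> V \<in> carrier X"
      using pre_diagonal_closed assms(1) UV by auto
    have "a \<sqinter>\<^bsub>X\<^esub> b \<sqsubseteq>\<^bsub>X\<^esub> ?\<Delta> U"
      using pre_diagonal_le_iff[OF assms(1) D(1) UV(1)] D z by auto
    then have ab: "a \<sqinter>\<^bsub>X\<^esub> b \<sqsubseteq>\<^bsub>X\<^esub> ?\<Delta> V"
      using le_trans[OF _ UV(3)] D z by simp
    have "(?\<Delta> V, \<top>\<^bsub>X\<^esub>) \<in> ?W"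
      unfolding pre_diagonal[OF UV(2)]
      by (rule prod_elements_Sup_left[OF W(3)]) (use prod_elements_subset[OF UV(2)] top in auto)
    then have ab': "(a \<sqinter>\<^bsub>X\<^esub> b, v) \<in> ?W" if "v \<in> carrier X" for v
      using prod_elements_down[OF W(3) _ ab] z that by auto
    have "(a, b) \<in> ?W"
    proof (rule reg[OF W(3) z(3,4)])
      fix w assume w: "well_inside X w b"
      then obtain t where t: "w \<in> carrier X" "t \<in> carrier X" "w \<sqinter>\<^bsub>X\<^esub> t = ?bot" "t \<squnion>\<^bsub>X\<^esub> b = \<top>\<^bsub>X\<^esub>"
        by (auto simp: well_inside_def)
      have "(a \<sqinter>\<^bsub>X\<^esub> t) \<sqinter>\<^bsub>X\<^esub> w = ?bot"
        by (rule meet_eq_bot_mono[of t w]) (use t z in \<open>auto simp: meet_right meet_comm[of X t w]\<close>)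
      then have "(a \<sqinter>\<^bsub>X\<^esub> t, w) \<in> ?W"
        using mem_N t z W(2) by auto
      then have "((a \<sqinter>\<^bsub>X\<^esub> t) \<squnion>\<^bsub>X\<^esub> (a \<sqinter>\<^bsub>X\<^esub> b), w) \<in> ?W"
        using join_left_mem[OF W(3)] ab' t z by simp
      moreover have "(a \<sqinter>\<^bsub>X\<^esub> t) \<squnion>\<^bsub>X\<^esub> (a \<sqinter>\<^bsub>X\<^esub> b) = a"
        using t z by (simp add: meet_top flip: meet_join_distrib)
      ultimately show "(a, w) \<in> ?W"
        by simp
    qed
    then show "z \<in> ?W"
      using z by simp
  qed
  have key': "?\<Delta> U \<sqsubseteq>\<^bsub>X\<^esub> ?\<Delta> V" if UV: "U \<in> prod_elements X X" "V \<in> prod_elements X X"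
    "U \<subseteq> V \<squnion>\<^bsub>?P\<^esub> N" for U V
  proof -
    let ?Z = "{(x, y) \<in> carrier X \<times> carrier X. x \<sqinter>\<^bsub>X\<^esub> y \<sqsubseteq>\<^bsub>X\<^esub> ?\<Delta> V}"
    have D: "?\<Delta> V \<in> carrier X"
      using pre_diagonal_closed assms(1) UV by auto
    have "V \<subseteq> ?Z"
      using pre_diagonal_le_iff[OF assms(1) D UV(2)] D prod_elements_subset[OF UV(2)] by auto
    moreover have "N \<subseteq> ?Z"
      using D by (auto simp: N_def intro: le_trans)
    ultimately have "U \<subseteq> ?Z"
      using prod_join_least[OF assms(1,1) UV(2) N meet_le_element[OF assms(1) D]] UV(3) by blast
    then show ?thesis
      using pre_diagonal_le_iff[OF assms(1) D UV(1)] by auto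
  qed
  have iff: "?\<Delta> U = ?\<Delta> V \<longleftrightarrow> U \<squnion>\<^bsub>?P\<^esub> N = V \<squnion>\<^bsub>?P\<^esub> N"
    if UV: "U \<in> prod_elements X X" "V \<in> prod_elements X X" for U V
  proof
    assume "?\<Delta> U = ?\<Delta> V"
    then have "U \<subseteq> V \<squnion>\<^bsub>?P\<^esub> N" "V \<subseteq> U \<squnion>\<^bsub>?P\<^esub> N"
      using key UV pre_diagonal_closed[OF assms(1)] by auto
    then show "U \<squnion>\<^bsub>?P\<^esub> N = V \<squnion>\<^bsub>?P\<^esub> N"
      using prod_join_least[OF assms(1,1)] prod_join_upper[OF assms(1,1)] UV N
      by (intro subset_antisym) auto
  next
    assume "U \<squnion>\<^bsub>?P\<^esub> N = V \<squnion>\<^bsub>?P\<^esub> N"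
    then have "U \<subseteq> V \<squnion>\<^bsub>?P\<^esub> N" "V \<subseteq> U \<squnion>\<^bsub>?P\<^esub> N"
      using prod_join_upper(1)[OF assms(1,1)] UV N by auto
    then show "?\<Delta> U = ?\<Delta> V"
      using key' UV pre_diagonal_closed[OF assms(1)] le_antisym by simp
  qed
  have "?\<Delta> ` prod_elements X X = carrier X"
  proof
    show "?\<Delta> ` prod_elements X X \<subseteq> carrier X"
      using pre_diagonal_closed[OF assms(1)] by blast
    show "carrier X \<subseteq> ?\<Delta> ` prod_elements X X"
    proof
      fix a assume "a \<in> carrier X"
      then show "a \<in> ?\<Delta> ` prod_elements X X"
        using strip_left_element[OF assms(1), of a] by (metis (lifting) image_eqI)
    qed
  qed
  then show ?thesis
    unfolding hausdorff_loc_def closed_embedding_def diagonal_simps using N iff by blast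
qed


section \<open>Points of a compact Hausdorff locale\<close>

text \<open>The objects of \<open>CHausLoc\<close>, apart from the size condition.\<close>

definition compact_hausdorff_loc :: "'a gorder \<Rightarrow> bool" where
  "compact_hausdorff_loc X \<longleftrightarrow> frame X \<and> compact_loc X \<and> hausdorff_loc X"

text \<open>A point of a locale is given by a prime element of the frame, the largest open not containing
  it. In a regular frame the prime elements are the maximal elements different from \<open>\<top>\<close>, and
  these are taken as the points.\<close>

definition pts :: "'a gorder \<Rightarrow> 'a set" where
  "pts X = {p \<in> carrier X. p \<noteq> \<top>\<^bsub>X\<^esub> \<and> (\<forall>m\<in>carrier X. p \<sqsubseteq>\<^bsub>X\<^esub> m \<longrightarrow> m = p \<or> m = \<top>\<^bsub>X\<^esub>)}"

text \<open>The set of points contained in the open \<open>a\<close>.\<close>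

definition opens_at :: "'a gorder \<Rightarrow> 'a \<Rightarrow> 'a set" where
  "opens_at X a = {p \<in> pts X. \<not> a \<sqsubseteq>\<^bsub>X\<^esub> p}"

text \<open>The space of points, with the sets \<open>opens_at X a\<close> as open sets.\<close>

definition space_of :: "'a gorder \<Rightarrow> 'a topology" where
  "space_of X = topology (\<lambda>V. \<exists>a\<in>carrier X. V = opens_at X a)"

lemma compact_hausdorff_locD:
  assumes "compact_hausdorff_loc X"
  shows "frame X" "compact_loc X" "regular_frame X"
  using assms regular_frame_if_compact_hausdorff by (auto simp: compact_hausdorff_loc_def)

lemma pts_carrier: "p \<in> pts X \<Longrightarrow> p \<in> carrier X"
  by (simp add: pts_def)

lemma pts_prime:
  assumes "frame X" "p \<in> pts X" "a \<in> carrier X" "b \<in> carrier X" "a \<sqinter>\<^bsub>X\<^esub> b \<sqsubseteq>\<^bsub>X\<^esub> p"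
  shows "a \<sqsubseteq>\<^bsub>X\<^esub> p \<or> b \<sqsubseteq>\<^bsub>X\<^esub> p"
proof (rule disjCI)
  interpret frame X by fact
  have p: "p \<in> carrier X"
    using assms(2) by (rule pts_carrier)
  assume b: "\<not> b \<sqsubseteq>\<^bsub>X\<^esub> p"
  have "b \<squnion>\<^bsub>X\<^esub> p \<noteq> p"
    using b join_left[of b p] assms(4) p by auto
  moreover have "p \<sqsubseteq>\<^bsub>X\<^esub> b \<squnion>\<^bsub>X\<^esub> p" "b \<squnion>\<^bsub>X\<^esub> p \<in> carrier X"
    using join_right[of b p] assms(4) p by auto
  ultimately have "b \<squnion>\<^bsub>X\<^esub> p = \<top>\<^bsub>X\<^esub>"
    using assms(2) by (auto simp: pts_def)
  then have "a = a \<sqinter>\<^bsub>X\<^esub> (b \<squnion>\<^bsub>X\<^esub> p)"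
    using assms(3) by (simp add: meet_top)
  also have "\<dots> = (a \<sqinter>\<^bsub>X\<^esub> b) \<squnion>\<^bsub>X\<^esub> (a \<sqinter>\<^bsub>X\<^esub> p)"
    using assms(3,4) p by (rule meet_join_distrib)
  also have "\<dots> \<sqsubseteq>\<^bsub>X\<^esub> p"
    using assms(3-5) p by (intro join_le) (auto simp: meet_right)
  finally show "a \<sqsubseteq>\<^bsub>X\<^esub> p" .
qed

lemma opens_at_subset: "opens_at X a \<subseteq> pts X"
  by (auto simp: opens_at_def)

lemma opens_at_top:
  assumes "frame X"
  shows "opens_at X \<top>\<^bsub>X\<^esub> = pts X"
proof -
  interpret frame X by fact
  show ?thesis
    by (auto simp: opens_at_def pts_def top_le_iff)
qed

lemma opens_at_meet:
  assumes "frame X" "a \<in> carrier X" "b \<in> carrier X"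
  shows "opens_at X (a \<sqinter>\<^bsub>X\<^esub> b) = opens_at X a \<inter> opens_at X b"
proof -
  interpret frame X by fact
  have "a \<sqinter>\<^bsub>X\<^esub> b \<sqsubseteq>\<^bsub>X\<^esub> p \<longleftrightarrow> a \<sqsubseteq>\<^bsub>X\<^esub> p \<or> b \<sqsubseteq>\<^bsub>X\<^esub> p" if "p \<in> pts X" for p
    using pts_prime[OF assms(1) that assms(2,3)] pts_carrier[OF that] assms(2,3)
      le_trans[OF meet_left, of a b p] le_trans[OF meet_right, of a b p] by auto
  then show ?thesis
    by (auto simp: opens_at_def)
qed

lemma opens_at_Sup:
  assumes "frame X" "S \<subseteq> carrier X"
  shows "opens_at X (\<Squnion>\<^bsub>X\<^esub>S) = \<Union>(opens_at X ` S)"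
proof -
  interpret frame X by fact
  show ?thesis
    using Sup_le_iff[OF assms(2) pts_carrier] by (auto simp: opens_at_def)
qed

lemma openin_space_of:
  assumes "frame X"
  shows "openin (space_of X) V \<longleftrightarrow> (\<exists>a\<in>carrier X. V = opens_at X a)"
proof -
  interpret frame X by fact
  have "istopology (\<lambda>V. \<exists>a\<in>carrier X. V = opens_at X a)"
    unfolding istopology_def
  proof (intro conjI allI impI)
    fix V W assume "\<exists>a\<in>carrier X. V = opens_at X a" "\<exists>a\<in>carrier X. W = opens_at X a"
    then obtain a b where "a \<in> carrier X" "V = opens_at X a" "b \<in> carrier X" "W = opens_at X b"
      by blast
    then show "\<exists>a\<in>carrier X. V \<inter> W = opens_at X a"
      using opens_at_meet[OF assms, of a b] by (intro bexI[of _ "a \<sqinter>\<^bsub>X\<^esub> b"]) auto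
  next
    fix K assume K: "\<forall>V\<in>K. \<exists>a\<in>carrier X. V = opens_at X a"
    let ?S = "{a \<in> carrier X. opens_at X a \<in> K}"
    have "\<Union>K = \<Union>(opens_at X ` ?S)"
    proof (rule arg_cong[of _ _ Union])
      show "K = opens_at X ` ?S"
        using K by auto
    qed
    also have "\<dots> = opens_at X (\<Squnion>\<^bsub>X\<^esub>?S)"
      by (subst opens_at_Sup[OF assms]) auto
    finally show "\<exists>a\<in>carrier X. \<Union>K = opens_at X a"
      by (intro bexI[of _ "\<Squnion>\<^bsub>X\<^esub>?S"]) auto
  qed
  then show ?thesis
    by (simp add: space_of_def)
qed

lemma topspace_space_of:
  assumes "frame X"
  shows "topspace (space_of X) = pts X"
proof
  interpret frame X by fact
  show "topspace (space_of X) \<subseteq> pts X"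
    using openin_space_of[OF assms, of "topspace (space_of X)"] opens_at_subset[of X] by auto
  show "pts X \<subseteq> topspace (space_of X)"
    using openin_space_of[OF assms, of "pts X"] opens_at_top[OF assms] openin_subset by fastforce
qed

text \<open>By compactness, a chain of elements different from \<open>\<top>\<close> has a supremum different from \<open>\<top>\<close>, so
  Zorn's lemma applies.\<close>

lemma ex_pts_above:
  assumes "frame X" "compact_loc X" "b \<in> carrier X" "b \<noteq> \<top>\<^bsub>X\<^esub>"
  obtains p where "p \<in> pts X" "b \<sqsubseteq>\<^bsub>X\<^esub> p"
proof -
  interpret frame X by fact
  let ?A = "{m \<in> carrier X. b \<sqsubseteq>\<^bsub>X\<^esub> m \<and> m \<noteq> \<top>\<^bsub>X\<^esub>}"
  let ?R = "relation_of (le X) ?A"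
  have "partial_order_on ?A ?R"
  proof (rule partial_order_on_relation_ofI)
    show "\<And>a. a \<in> ?A \<Longrightarrow> a \<sqsubseteq>\<^bsub>X\<^esub> a"
      by simp
    show "x \<sqsubseteq>\<^bsub>X\<^esub> z" if "x \<in> ?A" "y \<in> ?A" "z \<in> ?A" "x \<sqsubseteq>\<^bsub>X\<^esub> y" "y \<sqsubseteq>\<^bsub>X\<^esub> z" for x y z
      using that le_trans[of x y z] by simp
    show "x = y" if "x \<in> ?A" "y \<in> ?A" "x \<sqsubseteq>\<^bsub>X\<^esub> y" "y \<sqsubseteq>\<^bsub>X\<^esub> x" for x y
      using that le_antisym[of x y] by simp
  qed
  moreover have "\<exists>u\<in>?A. \<forall>a\<in>C. a \<sqsubseteq>\<^bsub>X\<^esub> u" if C: "C \<in> Chains ?R" for C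
  proof (cases "C = {}")
    case True
    then show ?thesis
      using assms(3,4) by auto
  next
    case False
    have sub: "C \<subseteq> ?A"
      using C by (auto simp: Chains_def relation_of_def)
    have total: "x \<sqsubseteq>\<^bsub>X\<^esub> y \<or> y \<sqsubseteq>\<^bsub>X\<^esub> x" if "x \<in> C" "y \<in> C" for x y
      using C that by (auto simp: Chains_def relation_of_def)
    have carr: "C \<subseteq> carrier X"
      using sub by auto
    have "directed_in X C"
      unfolding directed_in_def
    proof (intro conjI ballI carr False)
      fix x y assume "x \<in> C" "y \<in> C"
      then show "\<exists>z\<in>C. x \<sqsubseteq>\<^bsub>X\<^esub> z \<and> y \<sqsubseteq>\<^bsub>X\<^esub> z"
        using total[of x y] carr le_refl by blast
    qed
    then have "\<Squnion>\<^bsub>X\<^esub>C \<noteq> \<top>\<^bsub>X\<^esub>"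
      using assms(2) sub unfolding compact_loc_def by blast
    moreover have "b \<sqsubseteq>\<^bsub>X\<^esub> \<Squnion>\<^bsub>X\<^esub>C"
    proof -
      obtain x where "x \<in> C"
        using False by blast
      then show ?thesis
        using sub le_trans[OF _ sup_upper[OF carr], of b x] carr assms(3) by auto
    qed
    ultimately show ?thesis
      using carr sup_upper by (intro bexI[of _ "\<Squnion>\<^bsub>X\<^esub>C"]) auto
  qed
  ultimately obtain m where m: "m \<in> ?A" "\<And>a. a \<in> ?A \<Longrightarrow> m \<sqsubseteq>\<^bsub>X\<^esub> a \<Longrightarrow> a = m"
    using predicate_Zorn[of ?A "le X"] by blast
  have "a = m \<or> a = \<top>\<^bsub>X\<^esub>" if "a \<in> carrier X" "m \<sqsubseteq>\<^bsub>X\<^esub> a" for a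
    using m that le_trans[of b m a] assms(3) by auto
  then have "m \<in> pts X"
    using m(1) by (simp add: pts_def)
  then show thesis
    using that m(1) by simp
qed

text \<open>A compact Hausdorff locale has enough points. If \<open>a\<close> is not below \<open>b\<close>, some \<open>w\<close> well inside
  \<open>a\<close> is not below \<open>b\<close>; with \<open>t\<close> disjoint from \<open>w\<close> and \<open>t \<squnion> a = \<top>\<close>, any point above \<open>b \<squnion> t\<close> lies
  in \<open>a\<close> but not in \<open>b\<close>.\<close>

lemma opens_at_subset_iff:
  assumes "compact_hausdorff_loc X" "a \<in> carrier X" "b \<in> carrier X"
  shows "opens_at X a \<subseteq> opens_at X b \<longleftrightarrow> a \<sqsubseteq>\<^bsub>X\<^esub> b"
proof
  note X = compact_hausdorff_locD[OF assms(1)]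
  interpret frame X by fact
  show "a \<sqsubseteq>\<^bsub>X\<^esub> b \<Longrightarrow> opens_at X a \<subseteq> opens_at X b"
    using assms(2,3) le_trans[of a b, OF _ _ _ _ pts_carrier] by (auto simp: opens_at_def)
  show "a \<sqsubseteq>\<^bsub>X\<^esub> b" if sub: "opens_at X a \<subseteq> opens_at X b"
  proof (rule ccontr)
    assume "\<not> a \<sqsubseteq>\<^bsub>X\<^esub> b"
    then obtain w where w: "well_inside X w a" "\<not> w \<sqsubseteq>\<^bsub>X\<^esub> b"
      using regular_frame_separates[OF X(1,3) assms(2,3)] by blast
    then obtain t where t: "w \<in> carrier X" "t \<in> carrier X" "w \<sqinter>\<^bsub>X\<^esub> t = \<bottom>\<^bsub>X\<^esub>" "t \<squnion>\<^bsub>X\<^esub> a = \<top>\<^bsub>X\<^esub>"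
      by (auto simp: well_inside_def)
    have "b \<squnion>\<^bsub>X\<^esub> t \<noteq> \<top>\<^bsub>X\<^esub>"
    proof
      assume "b \<squnion>\<^bsub>X\<^esub> t = \<top>\<^bsub>X\<^esub>"
      then have "w = w \<sqinter>\<^bsub>X\<^esub> (b \<squnion>\<^bsub>X\<^esub> t)"
        using t(1) by (simp add: meet_top)
      also have "\<dots> = (w \<sqinter>\<^bsub>X\<^esub> b) \<squnion>\<^bsub>X\<^esub> (w \<sqinter>\<^bsub>X\<^esub> t)"
        using t assms(3) by (intro meet_join_distrib)
      also have "\<dots> = w \<sqinter>\<^bsub>X\<^esub> b"
        using t assms(3) by (simp add: join_bot)
      finally show False
        using w(2) meet_right[of w b] t(1) assms(3) by simp
    qed
    then obtain p where p: "p \<in> pts X" "b \<squnion>\<^bsub>X\<^esub> t \<sqsubseteq>\<^bsub>X\<^esub> p"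
      using ex_pts_above[OF X(1,2)] t assms(3) by (metis join_closed)
    have pc: "p \<in> carrier X"
      using p(1) by (rule pts_carrier)
    have bt: "b \<sqsubseteq>\<^bsub>X\<^esub> p" "t \<sqsubseteq>\<^bsub>X\<^esub> p"
      using p(2) t assms(3) pc by (simp_all add: join_le_iff)
    have "\<not> a \<sqsubseteq>\<^bsub>X\<^esub> p"
    proof
      assume "a \<sqsubseteq>\<^bsub>X\<^esub> p"
      then have "t \<squnion>\<^bsub>X\<^esub> a \<sqsubseteq>\<^bsub>X\<^esub> p"
        using bt(2) t(2) assms(2) pc by (simp only: join_le_iff)
      then show False
        using top_le_iff[OF pc] t(4) p(1) by (simp add: pts_def)
    qed
    then show False
      using sub p(1) bt(1) by (auto simp: opens_at_def)
  qed
qed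

lemma opens_at_inject:
  assumes "compact_hausdorff_loc X" "a \<in> carrier X" "b \<in> carrier X"
  shows "opens_at X a = opens_at X b \<longleftrightarrow> a = b"
proof -
  interpret frame X using assms(1) by (rule compact_hausdorff_locD)
  show ?thesis
    using opens_at_subset_iff[OF assms] opens_at_subset_iff[OF assms(1,3,2)] le_antisym[of a b]
      assms(2,3)
    by auto
qed

lemma Hausdorff_space_of:
  assumes "compact_hausdorff_loc X"
  shows "Hausdorff_space (space_of X)"
  unfolding Hausdorff_space_def topspace_space_of[OF compact_hausdorff_locD(1)[OF assms]]
proof (intro allI impI)
  note X = compact_hausdorff_locD[OF assms(1)]
  interpret frame X by fact
  fix p q assume *: "p \<in> pts X \<and> q \<in> pts X \<and> p \<noteq> q"
  then have pq: "p \<in> carrier X" "q \<in> carrier X"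
    using pts_carrier by auto
  have "\<not> p \<sqsubseteq>\<^bsub>X\<^esub> q"
    using * pq by (auto simp: pts_def)
  then obtain w where w: "well_inside X w p" "\<not> w \<sqsubseteq>\<^bsub>X\<^esub> q"
    using regular_frame_separates[OF X(1,3) pq] by blast
  then obtain t where t: "w \<in> carrier X" "t \<in> carrier X" "w \<sqinter>\<^bsub>X\<^esub> t = \<bottom>\<^bsub>X\<^esub>" "t \<squnion>\<^bsub>X\<^esub> p = \<top>\<^bsub>X\<^esub>"
    by (auto simp: well_inside_def)
  have "\<not> t \<sqsubseteq>\<^bsub>X\<^esub> p"
  proof
    assume "t \<sqsubseteq>\<^bsub>X\<^esub> p"
    then have "t \<squnion>\<^bsub>X\<^esub> p = p"
      using t pq le_iff_meet by simp
    then show False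
      using t(4) * by (simp add: pts_def)
  qed
  show "\<exists>U V. openin (space_of X) U \<and> openin (space_of X) V \<and> p \<in> U \<and> q \<in> V \<and> disjnt U V"
  proof (intro exI conjI)
    show "openin (space_of X) (opens_at X t)" "openin (space_of X) (opens_at X w)"
      using t openin_space_of[OF X(1)] by auto
    show "p \<in> opens_at X t" "q \<in> opens_at X w"
      using * w \<open>\<not> t \<sqsubseteq>\<^bsub>X\<^esub> p\<close> by (auto simp: opens_at_def)
    have "opens_at X t \<inter> opens_at X w = opens_at X \<bottom>\<^bsub>X\<^esub>"
      using opens_at_meet[OF X(1), of t w] t by (simp add: meet_comm[of X t w])
    also have "\<dots> = {}"
      using bottom_lower[OF pts_carrier] by (auto simp: opens_at_def)
    finally show "disjnt (opens_at X t) (opens_at X w)"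
      by (simp add: disjnt_def)
  qed
qed

lemma compact_space_of:
  assumes "compact_hausdorff_loc X"
  shows "compact_space (space_of X)"
  unfolding compact_space_alt topspace_space_of[OF compact_hausdorff_locD(1)[OF assms]]
proof (intro allI impI)
  note X = compact_hausdorff_locD[OF assms(1)]
  interpret frame X by fact
  fix K assume *: "Ball K (openin (space_of X)) \<and> pts X \<subseteq> \<Union>K"
  then have cover: "pts X \<subseteq> \<Union>K"
    by blast
  from * have K: "\<And>U. U \<in> K \<Longrightarrow> \<exists>a\<in>carrier X. U = opens_at X a"
    using openin_space_of[OF X(1)] by simp
  let ?S = "{a \<in> carrier X. opens_at X a \<in> K}"
  have "opens_at X (\<Squnion>\<^bsub>X\<^esub>?S) = \<Union>(opens_at X ` ?S)"
    by (rule opens_at_Sup[OF X(1)]) auto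
  also have "\<dots> = \<Union>K"
    using K by blast
  also have "\<dots> = opens_at X \<top>\<^bsub>X\<^esub>"
  proof -
    have "\<Union>K \<subseteq> pts X"
      using K opens_at_subset[of X] by blast
    then show ?thesis
      using cover opens_at_top[OF X(1)] by blast
  qed
  finally have "\<Squnion>\<^bsub>X\<^esub>?S = \<top>\<^bsub>X\<^esub>"
    using opens_at_inject[OF assms]
      by (metis (no_types, lifting) mem_Collect_eq subsetI sup_closed top_closed)
  then obtain F where F: "finite F" "F \<subseteq> ?S" "\<Squnion>\<^bsub>X\<^esub>F = \<top>\<^bsub>X\<^esub>"
    using compact_loc_finite_subcover[OF X(1,2), of ?S] by blast
  have "\<Union>(opens_at X ` F) = pts X"
    using opens_at_Sup[OF X(1), of F] F opens_at_top[OF X(1)] by auto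
  then show "\<exists>F. finite F \<and> F \<subseteq> K \<and> pts X \<subseteq> \<Union>F"
    using F by (intro exI[of _ "opens_at X ` F"]) auto
qed

section \<open>Maps of compact Hausdorff locales\<close>

text \<open>The action of a map of locales on points: the right adjoint of the inverse image map
  (\<open>le_ptmap_iff\<close>). Regularity of the codomain ensures that it sends points to points.\<close>

definition ptmap :: "('a, 'b) locmap \<Rightarrow> 'a \<Rightarrow> 'b" where
  "ptmap f p = \<Squnion>\<^bsub>tgt f\<^esub>{v \<in> carrier (tgt f). pre f v \<sqsubseteq>\<^bsub>src f\<^esub> p}"

lemma locale_mapD:
  assumes "locale_map f"
  shows "frame (src f)" "frame (tgt f)"
    "\<And>v. v \<in> carrier (tgt f) \<Longrightarrow> pre f v \<in> carrier (src f)"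
    "pre f \<top>\<^bsub>tgt f\<^esub> = \<top>\<^bsub>src f\<^esub>"
    "\<And>v w. v \<in> carrier (tgt f) \<Longrightarrow> w \<in> carrier (tgt f) \<Longrightarrow>
      pre f (v \<sqinter>\<^bsub>tgt f\<^esub> w) = pre f v \<sqinter>\<^bsub>src f\<^esub> pre f w"
    "\<And>S. S \<subseteq> carrier (tgt f) \<Longrightarrow> pre f (\<Squnion>\<^bsub>tgt f\<^esub>S) = \<Squnion>\<^bsub>src f\<^esub>(pre f ` S)"
    "pre f \<in> extensional (carrier (tgt f))"
  using assms by (auto simp: locale_map_def frame_hom_def PiE_iff)

lemma locale_map_mono:
  assumes "locale_map f" "v \<in> carrier (tgt f)" "w \<in> carrier (tgt f)" "v \<sqsubseteq>\<^bsub>tgt f\<^esub> w"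
  shows "pre f v \<sqsubseteq>\<^bsub>src f\<^esub> pre f w"
proof -
  interpret X: frame "src f" using assms(1) by (rule locale_mapD)
  interpret Y: frame "tgt f" using assms(1) by (rule locale_mapD)
  have "pre f v \<sqinter>\<^bsub>src f\<^esub> pre f w = pre f v"
    using locale_mapD(5)[OF assms(1-3)] Y.meet_absorb[OF assms(4,2,3)] by simp
  then show ?thesis
    using X.meet_right[of "pre f v" "pre f w"] locale_mapD(3)[OF assms(1)] assms(2,3) by simp
qed

lemma le_ptmap_iff:
  assumes "locale_map f" "p \<in> carrier (src f)" "v \<in> carrier (tgt f)"
  shows "v \<sqsubseteq>\<^bsub>tgt f\<^esub> ptmap f p \<longleftrightarrow> pre f v \<sqsubseteq>\<^bsub>src f\<^esub> p"
proof -
  interpret X: frame "src f" using assms(1) by (rule locale_mapD)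
  interpret Y: frame "tgt f" using assms(1) by (rule locale_mapD)
  let ?S = "{v \<in> carrier (tgt f). pre f v \<sqsubseteq>\<^bsub>src f\<^esub> p}"
  have S: "?S \<subseteq> carrier (tgt f)"
    by auto
  have pc: "ptmap f p \<in> carrier (tgt f)"
    unfolding ptmap_def using S by simp
  show ?thesis
  proof
    assume "pre f v \<sqsubseteq>\<^bsub>src f\<^esub> p"
    then show "v \<sqsubseteq>\<^bsub>tgt f\<^esub> ptmap f p"
      unfolding ptmap_def using assms(3) by (intro Y.sup_upper[OF S]) simp
  next
    assume "v \<sqsubseteq>\<^bsub>tgt f\<^esub> ptmap f p"
    then have "pre f v \<sqsubseteq>\<^bsub>src f\<^esub> pre f (ptmap f p)"
      using locale_map_mono[OF assms(1,3) pc] by simp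
    also have "pre f (ptmap f p) = \<Squnion>\<^bsub>src f\<^esub>(pre f ` ?S)"
      unfolding ptmap_def using locale_mapD(6)[OF assms(1) S] .
    also have "\<dots> \<sqsubseteq>\<^bsub>src f\<^esub> p"
      by (rule X.sup_least) (use locale_mapD(3)[OF assms(1)] assms(2) in auto)
    finally show "pre f v \<sqsubseteq>\<^bsub>src f\<^esub> p"
      using locale_mapD(3)[OF assms(1)] assms(2,3) S by (auto simp: image_subset_iff)
  qed
qed

lemma ptmap_pts:
  assumes "locale_map f" "compact_hausdorff_loc (tgt f)" "p \<in> pts (src f)"
  shows "ptmap f p \<in> pts (tgt f)"
proof -
  note Y = compact_hausdorff_locD[OF assms(2)]
  interpret X: frame "src f" using assms(1) by (rule locale_mapD)
  interpret Y: frame "tgt f" using assms(1) by (rule locale_mapD)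
  have p: "p \<in> carrier (src f)"
    using assms(3) by (rule pts_carrier)
  have c: "ptmap f p \<in> carrier (tgt f)"
    unfolding ptmap_def by (rule Y.sup_closed) auto
  have "ptmap f p \<noteq> \<top>\<^bsub>tgt f\<^esub>"
  proof
    assume "ptmap f p = \<top>\<^bsub>tgt f\<^esub>"
    then have "\<top>\<^bsub>src f\<^esub> \<sqsubseteq>\<^bsub>src f\<^esub> p"
      using le_ptmap_iff[OF assms(1) p Y.top_closed] locale_mapD(4)[OF assms(1)] by simp
    then show False
      using assms(3) X.top_le_iff[OF p] by (simp add: pts_def)
  qed
  moreover have "m = ptmap f p \<or> m = \<top>\<^bsub>tgt f\<^esub>" if m: "m \<in> carrier (tgt f)" "ptmap f p \<sqsubseteq>\<^bsub>tgt f\<^esub> m" for m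
  proof (rule disjCI)
    assume "m \<noteq> \<top>\<^bsub>tgt f\<^esub>"
    have "m \<sqsubseteq>\<^bsub>tgt f\<^esub> ptmap f p"
    proof (rule ccontr)
      assume "\<not> m \<sqsubseteq>\<^bsub>tgt f\<^esub> ptmap f p"
      then obtain w where w: "well_inside (tgt f) w m" "\<not> w \<sqsubseteq>\<^bsub>tgt f\<^esub> ptmap f p"
        using regular_frame_separates[OF Y(1,3) m(1) c] by blast
      then obtain t where t: "w \<in> carrier (tgt f)" "t \<in> carrier (tgt f)"
        "w \<sqinter>\<^bsub>tgt f\<^esub> t = \<bottom>\<^bsub>tgt f\<^esub>" "t \<squnion>\<^bsub>tgt f\<^esub> m = \<top>\<^bsub>tgt f\<^esub>"
        by (auto simp: well_inside_def)
      have "pre f w \<sqinter>\<^bsub>src f\<^esub> pre f t = pre f (\<Squnion>\<^bsub>tgt f\<^esub>{})"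
        using locale_mapD(5)[OF assms(1) t(1,2)] t(3) by (simp add: Y.Sup_empty)
      also have "\<dots> = \<bottom>\<^bsub>src f\<^esub>"
        using locale_mapD(6)[OF assms(1), of "{}"] by (simp add: X.Sup_empty)
      finally have "pre f w \<sqinter>\<^bsub>src f\<^esub> pre f t \<sqsubseteq>\<^bsub>src f\<^esub> p"
        using p by simp
      then have "pre f w \<sqsubseteq>\<^bsub>src f\<^esub> p \<or> pre f t \<sqsubseteq>\<^bsub>src f\<^esub> p"
        using pts_prime[OF locale_mapD(1)[OF assms(1)] assms(3)] locale_mapD(3)[OF assms(1)]
          t(1,2) by simp
      then have "t \<sqsubseteq>\<^bsub>tgt f\<^esub> ptmap f p"
        using w(2) le_ptmap_iff[OF assms(1) p] t by blast
      then have "t \<sqsubseteq>\<^bsub>tgt f\<^esub> m"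
        using Y.le_trans[OF _ m(2)] t m(1) c by blast
      then have "t \<squnion>\<^bsub>tgt f\<^esub> m = m"
        using Y.le_iff_meet t m(1) by simp
      then show False
        using t(4) \<open>m \<noteq> \<top>\<^bsub>tgt f\<^esub>\<close> by simp
    qed
    then show "m = ptmap f p"
      using m c Y.le_antisym by simp
  qed
  ultimately show ?thesis
    using c by (simp add: pts_def)
qed

lemma vimage_ptmap:
  assumes "locale_map f" "compact_hausdorff_loc (tgt f)" "v \<in> carrier (tgt f)"
  shows "{p \<in> pts (src f). ptmap f p \<in> opens_at (tgt f) v} = opens_at (src f) (pre f v)"
  using ptmap_pts[OF assms(1,2)] le_ptmap_iff[OF assms(1) pts_carrier assms(3)]
  by (auto simp: opens_at_def)

lemma continuous_ptmap:
  assumes "locale_map f" "compact_hausdorff_loc (tgt f)"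
  shows "continuous_map (space_of (src f)) (space_of (tgt f)) (ptmap f)"
proof -
  have fr: "frame (src f)" "frame (tgt f)"
    using assms(1) by (simp_all add: locale_mapD)
  show ?thesis
    unfolding continuous_map topspace_space_of[OF fr(1)] topspace_space_of[OF fr(2)]
  proof (intro conjI allI impI)
    show "ptmap f ` pts (src f) \<subseteq> pts (tgt f)"
      using ptmap_pts[OF assms] by blast
    fix V assume "openin (space_of (tgt f)) V"
    then obtain v where v: "v \<in> carrier (tgt f)" "V = opens_at (tgt f) v"
      using openin_space_of[OF fr(2)] by blast
    then show "openin (space_of (src f)) {x \<in> pts (src f). ptmap f x \<in> V}"
      using vimage_ptmap[OF assms v(1)] openin_space_of[OF fr(1)] locale_mapD(3)[OF assms(1) v(1)]
        by auto
  qed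
qed

text \<open>Passing to points is faithful, and by the next lemma full.\<close>

lemma locmap_eqI:
  assumes "locale_map f" "locale_map g" "src f = src g" "tgt f = tgt g"
    and "compact_hausdorff_loc (src f)" "compact_hausdorff_loc (tgt f)"
    and "\<And>p. p \<in> pts (src f) \<Longrightarrow> ptmap f p = ptmap g p"
  shows "f = g"
proof -
  have "pre f v = pre g v" if v: "v \<in> carrier (tgt f)" for v
  proof -
    have "opens_at (src f) (pre f v) = opens_at (src f) (pre g v)"
      unfolding vimage_ptmap[OF assms(1,6) v, symmetric]
        vimage_ptmap[OF assms(2) assms(6)[unfolded assms(4)] v[unfolded assms(4)], folded assms(3,4), symmetric]
      using assms(7) by auto
    then show ?thesis
      using opens_at_inject[OF assms(5)] locale_mapD(3)[OF assms(1) v] locale_mapD(3)[OF assms(2), of v]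
        v assms(3,4) by simp
  qed
  then have "pre f = pre g"
    using extensionalityI[OF locale_mapD(7)[OF assms(1)], of "pre g"] locale_mapD(7)[OF assms(2)]
      assms(4) by simp
  then show ?thesis
    using assms(3,4) by (rule_tac locmap.expand) simp
qed

lemma ex_locmap:
  assumes "compact_hausdorff_loc X" "compact_hausdorff_loc Y"
    "continuous_map (space_of X) (space_of Y) g"
  obtains f where "locale_map f" "src f = X" "tgt f = Y" "\<And>p. p \<in> pts X \<Longrightarrow> ptmap f p = g p"
proof -
  note X = compact_hausdorff_locD[OF assms(1)] and Y = compact_hausdorff_locD[OF assms(2)]
  interpret X: frame X by fact
  interpret Y: frame Y by fact
  define G where "G v = {p \<in> pts X. g p \<in> opens_at Y v}" for v
  have g: "g p \<in> pts Y" if "p \<in> pts X" for p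
    using assms(3) that by (auto simp: continuous_map topspace_space_of X Y)
  have "\<exists>a\<in>carrier X. opens_at X a = G v" if "v \<in> carrier Y" for v
  proof -
    have "openin (space_of Y) (opens_at Y v)"
      using that openin_space_of[OF Y(1)] by blast
    then have "openin (space_of X) {p \<in> topspace (space_of X). g p \<in> opens_at Y v}"
      by (rule openin_continuous_map_preimage[OF assms(3)])
    then show ?thesis
      unfolding openin_space_of[OF X(1)] topspace_space_of[OF X(1)] G_def by metis
  qed
  then have "\<forall>v\<in>carrier Y. \<exists>a. a \<in> carrier X \<and> opens_at X a = G v"
    by blast
  from bchoice[OF this] obtain h where h: "\<And>v. v \<in> carrier Y \<Longrightarrow> h v \<in> carrier X"
    "\<And>v. v \<in> carrier Y \<Longrightarrow> opens_at X (h v) = G v"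
    by blast
  have h_eq: "h v = a" if "v \<in> carrier Y" "a \<in> carrier X" "G v = opens_at X a" for v a
    using opens_at_inject[OF assms(1) h(1)[OF that(1)] that(2)] h(2)[OF that(1)] that(3) by simp
  define f where "f = LocMap X Y (restrict h (carrier Y))"
  have f: "src f = X" "tgt f = Y" "\<And>v. v \<in> carrier Y \<Longrightarrow> pre f v = h v"
    by (simp_all add: f_def)
  have "frame_hom Y X (restrict h (carrier Y))"
    unfolding frame_hom_def
  proof (intro conjI ballI allI impI)
    show "restrict h (carrier Y) \<in> carrier Y \<rightarrow>\<^sub>E carrier X"
      using h(1) by auto
    have "h \<top>\<^bsub>Y\<^esub> = \<top>\<^bsub>X\<^esub>"
      by (rule h_eq) (auto simp: G_def opens_at_top X(1) Y(1) g)
    then show "restrict h (carrier Y) \<top>\<^bsub>Y\<^esub> = \<top>\<^bsub>X\<^esub>"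
      by simp
  next
    fix a b assume ab: "a \<in> carrier Y" "b \<in> carrier Y"
    have "h (a \<sqinter>\<^bsub>Y\<^esub> b) = h a \<sqinter>\<^bsub>X\<^esub> h b"
    proof (rule h_eq)
      show "G (a \<sqinter>\<^bsub>Y\<^esub> b) = opens_at X (h a \<sqinter>\<^bsub>X\<^esub> h b)"
        using opens_at_meet[OF X(1) h(1)[OF ab(1)] h(1)[OF ab(2)]] h(2) ab opens_at_meet[OF Y(1) ab]
        by (auto simp: G_def)
    qed (use ab h(1) in auto)
    then show "restrict h (carrier Y) (a \<sqinter>\<^bsub>Y\<^esub> b) = restrict h (carrier Y) a \<sqinter>\<^bsub>X\<^esub> restrict h (carrier Y) b"
      using ab by simp
  next
    fix S assume S: "S \<subseteq> carrier Y"
    have hS: "h ` S \<subseteq> carrier X"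
      using S h(1) by blast
    have "h (\<Squnion>\<^bsub>Y\<^esub>S) = \<Squnion>\<^bsub>X\<^esub>(h ` S)"
    proof (rule h_eq)
      have "G (\<Squnion>\<^bsub>Y\<^esub>S) = \<Union>(G ` S)"
        using opens_at_Sup[OF Y(1) S] by (auto simp: G_def)
      also have "\<dots> = \<Union>(opens_at X ` (h ` S))"
        using h(2) S by (simp add: image_image subset_iff)
      also have "\<dots> = opens_at X (\<Squnion>\<^bsub>X\<^esub>(h ` S))"
        by (rule opens_at_Sup[OF X(1) hS, symmetric])
      finally show "G (\<Squnion>\<^bsub>Y\<^esub>S) = opens_at X (\<Squnion>\<^bsub>X\<^esub>(h ` S))" .
    qed (use S hS in auto)
    moreover have "restrict h (carrier Y) ` S = h ` S"
      using S by (intro image_cong) auto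
    ultimately show "restrict h (carrier Y) (\<Squnion>\<^bsub>Y\<^esub>S) = \<Squnion>\<^bsub>X\<^esub>(restrict h (carrier Y) ` S)"
      using S by simp
  qed
  then have lm: "locale_map f"
    using X(1) Y(1) by (simp add: locale_map_def f_def)
  have "ptmap f p = g p" if p: "p \<in> pts X" for p
  proof -
    have iff: "v \<sqsubseteq>\<^bsub>Y\<^esub> ptmap f p \<longleftrightarrow> v \<sqsubseteq>\<^bsub>Y\<^esub> g p" if v: "v \<in> carrier Y" for v
    proof -
      have "v \<sqsubseteq>\<^bsub>Y\<^esub> ptmap f p \<longleftrightarrow> p \<notin> opens_at X (h v)"
        using le_ptmap_iff[OF lm, of p v] f v p pts_carrier[OF p] by (simp add: opens_at_def)
      also have "\<dots> \<longleftrightarrow> v \<sqsubseteq>\<^bsub>Y\<^esub> g p"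
        using h(2)[OF v] p g by (simp add: G_def opens_at_def)
      finally show ?thesis .
    qed
    have "ptmap f p \<in> carrier Y" "g p \<in> carrier Y"
      using ptmap_pts[OF lm, of p] f assms(2) p g[OF p] pts_carrier[of _ Y] by auto
    then show ?thesis
      using iff[of "ptmap f p"] iff[of "g p"] Y.le_antisym Y.le_refl by simp
  qed
  then show thesis
    using that lm f by blast
qed

lemma ptmap_loc_id:
  assumes "frame X" "p \<in> carrier X"
  shows "ptmap (loc_id X) p = p"
proof -
  interpret frame X by fact
  have "{v \<in> carrier X. pre (loc_id X) v \<sqsubseteq>\<^bsub>X\<^esub> p} = {v \<in> carrier X. v \<sqsubseteq>\<^bsub>X\<^esub> p}"
    by (auto simp: loc_id_def)
  then have "ptmap (loc_id X) p = \<Squnion>\<^bsub>X\<^esub>{v \<in> carrier X. v \<sqsubseteq>\<^bsub>X\<^esub> p}"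
    by (simp add: ptmap_def loc_id_def)
  also have "\<dots> = p"
  proof (rule le_antisym)
    show "\<Squnion>\<^bsub>X\<^esub>{v \<in> carrier X. v \<sqsubseteq>\<^bsub>X\<^esub> p} \<sqsubseteq>\<^bsub>X\<^esub> p"
      using assms(2) by (intro sup_least) auto
    show "p \<sqsubseteq>\<^bsub>X\<^esub> \<Squnion>\<^bsub>X\<^esub>{v \<in> carrier X. v \<sqsubseteq>\<^bsub>X\<^esub> p}"
      using assms(2) by (intro sup_upper) auto
  qed (use assms(2) in auto)
  finally show ?thesis .
qed

lemma locale_map_comp:
  assumes "locale_map f" "locale_map g" "tgt f = src g"
  shows "locale_map (loc_comp g f)"
proof -
  note F = locale_mapD[OF assms(1)] and G = locale_mapD[OF assms(2)]
  interpret Z: frame "tgt g" by fact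
  have "frame_hom (tgt g) (src f) (compose (carrier (tgt g)) (pre f) (pre g))"
    unfolding frame_hom_def
  proof (intro conjI ballI allI impI)
    fix S assume S: "S \<subseteq> carrier (tgt g)"
    have "compose (carrier (tgt g)) (pre f) (pre g) ` S = pre f ` pre g ` S"
      using S by (auto simp: compose_def image_image intro!: image_cong)
    moreover have "pre g ` S \<subseteq> carrier (tgt f)"
      using S G(3) assms(3) by auto
    ultimately show "compose (carrier (tgt g)) (pre f) (pre g) (\<Squnion>\<^bsub>tgt g\<^esub>S) =
        \<Squnion>\<^bsub>src f\<^esub>(compose (carrier (tgt g)) (pre f) (pre g) ` S)"
      using S F(6) G(6) assms(3) by (simp add: compose_def)
  qed (use F G assms(3) in \<open>auto simp: compose_def\<close>)
  then show ?thesis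
    using F(1) G(2) by (simp add: locale_map_def loc_comp_def)
qed

lemma ptmap_loc_comp:
  assumes "locale_map f" "locale_map g" "tgt f = src g" "p \<in> carrier (src f)"
  shows "ptmap (loc_comp g f) p = ptmap g (ptmap f p)"
proof -
  note G = locale_mapD[OF assms(2)]
  have c: "ptmap f p \<in> carrier (src g)"
  proof -
    interpret Y: frame "tgt f" using assms(1) by (rule locale_mapD)
    show ?thesis
      unfolding ptmap_def assms(3)[symmetric] by (rule Y.sup_closed) auto
  qed
  have "{v \<in> carrier (tgt g). compose (carrier (tgt g)) (pre f) (pre g) v \<sqsubseteq>\<^bsub>src f\<^esub> p} =
      {v \<in> carrier (tgt g). pre g v \<sqsubseteq>\<^bsub>src g\<^esub> ptmap f p}"
    using le_ptmap_iff[OF assms(1,4)] G(3) assms(3) by (auto simp: compose_def)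
  then show ?thesis
    by (simp add: ptmap_def[of "loc_comp g f"] ptmap_def[of g "ptmap f p"]) (simp add: loc_comp_def)
qed

lemma locale_map_id:
  assumes "frame X"
  shows "locale_map (loc_id X)"
proof -
  interpret frame X by fact
  have "(\<lambda>u\<in>carrier X. u) ` S = S" if "S \<subseteq> carrier X" for S
    using that by (auto simp: image_iff)
  then show ?thesis
    using assms by (auto simp: locale_map_def loc_id_def frame_hom_def)
qed


section \<open>Sets with small powerset\<close>

lemma Pow_Un_lepoll:
  assumes "Pow A \<lesssim> U" "Pow B \<lesssim> U" "infinite U"
  shows "Pow (A \<union> B) \<lesssim> U"
proof -
  have "inj_on (\<lambda>S. (S \<inter> A, S \<inter> B)) (Pow (A \<union> B))"
    by (rule inj_onI) blast
  then have "Pow (A \<union> B) \<lesssim> Pow A \<times> Pow B"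
    unfolding lepoll_def by blast
  also have "\<dots> \<lesssim> U \<times> U"
    using assms times_lepoll_mono by blast
  also have "U \<times> U \<approx> U"
    using card_of_Times_same_infinite[OF assms(3)] by (simp add: eqpoll_iff_card_of_ordIso)
  finally show ?thesis .
qed

lemma finite_Pow_lepoll:
  assumes "finite A" "infinite U"
  shows "Pow A \<lesssim> U"
  by (simp add: assms finite_lepoll_infinite)

lemma lepoll_Pow_lepoll: "A \<lesssim> B \<Longrightarrow> Pow B \<lesssim> U \<Longrightarrow> Pow A \<lesssim> U"
  by (meson image_Pow_mono inj_on_image_Pow lepoll_def lepoll_trans)

lemma Pow_Sigma_lepoll:
  assumes "finite I" "\<And>i. i \<in> I \<Longrightarrow> Pow (B i) \<lesssim> U" "infinite U"
  shows "Pow (Sigma I B) \<lesssim> U"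
  using assms(1,2)
proof (induction I rule: finite_induct)
  case empty
  then show ?case
    using assms(3) by (simp add: finite_lepoll_infinite)
next
  case (insert i I)
  have "Pow ({i} \<times> B i) \<lesssim> U"
    by (rule lepoll_Pow_lepoll[of _ "B i"])
      (use insert in \<open>auto simp: eqpoll_imp_lepoll times_singleton_eqpoll\<close>)
  moreover have "Sigma (insert i I) B = {i} \<times> B i \<union> Sigma I B"
    by blast
  ultimately show ?case
    using insert Pow_Un_lepoll[OF _ _ assms(3)] by simp
qed

text \<open>An infinite set has no more finite subsets than elements: each of the countably many sets of
  subsets with at most \<open>n\<close> elements is bounded by induction on \<open>n\<close>.\<close>

lemma Fpow_lepoll:
  assumes "infinite A"
  shows "Fpow A \<lesssim> A"
proof -
  define F where "F n = {S. S \<subseteq> A \<and> finite S \<and> card S \<le> n}" for n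
  have F: "F n \<lesssim> A" for n
  proof (induction n)
    case 0
    have "F 0 = {{}}"
      by (auto simp: F_def)
    then show ?case
      using assms by (simp add: finite_lepoll_infinite)
  next
    case (Suc n)
    have sub: "F (Suc n) \<subseteq> insert {} ((\<lambda>(a, S). insert a S) ` (A \<times> F n))"
    proof
      fix S assume S: "S \<in> F (Suc n)"
      show "S \<in> insert {} ((\<lambda>(a, S). insert a S) ` (A \<times> F n))"
      proof (cases "S = {}")
        case False
        then obtain a where a: "a \<in> S"
          by blast
        then have "S - {a} \<in> F n" "a \<in> A" "S = insert a (S - {a})"
          using S by (auto simp: F_def)
        then show ?thesis
          by (intro insertI2 image_eqI[of _ _ "(a, S - {a})"]) auto
      qed simp
    qed
    have "A \<times> F n \<lesssim> A"
    proof -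
      have "A \<times> F n \<lesssim> A \<times> A"
        using Suc times_lepoll_mono by blast
      also have "A \<times> A \<approx> A"
        using card_of_Times_same_infinite[OF assms] by (simp add: eqpoll_iff_card_of_ordIso)
      finally show ?thesis .
    qed
    then have "(\<lambda>(a, S). insert a S) ` (A \<times> F n) \<lesssim> A"
      using image_lepoll lepoll_trans by blast
    then have "insert {} ((\<lambda>(a, S). insert a S) ` (A \<times> F n)) \<lesssim> A"
      using assms by (metis finite_insert finite_lepoll_infinite infinite_insert_lepoll lepoll_trans)
    then show ?case
      by (rule lepoll_trans[OF subset_imp_lepoll[OF sub]])
  qed
  have "Fpow A = (\<Union>n. F n)"
    by (auto simp: Fpow_def F_def)
  also have "\<dots> \<lesssim> A"
    unfolding lepoll_def card_of_ordLeq
  proof (rule card_of_UNION_ordLeq_infinite[OF assms])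
    show "(card_of (UNIV :: nat set), card_of A) \<in> ordLeq"
      using assms infinite_iff_card_of_nat by blast
    show "\<forall>n\<in>UNIV. (card_of (F n), card_of A) \<in> ordLeq"
      using F unfolding lepoll_def card_of_ordLeq by blast
  qed
  finally show ?thesis .
qed

lemma Pow_Fpow_lepoll:
  assumes "Pow A \<lesssim> U" "infinite U"
  shows "Pow (Fpow A) \<lesssim> U"
proof (cases "finite A")
  case True
  then have "finite (Fpow A)"
    by (simp add: Fpow_def)
  then show ?thesis
    using assms(2) finite_Pow_lepoll by blast
next
  case False
  then show ?thesis
    using assms(1) Fpow_lepoll lepoll_Pow_lepoll by blast
qed

text \<open>An element of a finite product is determined by its graph, a finite subset of the disjoint
  union of the factors.\<close>

lemma Pow_PiE_lepoll:
  assumes "finite I" "\<And>i. i \<in> I \<Longrightarrow> Pow (B i) \<lesssim> U" "infinite U"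
  shows "Pow (PiE I B) \<lesssim> U"
proof -
  let ?g = "\<lambda>f. (\<lambda>i. (i, f i)) ` I"
  have "inj_on ?g (PiE I B)"
  proof (rule inj_onI)
    fix f f' assume *: "f \<in> PiE I B" "f' \<in> PiE I B" "?g f = ?g f'"
    then have "f i = f' i" if "i \<in> I" for i
    proof -
      have "(i, f i) \<in> ?g f'"
        using that *(3) by blast
      then show ?thesis
        by blast
    qed
    with *(1,2) show "f = f'"
      by (rule PiE_ext)
  qed
  moreover have "?g ` PiE I B \<subseteq> Fpow (Sigma I B)"
    using assms(1) by (auto simp: Fpow_def)
  ultimately have "PiE I B \<lesssim> Fpow (Sigma I B)"
    unfolding lepoll_def by (intro exI[of _ ?g] conjI)
  then show ?thesis
    using lepoll_Pow_lepoll Pow_Fpow_lepoll Pow_Sigma_lepoll assms by blast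
qed

section \<open>Spaces of small weight\<close>

text \<open>A base of a topology, stated pointwise.\<close>

definition topology_base :: "'t topology \<Rightarrow> 't set set \<Rightarrow> bool" where
  "topology_base S B \<longleftrightarrow> (\<forall>b\<in>B. openin S b) \<and>
     (\<forall>V x. openin S V \<longrightarrow> x \<in> V \<longrightarrow> (\<exists>b\<in>B. x \<in> b \<and> b \<subseteq> V))"

text \<open>The space has a base whose powerset embeds in \<open>U\<close>. With \<open>U\<close> the universe this is the
  condition that \<open>small_loc\<close> imposes on the frame of opens.\<close>

definition small_weight :: "'t topology \<Rightarrow> 'u set \<Rightarrow> bool" where
  "small_weight S U \<longleftrightarrow> (\<exists>B. topology_base S B \<and> Pow B \<lesssim> U)"

lemma small_weightI:
  assumes "\<And>b. b \<in> B \<Longrightarrow> openin S b"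
    "\<And>V x. openin S V \<Longrightarrow> x \<in> V \<Longrightarrow> \<exists>b\<in>B. x \<in> b \<and> b \<subseteq> V" "Pow B \<lesssim> U"
  shows "small_weight S U"
  unfolding small_weight_def topology_base_def using assms by (intro exI[of _ B]) simp

lemma small_weight_subtopology:
  assumes "small_weight S U"
  shows "small_weight (subtopology S K) U"
proof -
  obtain B where "topology_base S B" "Pow B \<lesssim> U"
    using assms by (auto simp: small_weight_def)
  then have B: "\<And>b. b \<in> B \<Longrightarrow> openin S b"
    "\<And>V x. openin S V \<Longrightarrow> x \<in> V \<Longrightarrow> \<exists>b\<in>B. x \<in> b \<and> b \<subseteq> V" "Pow B \<lesssim> U"
    by (simp_all add: topology_base_def)
  let ?B = "(\<lambda>b. b \<inter> K) ` B"
  have "openin (subtopology S K) b" if "b \<in> ?B" for b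
    using that B(1) unfolding openin_subtopology by blast
  moreover have "\<exists>b\<in>?B. x \<in> b \<and> b \<subseteq> V" if V: "openin (subtopology S K) V" "x \<in> V" for V x
  proof -
    obtain W where "openin S W" "V = W \<inter> K"
      using V(1) unfolding openin_subtopology by blast
    moreover obtain b where "b \<in> B" "x \<in> b" "b \<subseteq> W"
      using B(2)[of W x] V(2) calculation by blast
    ultimately show ?thesis
      using V(2) by (intro bexI[of _ "b \<inter> K"]) auto
  qed
  moreover have "Pow ?B \<lesssim> U"
    by (rule lepoll_Pow_lepoll[OF image_lepoll B(3)])
  ultimately show ?thesis
    by (rule small_weightI[of ?B])
qed

lemma small_weight_product_topology:
  assumes "finite I" "\<And>i. i \<in> I \<Longrightarrow> small_weight (S i) U" "infinite U"
  shows "small_weight (product_topology S I) U"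
proof -
  have "\<forall>i\<in>I. \<exists>B. topology_base (S i) B \<and> Pow B \<lesssim> U"
    using assms(2) unfolding small_weight_def by blast
  from bchoice[OF this] obtain B where "\<forall>i\<in>I. topology_base (S i) (B i) \<and> Pow (B i) \<lesssim> U" ..
  then have B: "\<And>i b. i \<in> I \<Longrightarrow> b \<in> B i \<Longrightarrow> openin (S i) b"
    "\<And>i V x. i \<in> I \<Longrightarrow> openin (S i) V \<Longrightarrow> x \<in> V \<Longrightarrow> \<exists>b\<in>B i. x \<in> b \<and> b \<subseteq> V"
    "\<And>i. i \<in> I \<Longrightarrow> Pow (B i) \<lesssim> U"
    by (simp_all add: topology_base_def)
  let ?B = "PiE I ` PiE I B"
  have "openin (product_topology S I) b" if "b \<in> ?B" for b
    using that B(1) assms(1) by (auto simp: openin_PiE_gen PiE_iff)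
  moreover have "\<exists>b\<in>?B. x \<in> b \<and> b \<subseteq> V" if V: "openin (product_topology S I) V" "x \<in> V" for V x
  proof -
    obtain W where W: "\<And>i. i \<in> I \<Longrightarrow> openin (S i) (W i)" "x \<in> PiE I W" "PiE I W \<subseteq> V"
      using V unfolding openin_product_topology_alt by metis
    have "\<forall>i\<in>I. \<exists>b\<in>B i. x i \<in> b \<and> b \<subseteq> W i"
      using B(2) W(1,2) by (metis PiE_mem)
    then obtain b where b: "\<And>i. i \<in> I \<Longrightarrow> b i \<in> B i \<and> x i \<in> b i \<and> b i \<subseteq> W i"
      by metis
    let ?b = "restrict b I"
    have "?b \<in> PiE I B" "x \<in> PiE I ?b"
      using b W(2) by (auto simp: PiE_iff)
    moreover have "PiE I ?b \<subseteq> V"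
      by (rule subset_trans[OF PiE_mono W(3)]) (use b in simp)
    ultimately show ?thesis
      by (intro bexI[of _ "PiE I ?b"]) auto
  qed
  moreover have "Pow ?B \<lesssim> U"
    by (rule lepoll_Pow_lepoll[OF image_lepoll Pow_PiE_lepoll[OF assms(1) B(3) assms(3)]])
  ultimately show ?thesis
    by (rule small_weightI[of ?B])
qed

text \<open>A base of the image consists of the sets of points whose whole fibre lies in a given finite
  union of basic open sets; compactness of the fibres makes these sets a base.\<close>

lemma small_weight_image:
  assumes "compact_space S" "continuous_map S T q" "q ` topspace S = topspace T"
    and "closed_map S T q" "t1_space T" "small_weight S U" "infinite U"
  shows "small_weight T U"
proof -
  obtain B where "topology_base S B" "Pow B \<lesssim> U"
    using assms(6) by (auto simp: small_weight_def)
  then have B: "\<And>b. b \<in> B \<Longrightarrow> openin S b"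
    "\<And>V x. openin S V \<Longrightarrow> x \<in> V \<Longrightarrow> \<exists>b\<in>B. x \<in> b \<and> b \<subseteq> V" "Pow B \<lesssim> U"
    by (simp_all add: topology_base_def)
  define g where "g F = topspace T - q ` (topspace S - \<Union>F)" for F
  let ?B = "g ` Fpow B"
  have "openin T b" if b: "b \<in> ?B" for b
  proof -
    obtain F where F: "F \<in> Fpow B" "b = g F"
      using b by blast
    have "openin S (\<Union>F)"
      by (rule openin_Union) (use F(1) B(1) in \<open>auto simp: Fpow_def\<close>)
    then show ?thesis
      using assms(4) unfolding F(2) g_def closed_map_def by blast
  qed
  moreover have "\<exists>b\<in>?B. y \<in> b \<and> b \<subseteq> V" if V: "openin T V" "y \<in> V" for V y
  proof -
    let ?K = "{x \<in> topspace S. q x = y}" and ?W = "{x \<in> topspace S. q x \<in> V}"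
    have y: "y \<in> topspace T"
      using V openin_subset by blast
    then have "closedin T {y}"
      by (rule closedin_t1_singleton[OF assms(5)])
    with assms(2) have "closedin S {x \<in> topspace S. q x \<in> {y}}"
      by (rule closedin_continuous_map_preimage)
    then have K: "compactin S ?K"
      using assms(1) closedin_compact_space by simp
    have W: "openin S ?W"
      using assms(2) V(1) openin_continuous_map_preimage by blast
    let ?C = "{b \<in> B. b \<subseteq> ?W}"
    have "?K \<subseteq> \<Union>?C"
      using B(2)[OF W] V(2) by fastforce
    then obtain F where F: "finite F" "F \<subseteq> ?C" "?K \<subseteq> \<Union>F"
      using K B(1) unfolding compactin_def by (metis (no_types, lifting) mem_Collect_eq)
    have "F \<in> Fpow B"
      using F by (auto simp: Fpow_def)
    moreover have "y \<in> g F"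
      using F(3) y by (auto simp: g_def)
    moreover have "g F \<subseteq> V"
    proof
      fix z assume z: "z \<in> g F"
      then obtain x where x: "x \<in> topspace S" "z = q x"
        using assms(3) by (auto simp: g_def)
      then have "x \<in> \<Union>F"
        using z by (auto simp: g_def)
      then show "z \<in> V"
        using F(2) x by blast
    qed
    ultimately show ?thesis
      by blast
  qed
  moreover have "Pow ?B \<lesssim> U"
    by (rule lepoll_Pow_lepoll[OF image_lepoll Pow_Fpow_lepoll[OF B(3) assms(7)]])
  ultimately show ?thesis
    by (rule small_weightI[of ?B])
qed

section \<open>Maps and quotients of compact Hausdorff spaces\<close>

text \<open>A continuous injection of a compact space into a Hausdorff space is an embedding, so
  continuity of a map into its domain can be tested after composing with it. Dually, by the next
  lemma, a continuous surjection from a compact space onto a Hausdorff space is a quotient map, and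
  continuity of a map out of its codomain can be tested after composing with the surjection.\<close>

lemma continuous_map_lift_injective:
  assumes "compact_space P" "Hausdorff_space Y" "continuous_map P Y j" "inj_on j (topspace P)"
    and "g \<in> topspace W \<rightarrow> topspace P" "continuous_map W Y (j \<circ> g)"
  shows "continuous_map W P g"
  unfolding continuous_map_closedin
proof (intro conjI allI impI)
  show "g \<in> topspace W \<rightarrow> topspace P"
    by fact
  fix C assume C: "closedin P C"
  then have "closedin Y (j ` C)"
    using continuous_imp_closed_map[OF assms(3,1,2)] by (simp add: closed_map_def)
  then have "closedin W {x \<in> topspace W. (j \<circ> g) x \<in> j ` C}"
    using assms(6) closedin_continuous_map_preimage by blast
  moreover have "{x \<in> topspace W. (j \<circ> g) x \<in> j ` C} = {x \<in> topspace W. g x \<in> C}"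
    using assms(4,5) closedin_subset[OF C] by (auto simp: inj_on_def Pi_iff subset_iff)
  ultimately show "closedin W {x \<in> topspace W. g x \<in> C}"
    by simp
qed

lemma continuous_map_descend_surjective:
  assumes "compact_space S" "Hausdorff_space T" "continuous_map S T q" "q ` topspace S = topspace T"
    and "continuous_map S Z (g \<circ> q)"
  shows "continuous_map T Z g"
proof -
  have "quotient_map S T q"
    using continuous_imp_closed_map[OF assms(3,1,2)] assms(3,4) continuous_closed_imp_quotient_map
      by blast
  then show ?thesis
    using assms(5) continuous_compose_quotient_map by blast
qed

text \<open>The quotient map is closed, because the saturation of a closed set \<open>C\<close> is the projection of the
  compact set \<open>E \<inter> (C \<times> S)\<close>. The image of a compact Hausdorff
  space under a closed continuous map is Hausdorff.\<close>

theorem compact_Hausdorff_quotient: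
  fixes S :: "'t topology" and E :: "('t \<times> 't) set" and U :: "'u set"
  assumes "compact_space S" "Hausdorff_space S" "small_weight S U" "infinite U"
    and E: "equiv (topspace S) E" "closedin (prod_topology S S) E"
  obtains T :: "'t set topology" and q where "compact_space T" "Hausdorff_space T" "small_weight T U"
    "continuous_map S T q" "q ` topspace S = topspace T"
    "\<And>x y. x \<in> topspace S \<Longrightarrow> y \<in> topspace S \<Longrightarrow> q x = q y \<longleftrightarrow> (x, y) \<in> E"
proof -
  define q where "q x = E `` {x}" for x
  have q_eq: "q x = q y \<longleftrightarrow> (x, y) \<in> E" if "x \<in> topspace S" "y \<in> topspace S" for x y
    using E(1) that eq_equiv_class_iff[of "topspace S" E x y] by (simp add: q_def)
  define opn where "opn V \<longleftrightarrow> V \<subseteq> q ` topspace S \<and> openin S {x \<in> topspace S. q x \<in> V}" for V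
  have "istopology opn"
    unfolding istopology_def
  proof (intro conjI allI impI)
    fix V W assume "opn V" "opn W"
    moreover have
      "{x \<in> topspace S. q x \<in> V \<inter> W} = {x \<in> topspace S. q x \<in> V} \<inter> {x \<in> topspace S. q x \<in> W}"
      by blast
    ultimately show "opn (V \<inter> W)"
      unfolding opn_def by auto
  next
    fix K assume K: "\<forall>V\<in>K. opn V"
    have "{x \<in> topspace S. q x \<in> \<Union>K} = \<Union>((\<lambda>V. {x \<in> topspace S. q x \<in> V}) ` K)"
      by blast
    moreover have "openin S (\<Union>((\<lambda>V. {x \<in> topspace S. q x \<in> V}) ` K))"
      by (rule openin_Union) (use K in \<open>auto simp: opn_def\<close>)
    ultimately show "opn (\<Union>K)"
      using K unfolding opn_def by auto
  qed
  define T where "T = topology opn"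
  have openT: "openin T V \<longleftrightarrow> opn V" for V
    unfolding T_def using \<open>istopology opn\<close> by simp
  have "{x \<in> topspace S. q x \<in> q ` topspace S} = topspace S"
    by blast
  then have "opn (q ` topspace S)"
    by (simp add: opn_def)
  then have topT: "topspace T = q ` topspace S"
    by (intro subset_antisym openin_subset) (auto simp: openT topspace_def opn_def)
  have quot: "quotient_map S T q"
    unfolding quotient_map_def by (auto simp: topT openT opn_def)
  then have cont: "continuous_map S T q"
    using quotient_imp_continuous_map by blast
  have closed: "closed_map S T q"
    unfolding closed_map_def
  proof (intro allI impI)
    fix C assume C: "closedin S C"
    have "closedin (prod_topology S S) (E \<inter> (C \<times> topspace S))"
      using C E(2) by (intro closedin_Int) (auto simp: closedin_prod_Times_iff)
    then have "compactin (prod_topology S S) (E \<inter> (C \<times> topspace S))"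
      using assms(1) by (intro closedin_compact_space) (auto simp: compact_space_prod_topology)
    then have "compactin S (snd ` (E \<inter> (C \<times> topspace S)))"
      by (rule image_compactin) (rule continuous_map_snd)
    then have "closedin S (snd ` (E \<inter> (C \<times> topspace S)))"
      using assms(2) compactin_imp_closedin by blast
    moreover have "snd ` (E \<inter> (C \<times> topspace S)) = {x \<in> topspace S. q x \<in> q ` C}"
    proof (intro subset_antisym subsetI)
      fix y assume "y \<in> snd ` (E \<inter> (C \<times> topspace S))"
      then obtain x where "(x, y) \<in> E" "x \<in> C" "y \<in> topspace S"
        by auto
      then show "y \<in> {x \<in> topspace S. q x \<in> q ` C}"
        using q_eq[of x y] closedin_subset[OF C] by auto
    next
      fix y assume "y \<in> {x \<in> topspace S. q x \<in> q ` C}"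
      then obtain x where "x \<in> C" "q x = q y" "y \<in> topspace S"
        by auto
      then have "(x, y) \<in> E \<inter> (C \<times> topspace S)"
        using q_eq[of x y] closedin_subset[OF C] by auto
      then show "y \<in> snd ` (E \<inter> (C \<times> topspace S))"
        by force
    qed
    ultimately show "closedin T (q ` C)"
      using quot image_mono[OF closedin_subset[OF C], of q] unfolding quotient_map_closedin topT by simp
  qed
  have surj: "q ` topspace S = topspace T"
    by (simp add: topT)
  have normal: "normal_space S"
    using assms(1,2) compact_Hausdorff_or_regular_imp_normal_space by blast
  have "Hausdorff_space T"
    using normal_Hausdorff_space_closed_continuous_map_image[OF normal assms(2) closed cont surj]
      by blast
  moreover have "compact_space T"
    using image_compactin[OF _ cont, of "topspace S"] assms(1) surj by (simp add: compact_space_def)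
  moreover have "small_weight T U"
    using small_weight_image[OF assms(1) cont surj closed _ assms(3,4)] \<open>Hausdorff_space T\<close>
      Hausdorff_imp_t1_space by blast
  ultimately show thesis
    using that cont surj q_eq by blast
qed


section \<open>Compact Hausdorff spaces as locales\<close>

lemma directed_in_finite_bound:
  assumes "directed_in X D" "partial_order X" "finite F" "F \<subseteq> D"
  shows "\<exists>c\<in>D. \<forall>a\<in>F. a \<sqsubseteq>\<^bsub>X\<^esub> c"
  using assms(3,4)
proof (induction F rule: finite_induct)
  case empty
  then show ?case
    using assms(1) by (auto simp: directed_in_def)
next
  interpret partial_order X by fact
  case (insert a F)
  then obtain c where c: "c \<in> D" "\<forall>a\<in>F. a \<sqsubseteq>\<^bsub>X\<^esub> c"
    by auto
  then obtain c' where c': "c' \<in> D" "a \<sqsubseteq>\<^bsub>X\<^esub> c'" "c \<sqsubseteq>\<^bsub>X\<^esub> c'"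
    using assms(1) insert.prems unfolding directed_in_def by (meson insert_subset)
  have D: "D \<subseteq> carrier X"
    using assms(1) by (simp add: directed_in_def)
  have "b \<sqsubseteq>\<^bsub>X\<^esub> c'" if "b \<in> F" for b
    using le_trans[of b c c'] c c' D insert.prems that by blast
  then show ?case
    using c' by blast
qed

text \<open>A copy inside the type \<open>'u\<close> of the frame of opens of a space, along an injection \<open>e\<close> of the
  set of opens into \<open>'u\<close>.\<close>

locale coded_opens =
  fixes S :: "'t topology" and e :: "'t set \<Rightarrow> 'u"
  assumes inj: "inj_on e {V. openin S V}"
begin

text \<open>The open set coded by an element of \<open>'u\<close>.\<close>

definition dec :: "'u \<Rightarrow> 't set" where
  "dec = inv_into {V. openin S V} e"

text \<open>The frame of codes, ordered by inclusion of the coded open sets.\<close>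

definition frm :: "'u gorder" where
  "frm = \<lparr>carrier = e ` {V. openin S V}, eq = (=), le = (\<lambda>a b. dec a \<subseteq> dec b)\<rparr>"

lemma dec_e [simp]: "openin S V \<Longrightarrow> dec (e V) = V"
  unfolding dec_def using inj by simp

lemma le_frm [simp]: "a \<sqsubseteq>\<^bsub>frm\<^esub> b \<longleftrightarrow> dec a \<subseteq> dec b"
  by (simp add: frm_def)

lemma eq_frm [simp]: "(.=\<^bsub>frm\<^esub>) = (=)"
  by (simp add: frm_def)

lemma e_carrier [simp]: "openin S V \<Longrightarrow> e V \<in> carrier frm"
  by (simp add: frm_def)

lemma dec_open [simp]: "a \<in> carrier frm \<Longrightarrow> openin S (dec a)"
  by (auto simp: frm_def)

lemma e_dec [simp]: "a \<in> carrier frm \<Longrightarrow> e (dec a) = a"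
  by (auto simp: frm_def)

lemma dec_Union_open [simp]: "A \<subseteq> carrier frm \<Longrightarrow> openin S (\<Union>(dec ` A))"
  by (rule openin_Union) auto

lemma partial_order_frm: "partial_order frm"
proof -
  have "x = y" if "x \<in> carrier frm" "y \<in> carrier frm" "dec x = dec y" for x y
    using that e_dec by metis
  then show ?thesis
    by unfold_locales auto
qed

lemma least_frm:
  assumes "A \<subseteq> carrier frm"
  shows "least frm (e (\<Union>(dec ` A))) (Upper frm A)"
proof -
  have op: "openin S (\<Union>(dec ` A))"
    using assms by (rule dec_Union_open)
  then have "e (\<Union>(dec ` A)) \<in> Upper frm A"
    by (auto simp: Upper_def)
  moreover have "e (\<Union>(dec ` A)) \<sqsubseteq>\<^bsub>frm\<^esub> u" if "u \<in> Upper frm A" for u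
    using op that assms by (auto simp: Upper_def)
  ultimately show ?thesis
    by (auto simp: least_def)
qed

lemma greatest_frm:
  assumes "A \<subseteq> carrier frm"
  defines "V \<equiv> \<Union>{W. openin S W \<and> (\<forall>a\<in>A. W \<subseteq> dec a)}"
  shows "greatest frm (e V) (Lower frm A)"
proof -
  have V: "openin S V"
    unfolding V_def by (rule openin_Union) auto
  have "e V \<in> Lower frm A"
    using V by (auto simp: Lower_def V_def)
  moreover have "l \<sqsubseteq>\<^bsub>frm\<^esub> e V" if "l \<in> Lower frm A" for l
  proof -
    have "openin S (dec l)" "\<forall>a\<in>A. dec l \<subseteq> dec a"
      using that assms(1) by (auto simp: Lower_def)
    then have "dec l \<subseteq> V"
      unfolding V_def by blast
    then show ?thesis
      using V by simp
  qed
  ultimately show ?thesis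
    by (auto simp: greatest_def)
qed

lemma complete_lattice_frm: "complete_lattice frm"
proof -
  interpret partial_order frm by (rule partial_order_frm)
  show ?thesis
    by unfold_locales (use least_frm greatest_frm in blast)+
qed

lemma Sup_frm:
  assumes "A \<subseteq> carrier frm"
  shows "\<Squnion>\<^bsub>frm\<^esub>A = e (\<Union>(dec ` A))"
proof -
  interpret complete_lattice frm by (rule complete_lattice_frm)
  show ?thesis
    using least_unique[OF sup_lub[OF assms] least_frm[OF assms]] .
qed

lemma join_frm:
  assumes "a \<in> carrier frm" "b \<in> carrier frm"
  shows "a \<squnion>\<^bsub>frm\<^esub> b = e (dec a \<union> dec b)"
  using Sup_frm[of "{a, b}"] assms by (simp add: join_def)

lemma meet_frm:
  assumes "a \<in> carrier frm" "b \<in> carrier frm"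
  shows "a \<sqinter>\<^bsub>frm\<^esub> b = e (dec a \<inter> dec b)"
proof -
  interpret complete_lattice frm by (rule complete_lattice_frm)
  have o: "openin S (dec a \<inter> dec b)"
    using assms by auto
  show ?thesis
  proof (rule le_antisym)
    have "a \<sqinter>\<^bsub>frm\<^esub> b \<sqsubseteq>\<^bsub>frm\<^esub> a" "a \<sqinter>\<^bsub>frm\<^esub> b \<sqsubseteq>\<^bsub>frm\<^esub> b"
      using meet_left meet_right assms by blast+
    then show "a \<sqinter>\<^bsub>frm\<^esub> b \<sqsubseteq>\<^bsub>frm\<^esub> e (dec a \<inter> dec b)"
      using o by simp
    show "e (dec a \<inter> dec b) \<sqsubseteq>\<^bsub>frm\<^esub> a \<sqinter>\<^bsub>frm\<^esub> b"
      by (rule meet_le) (use o assms in auto)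
  qed (use o assms in auto)
qed

lemma top_frm: "\<top>\<^bsub>frm\<^esub> = e (topspace S)"
proof -
  interpret complete_lattice frm by (rule complete_lattice_frm)
  have "e (topspace S) \<sqsubseteq>\<^bsub>frm\<^esub> \<top>\<^bsub>frm\<^esub>"
    by (rule top_higher) simp
  then show ?thesis
    using openin_subset[OF dec_open[of "\<top>\<^bsub>frm\<^esub>"]] by (intro le_antisym) auto
qed

lemma bottom_frm: "\<bottom>\<^bsub>frm\<^esub> = e {}"
proof -
  interpret complete_lattice frm by (rule complete_lattice_frm)
  have "\<bottom>\<^bsub>frm\<^esub> \<sqsubseteq>\<^bsub>frm\<^esub> e {}"
    by (rule bottom_lower) simp
  then show ?thesis
    by (intro le_antisym) auto
qed

lemma frame_frm: "frame frm"
proof -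
  interpret complete_lattice frm by (rule complete_lattice_frm)
  show ?thesis
  proof
    fix a A assume *: "a \<in> carrier frm" "A \<subseteq> carrier frm"
    have m: "(\<lambda>s. a \<sqinter>\<^bsub>frm\<^esub> s) ` A \<subseteq> carrier frm"
      using * by auto
    have "dec (a \<sqinter>\<^bsub>frm\<^esub> s) = dec a \<inter> dec s" if "s \<in> A" for s
      using that * by (subst meet_frm) (auto intro!: dec_e intro: openin_Int dec_open)
    then have "(\<Union>s\<in>A. dec (a \<sqinter>\<^bsub>frm\<^esub> s)) = dec a \<inter> \<Union>(dec ` A)"
      by auto
    then show "a \<sqinter>\<^bsub>frm\<^esub> \<Squnion>\<^bsub>frm\<^esub>A = \<Squnion>\<^bsub>frm\<^esub>((\<lambda>s. a \<sqinter>\<^bsub>frm\<^esub> s) ` A)"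
      using * by (simp add: Sup_frm[OF m] Sup_frm[OF *(2)] meet_frm image_image)
  qed
qed

lemma compact_loc_frm:
  assumes "compact_space S"
  shows "compact_loc frm"
  unfolding compact_loc_def
proof (intro allI impI)
  fix D assume *: "directed_in frm D \<and> \<Squnion>\<^bsub>frm\<^esub>D = \<top>\<^bsub>frm\<^esub>"
  then have D: "D \<subseteq> carrier frm"
    by (simp add: directed_in_def)
  have "e (\<Union>(dec ` D)) = e (topspace S)"
    using * Sup_frm[OF D] top_frm by simp
  then have "\<Union>(dec ` D) = topspace S"
    by (metis D dec_Union_open dec_e openin_topspace)
  moreover have "\<forall>V\<in>dec ` D. openin S V"
    using D by auto
  ultimately obtain F where "finite F" "F \<subseteq> dec ` D" "topspace S \<subseteq> \<Union>F"
    using assms unfolding compact_space_alt by (metis order_refl)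
  then obtain G where G: "finite G" "G \<subseteq> D" "topspace S \<subseteq> \<Union>(dec ` G)"
    by (metis finite_subset_image)
  then obtain c where c: "c \<in> D" "\<forall>a\<in>G. a \<sqsubseteq>\<^bsub>frm\<^esub> c"
    using directed_in_finite_bound[OF _ partial_order_frm] * by blast
  have "dec c = topspace S"
  proof
    show "dec c \<subseteq> topspace S"
      using c(1) D by (intro openin_subset dec_open) auto
    show "topspace S \<subseteq> dec c"
      using c(2) G(3) unfolding le_frm by blast
  qed
  then have "c = \<top>\<^bsub>frm\<^esub>"
    using top_frm e_dec[of c] c(1) D by auto
  then show "\<top>\<^bsub>frm\<^esub> \<in> D"
    using c by simp
qed

lemma regular_frame_frm:
  assumes "regular_space S"
  shows "regular_frame frm"
  unfolding regular_frame_def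
proof
  fix a assume a: "a \<in> carrier frm"
  let ?W = "{w. well_inside frm w a}"
  have W: "?W \<subseteq> carrier frm"
    by (auto simp: well_inside_def)
  have "x \<in> \<Union>(dec ` ?W)" if x: "x \<in> dec a" for x
  proof -
    have "closedin S (topspace S - dec a)" "x \<in> topspace S - (topspace S - dec a)"
      using a x openin_subset[OF dec_open[OF a]] by auto
    then obtain V T where VT: "openin S V" "openin S T" "x \<in> V" "topspace S - dec a \<subseteq> T" "disjnt V T"
      using assms[unfolded regular_space_def, rule_format, of "topspace S - dec a" x] by blast
    have "e V \<sqinter>\<^bsub>frm\<^esub> e T = \<bottom>\<^bsub>frm\<^esub>"
      using VT by (simp add: meet_frm bottom_frm disjnt_def)
    moreover have "T \<union> dec a = topspace S"
      using VT openin_subset[OF dec_open[OF a]] openin_subset[OF VT(2)] by blast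
    then have "e T \<squnion>\<^bsub>frm\<^esub> a = \<top>\<^bsub>frm\<^esub>"
      using VT a by (simp add: join_frm top_frm)
    ultimately have "e V \<in> ?W"
      using VT by (auto simp: well_inside_def)
    then show ?thesis
      using VT(1,3) by force
  qed
  then show "a \<sqsubseteq>\<^bsub>frm\<^esub> \<Squnion>\<^bsub>frm\<^esub>?W"
    using W by (auto simp: Sup_frm)
qed

lemma small_loc_frm:
  assumes "small_weight S (UNIV :: 'u set)"
  shows "small_loc frm"
proof -
  obtain B where "topology_base S B" and P: "Pow B \<lesssim> (UNIV :: 'u set)"
    using assms by (auto simp: small_weight_def)
  then have B: "\<And>b. b \<in> B \<Longrightarrow> openin S b"
    "\<And>V x. openin S V \<Longrightarrow> x \<in> V \<Longrightarrow> \<exists>b\<in>B. x \<in> b \<and> b \<subseteq> V"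
    by (simp_all add: topology_base_def)
  have "a = \<Squnion>\<^bsub>frm\<^esub>(e ` {b \<in> B. b \<subseteq> dec a})" if a: "a \<in> carrier frm" for a
  proof -
    have "dec ` e ` {b \<in> B. b \<subseteq> dec a} = {b \<in> B. b \<subseteq> dec a}"
      using B(1) by (force simp: image_iff)
    moreover have "\<Union>{b \<in> B. b \<subseteq> dec a} = dec a"
      using B(2)[OF dec_open[OF a]] by blast
    moreover have "e ` {b \<in> B. b \<subseteq> dec a} \<subseteq> carrier frm"
      using B(1) by auto
    ultimately show ?thesis
      using a by (simp add: Sup_frm)
  qed
  then have "is_base frm (e ` B)"
    unfolding is_base_def
  proof (intro conjI ballI)
    fix a assume "a \<in> carrier frm"
    then have "a = \<Squnion>\<^bsub>frm\<^esub>(e ` {b \<in> B. b \<subseteq> dec a})"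
      using \<open>\<And>a. a \<in> carrier frm \<Longrightarrow> a = \<Squnion>\<^bsub>frm\<^esub>(e ` {b \<in> B. b \<subseteq> dec a})\<close> by blast
    then show "\<exists>S\<subseteq>e ` B. a = \<Squnion>\<^bsub>frm\<^esub>S"
      by (intro exI[of _ "e ` {b \<in> B. b \<subseteq> dec a}"]) auto
  qed (use B(1) in auto)
  moreover have "Pow (e ` B) \<lesssim> (UNIV :: 'u set)"
    by (rule lepoll_Pow_lepoll[OF image_lepoll P])
  ultimately show ?thesis
    by (auto simp: small_loc_def)
qed

text \<open>The maximal opens different from the whole space are the complements of points.\<close>

lemma homeomorphic_map_frm:
  assumes "compact_space S" "Hausdorff_space S"
  shows "homeomorphic_map S (space_of frm) (\<lambda>s. e (topspace S - {s}))"
proof -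
  have reg: "regular_space S"
    using assms compact_Hausdorff_imp_regular_space by blast
  have ch: "compact_hausdorff_loc frm"
    using frame_frm compact_loc_frm[OF assms(1)]
      hausdorff_if_regular_frame[OF frame_frm regular_frame_frm[OF reg]]
    by (simp add: compact_hausdorff_loc_def)
  have op: "openin S (topspace S - {s})" for s
    using assms(2) Hausdorff_imp_t1_space t1_space_openin_delete_alt by blast
  have sub: "dec a \<subseteq> topspace S" if "a \<in> carrier frm" for a
    using openin_subset[OF dec_open[OF that]] .
  have e_eq: "e V = e W \<longleftrightarrow> V = W" if "openin S V" "openin S W" for V W
    using inj that by (auto simp: inj_on_def)
  let ?\<phi> = "\<lambda>s. e (topspace S - {s})"
  have pt: "?\<phi> s \<in> pts frm" if s: "s \<in> topspace S" for s
    unfolding pts_def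
  proof (intro CollectI conjI ballI impI)
    show "?\<phi> s \<noteq> \<top>\<^bsub>frm\<^esub>"
      using s op by (auto simp: top_frm e_eq)
    fix m assume m: "m \<in> carrier frm" "?\<phi> s \<sqsubseteq>\<^bsub>frm\<^esub> m"
    have "topspace S - {s} \<subseteq> dec m"
      using m(2) op by simp
    then have "dec m = topspace S - {s} \<or> dec m = topspace S"
      using sub[OF m(1)] by blast
    then have "e (dec m) = ?\<phi> s \<or> e (dec m) = \<top>\<^bsub>frm\<^esub>"
      unfolding top_frm by metis
    then show "m = ?\<phi> s \<or> m = \<top>\<^bsub>frm\<^esub>"
      using e_dec[OF m(1)] by simp
  qed (use op in simp)
  have surj: "\<exists>s\<in>topspace S. p = ?\<phi> s" if p: "p \<in> pts frm" for p
  proof -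
    have c: "p \<in> carrier frm"
      using p by (rule pts_carrier)
    have "dec p \<noteq> topspace S"
    proof
      assume "dec p = topspace S"
      then have "p = \<top>\<^bsub>frm\<^esub>"
        unfolding top_frm using e_dec[OF c] by metis
      then show False
        using p by (simp add: pts_def)
    qed
    then obtain s where s: "s \<in> topspace S" "s \<notin> dec p"
      using sub[OF c] by blast
    then have "p \<sqsubseteq>\<^bsub>frm\<^esub> ?\<phi> s"
      using sub[OF c] op by auto
    moreover have "?\<phi> s \<noteq> \<top>\<^bsub>frm\<^esub>"
      using pt[OF s(1)] by (simp add: pts_def)
    ultimately have "?\<phi> s = p"
      using p e_carrier[OF op, of s] unfolding pts_def by blast
    then show ?thesis
      using s(1) by blast
  qed
  have "continuous_map S (space_of frm) ?\<phi>"
    unfolding continuous_map topspace_space_of[OF frame_frm]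
  proof (intro conjI allI impI)
    show "?\<phi> ` topspace S \<subseteq> pts frm"
      using pt by blast
    fix V assume "openin (space_of frm) V"
    then obtain a where a: "a \<in> carrier frm" "V = opens_at frm a"
      using openin_space_of[OF frame_frm] by blast
    have "{s \<in> topspace S. ?\<phi> s \<in> V} = dec a"
      using a(2) pt op sub[OF a(1)] by (auto simp: opens_at_def)
    then show "openin S {s \<in> topspace S. ?\<phi> s \<in> V}"
      using a(1) by simp
  qed
  moreover have "?\<phi> ` topspace S = topspace (space_of frm)"
    unfolding topspace_space_of[OF frame_frm] using pt surj by blast
  moreover have "inj_on ?\<phi> (topspace S)"
    by (rule inj_onI) (use e_eq[OF op op] in blast)
  ultimately show ?thesis
    using continuous_imp_homeomorphic_map[OF _ assms(1) Hausdorff_space_of[OF ch]] by blast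
qed

end

text \<open>An open set is determined by the members of the base that it contains, so there are at most
  as many open sets as subsets of the base.\<close>

theorem ex_locale_of_space:
  fixes S :: "'t topology"
  assumes "compact_space S" "Hausdorff_space S" "small_weight S (UNIV :: 'u set)"
  obtains X :: "'u gorder" and \<phi> \<psi> where "compact_hausdorff_loc X" "small_loc X"
    "homeomorphic_maps (space_of X) S \<phi> \<psi>"
proof -
  obtain B where "topology_base S B" and P: "Pow B \<lesssim> (UNIV :: 'u set)"
    using assms(3) by (auto simp: small_weight_def)
  then have B: "\<And>V x. openin S V \<Longrightarrow> x \<in> V \<Longrightarrow> \<exists>b\<in>B. x \<in> b \<and> b \<subseteq> V"
    by (simp_all add: topology_base_def)
  have "inj_on (\<lambda>V. {b \<in> B. b \<subseteq> V}) {V. openin S V}"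
  proof (rule inj_onI)
    fix V W assume *: "V \<in> {V. openin S V}" "W \<in> {V. openin S V}" "{b \<in> B. b \<subseteq> V} = {b \<in> B. b \<subseteq> W}"
    have "V = \<Union>{b \<in> B. b \<subseteq> V}"
      using B[of V] *(1) by blast
    moreover have "W = \<Union>{b \<in> B. b \<subseteq> W}"
      using B[of W] *(2) by blast
    ultimately show "V = W"
      using *(3) by simp
  qed
  then have "{V. openin S V} \<lesssim> Pow B"
    unfolding lepoll_def by blast
  then have "{V. openin S V} \<lesssim> (UNIV :: 'u set)"
    using P lepoll_trans by blast
  then obtain e :: "'t set \<Rightarrow> 'u" where "inj_on e {V. openin S V}"
    by (auto simp: lepoll_def)
  then interpret coded_opens S e
    by unfold_locales
  have "regular_space S"
    using assms(1,2) compact_Hausdorff_imp_regular_space by blast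
  then have "compact_hausdorff_loc frm"
    using frame_frm compact_loc_frm[OF assms(1)]
      hausdorff_if_regular_frame[OF frame_frm regular_frame_frm]
    by (simp add: compact_hausdorff_loc_def)
  moreover obtain \<psi> where "homeomorphic_maps S (space_of frm) (\<lambda>s. e (topspace S - {s})) \<psi>"
    using homeomorphic_map_frm[OF assms(1,2)] unfolding homeomorphic_map_maps by blast
  ultimately show thesis
    using that[of frm] small_loc_frm[OF assms(3)] homeomorphic_maps_sym by blast
qed

lemma small_weight_space_of:
  fixes X :: "'u gorder"
  assumes "frame X" "small_loc X"
  shows "small_weight (space_of X) (UNIV :: 'u set)"
proof -
  interpret frame X by fact
  obtain B where B: "B \<subseteq> carrier X" "\<And>a. a \<in> carrier X \<Longrightarrow> \<exists>S\<subseteq>B. a = \<Squnion>\<^bsub>X\<^esub>S"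
    and P: "Pow B \<lesssim> (UNIV :: 'u set)"
    using assms(2) unfolding small_loc_def is_base_def by blast
  show ?thesis
  proof (rule small_weightI)
    show "openin (space_of X) b" if "b \<in> opens_at X ` B" for b
      using that B(1) openin_space_of[OF assms(1)] by blast
    show "\<exists>b\<in>opens_at X ` B. x \<in> b \<and> b \<subseteq> V" if V: "openin (space_of X) V" "x \<in> V" for V x
    proof -
      obtain a where a: "a \<in> carrier X" "V = opens_at X a"
        using V(1) openin_space_of[OF assms(1)] by blast
      obtain S where S: "S \<subseteq> B" "a = \<Squnion>\<^bsub>X\<^esub>S"
        using B(2)[OF a(1)] by blast
      have "V = \<Union>(opens_at X ` S)"
        using a(2) S opens_at_Sup[OF assms(1), of S] B(1) by auto
      then show ?thesis
        using V(2) S(1) by blast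
    qed
    show "Pow (opens_at X ` B) \<lesssim> (UNIV :: 'u set)"
      by (rule lepoll_Pow_lepoll[OF image_lepoll P])
  qed
qed


section \<open>The category of compact Hausdorff locales in terms of points\<close>

lemma Obj_CHausLoc: "X \<in> Obj CHausLoc \<longleftrightarrow> compact_hausdorff_loc X \<and> small_loc X"
  by (auto simp: CHausLoc_def Let_def compact_hausdorff_loc_def)

lemma homD: "f \<in> hom C X Y \<Longrightarrow> f \<in> Arr C" "f \<in> hom C X Y \<Longrightarrow> Dom C f = X" "f \<in> hom C X Y \<Longrightarrow> Cod C f = Y"
  by (simp_all add: hom_def)

lemma hom_Obj: "f \<in> hom CHausLoc X Y \<Longrightarrow> X \<in> Obj CHausLoc" "f \<in> hom CHausLoc X Y \<Longrightarrow> Y \<in> Obj CHausLoc"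
  by (auto simp: hom_def CHausLoc_def Let_def)

lemma CHausLoc_sel:
  "Dom CHausLoc = src" "Cod CHausLoc = tgt" "Id CHausLoc = loc_id" "Comp CHausLoc = loc_comp"
  by (simp_all add: CHausLoc_def Let_def)

lemma Arr_CHausLoc: "f \<in> Arr CHausLoc \<longleftrightarrow> f \<in> hom CHausLoc (src f) (tgt f)"
  by (simp add: hom_def CHausLoc_sel)

lemma hom_CHausLoc:
  "f \<in> hom CHausLoc X Y \<longleftrightarrow>
     locale_map f \<and> src f = X \<and> tgt f = Y \<and> X \<in> Obj CHausLoc \<and> Y \<in> Obj CHausLoc"
  by (auto simp: hom_def CHausLoc_def Let_def)

text \<open>The points of an object, as the underlying set of its space of points.\<close>

abbreviation points :: "'a gorder \<Rightarrow> 'a set" where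
  "points X \<equiv> topspace (space_of X)"

lemma points_eq_pts: "X \<in> Obj CHausLoc \<Longrightarrow> points X = pts X"
  using topspace_space_of compact_hausdorff_locD(1) by (auto simp: Obj_CHausLoc)

lemma space_of_Obj:
  fixes X :: "'u gorder"
  assumes "X \<in> Obj CHausLoc"
  shows "compact_space (space_of X)" "Hausdorff_space (space_of X)"
    "small_weight (space_of X) (UNIV :: 'u set)"
  using assms compact_space_of Hausdorff_space_of small_weight_space_of compact_hausdorff_locD(1)
  by (auto simp: Obj_CHausLoc)

lemma hom_continuous:
  assumes "f \<in> hom CHausLoc X Y"
  shows "continuous_map (space_of X) (space_of Y) (ptmap f)"
  using assms continuous_ptmap[of f] by (auto simp: hom_CHausLoc Obj_CHausLoc)

lemma hom_points:
  assumes "f \<in> hom CHausLoc X Y" "x \<in> points X"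
  shows "ptmap f x \<in> points Y"
  using hom_continuous[OF assms(1)] assms(2) by (auto simp: continuous_map)

lemma hom_eqI:
  assumes "f \<in> hom CHausLoc X Y" "g \<in> hom CHausLoc X Y"
    and "\<And>x. x \<in> points X \<Longrightarrow> ptmap f x = ptmap g x"
  shows "f = g"
  by (rule locmap_eqI) (use assms points_eq_pts[of X] in \<open>auto simp: hom_CHausLoc Obj_CHausLoc\<close>)

lemma hom_of_continuous:
  assumes "X \<in> Obj CHausLoc" "Y \<in> Obj CHausLoc" "continuous_map (space_of X) (space_of Y) g"
  obtains f where "f \<in> hom CHausLoc X Y" "\<And>x. x \<in> points X \<Longrightarrow> ptmap f x = g x"
proof -
  obtain f where "locale_map f" "src f = X" "tgt f = Y" "\<And>p. p \<in> pts X \<Longrightarrow> ptmap f p = g p"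
    using ex_locmap[of X Y g] assms by (auto simp: Obj_CHausLoc)
  then show thesis
    using that[of f] assms points_eq_pts[of X] by (auto simp: hom_CHausLoc)
qed

lemma Id_hom_CHausLoc: "X \<in> Obj CHausLoc \<Longrightarrow> Id CHausLoc X \<in> hom CHausLoc X X"
  using locale_map_id compact_hausdorff_locD(1)
  by (auto simp: hom_CHausLoc CHausLoc_sel Obj_CHausLoc) (simp_all add: loc_id_def)

lemma Comp_hom_CHausLoc:
  "f \<in> hom CHausLoc X Y \<Longrightarrow> g \<in> hom CHausLoc Y Z \<Longrightarrow> Comp CHausLoc g f \<in> hom CHausLoc X Z"
  using locale_map_comp[of f g] by (auto simp: hom_CHausLoc CHausLoc_sel) (simp_all add: loc_comp_def)

lemma ptmap_Id:
  assumes "X \<in> Obj CHausLoc" "x \<in> points X"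
  shows "ptmap (Id CHausLoc X) x = x"
  using assms ptmap_loc_id[of X x] points_eq_pts[OF assms(1)] pts_carrier[of x X]
    compact_hausdorff_locD(1)
  by (auto simp: CHausLoc_sel Obj_CHausLoc)

lemma ptmap_Comp:
  assumes "f \<in> hom CHausLoc X Y" "g \<in> hom CHausLoc Y Z" "x \<in> points X"
  shows "ptmap (Comp CHausLoc g f) x = ptmap g (ptmap f x)"
proof -
  have "x \<in> pts X"
    using assms(1,3) points_eq_pts[of X] by (simp add: hom_CHausLoc)
  then show ?thesis
    using assms ptmap_loc_comp[of f g x] pts_carrier[of x X] by (auto simp: hom_CHausLoc CHausLoc_sel)
qed

lemma category_CHausLoc: "category CHausLoc"
proof
  fix f :: "('u, 'u) locmap"
  assume "f \<in> Arr CHausLoc"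
  then show "Dom CHausLoc f \<in> Obj CHausLoc" "Cod CHausLoc f \<in> Obj CHausLoc"
    by (auto simp: Arr_CHausLoc hom_CHausLoc CHausLoc_sel)
next
  fix f :: "('u, 'u) locmap" and X Y
  assume f: "f \<in> hom CHausLoc X Y"
  then have XY: "X \<in> Obj CHausLoc" "Y \<in> Obj CHausLoc"
    by (auto simp: hom_CHausLoc)
  show "Comp CHausLoc (Id CHausLoc Y) f = f"
    by (rule hom_eqI[OF Comp_hom_CHausLoc[OF f Id_hom_CHausLoc[OF XY(2)]] f])
      (simp add: ptmap_Comp[OF f Id_hom_CHausLoc[OF XY(2)]] ptmap_Id[OF XY(2)] hom_points[OF f])
  show "Comp CHausLoc f (Id CHausLoc X) = f"
    by (rule hom_eqI[OF Comp_hom_CHausLoc[OF Id_hom_CHausLoc[OF XY(1)] f] f])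
      (simp add: ptmap_Comp[OF Id_hom_CHausLoc[OF XY(1)] f] ptmap_Id[OF XY(1)])
next
  fix f g h :: "('u, 'u) locmap" and W X Y Z
  assume f: "f \<in> hom CHausLoc W X" and g: "g \<in> hom CHausLoc X Y" and h: "h \<in> hom CHausLoc Y Z"
  note gf = Comp_hom_CHausLoc[OF f g] and hg = Comp_hom_CHausLoc[OF g h]
  show "Comp CHausLoc (Comp CHausLoc h g) f = Comp CHausLoc h (Comp CHausLoc g f)"
    by (rule hom_eqI[OF Comp_hom_CHausLoc[OF f hg] Comp_hom_CHausLoc[OF gf h]])
      (simp add: ptmap_Comp[OF f hg] ptmap_Comp[OF g h] ptmap_Comp[OF gf h] ptmap_Comp[OF f g] hom_points[OF f])
qed (fact Id_hom_CHausLoc Comp_hom_CHausLoc)+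

lemma Obj_of_space:
  fixes S :: "'t topology"
  assumes "compact_space S" "Hausdorff_space S" "small_weight S (UNIV :: 'u set)"
  obtains X :: "'u gorder" and \<phi> \<psi> where "X \<in> Obj CHausLoc" "homeomorphic_maps (space_of X) S \<phi> \<psi>"
  using ex_locale_of_space[OF assms] by (metis Obj_CHausLoc)

lemma homeomorphic_mapsD:
  assumes "homeomorphic_maps S T \<phi> \<psi>"
  shows "continuous_map S T \<phi>" "continuous_map T S \<psi>"
    "\<And>x. x \<in> topspace S \<Longrightarrow> \<psi> (\<phi> x) = x" "\<And>y. y \<in> topspace T \<Longrightarrow> \<phi> (\<psi> y) = y"
    "\<And>x. x \<in> topspace S \<Longrightarrow> \<phi> x \<in> topspace T" "\<And>y. y \<in> topspace T \<Longrightarrow> \<psi> y \<in> topspace S"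
  using assms by (auto simp: homeomorphic_maps_def continuous_map)

subsection \<open>Coequalizers\<close>

text \<open>A surjection identifying exactly the pairs \<open>(d z, c z)\<close> is the coequalizer of \<open>d\<close> and \<open>c\<close>,
  since it is a quotient map.\<close>

lemma is_coequalizer_if_points:
  assumes d: "d \<in> hom CHausLoc R X" and c: "c \<in> hom CHausLoc R X" and q: "q \<in> hom CHausLoc X Q"
    and eq: "Comp CHausLoc q d = Comp CHausLoc q c"
    and surj: "ptmap q ` points X = points Q"
    and ker: "\<And>x y. x \<in> points X \<Longrightarrow> y \<in> points X \<Longrightarrow> ptmap q x = ptmap q y \<Longrightarrow>
      \<exists>z\<in>points R. ptmap d z = x \<and> ptmap c z = y"
  shows "is_coequalizer CHausLoc d c q"
proof -
  have Obj: "X \<in> Obj CHausLoc" "Q \<in> Obj CHausLoc"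
    using q by (auto simp: hom_CHausLoc)
  have "\<exists>!h. h \<in> hom CHausLoc Q T \<and> Comp CHausLoc h q = a"
    if a: "a \<in> hom CHausLoc X T" and ad: "Comp CHausLoc a d = Comp CHausLoc a c" for T a
  proof -
    have T: "T \<in> Obj CHausLoc"
      using a by (auto simp: hom_CHausLoc)
    have fibres: "ptmap a x = ptmap a y" if xy: "x \<in> points X" "y \<in> points X"
      "ptmap q x = ptmap q y" for x y
    proof -
      obtain z where z: "z \<in> points R" "ptmap d z = x" "ptmap c z = y"
        using ker[OF xy] by blast
      have "ptmap (Comp CHausLoc a d) z = ptmap (Comp CHausLoc a c) z"
        using ad by simp
      then show ?thesis
        using z ptmap_Comp[OF d a z(1)] ptmap_Comp[OF c a z(1)] by simp
    qed
    define g where "g y = ptmap a (SOME x. x \<in> points X \<and> ptmap q x = y)" for y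
    have g: "g (ptmap q x) = ptmap a x" if x: "x \<in> points X" for x
    proof -
      let ?y = "SOME y. y \<in> points X \<and> ptmap q y = ptmap q x"
      have "?y \<in> points X \<and> ptmap q ?y = ptmap q x"
        by (rule someI[of "\<lambda>y. y \<in> points X \<and> ptmap q y = ptmap q x" x]) (use x in simp)
      then show ?thesis
        unfolding g_def using fibres x by blast
    qed
    have "continuous_map (space_of X) (space_of T) (g \<circ> ptmap q)"
      using g by (intro continuous_map_eq[OF hom_continuous[OF a]]) simp
    then have "continuous_map (space_of Q) (space_of T) g"
      by (rule continuous_map_descend_surjective[OF space_of_Obj(1)[OF Obj(1)] space_of_Obj(2)[OF Obj(2)]
            hom_continuous[OF q] surj])
    then obtain h where h: "h \<in> hom CHausLoc Q T" "\<And>y. y \<in> points Q \<Longrightarrow> ptmap h y = g y"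
      using hom_of_continuous[OF Obj(2) T] by metis
    show ?thesis
    proof (rule ex1I[of _ h])
      show "h \<in> hom CHausLoc Q T \<and> Comp CHausLoc h q = a"
        using h g hom_points[OF q] ptmap_Comp[OF q h(1)]
        by (intro conjI h(1) hom_eqI[OF Comp_hom_CHausLoc[OF q h(1)] a]) simp
      fix h' assume h': "h' \<in> hom CHausLoc Q T \<and> Comp CHausLoc h' q = a"
      then have h'_hom: "h' \<in> hom CHausLoc Q T"
        by blast
      show "h' = h"
      proof (rule hom_eqI[OF h'_hom h(1)])
        fix y assume y: "y \<in> points Q"
        then obtain x where x: "x \<in> points X" "y = ptmap q x"
          using surj by blast
        show "ptmap h' y = ptmap h y"
          using ptmap_Comp[OF q h'_hom x(1)] h' h(2)[OF y] g[OF x(1)] x(2) by simp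
      qed
    qed
  qed
  then show ?thesis
    unfolding is_coequalizer_def by (simp add: homD[OF d] homD[OF c] homD[OF q] eq)
qed

subsection \<open>Images\<close>

lemma image_factorization:
  fixes f :: "('u, 'u) locmap"
  assumes f: "f \<in> hom CHausLoc X Y"
  obtains I e m where "e \<in> hom CHausLoc X I" "m \<in> hom CHausLoc I Y" "Comp CHausLoc m e = f"
    "ptmap e ` points X = points I" "inj_on (ptmap m) (points I)"
proof -
  have Obj: "X \<in> Obj CHausLoc" "Y \<in> Obj CHausLoc"
    using f by (auto simp: hom_CHausLoc)
  note X = space_of_Obj[OF Obj(1)] and Y = space_of_Obj[OF Obj(2)]
  let ?K = "ptmap f ` points X"
  let ?S = "subtopology (space_of Y) ?K"
  have "compactin (space_of Y) ?K"
    using X(1) image_compactin[OF _ hom_continuous[OF f], of "points X"]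
      by (simp add: compact_space_def)
  then have "compact_space ?S"
    by (simp add: compactin_subspace)
  moreover have top: "topspace ?S = ?K"
    using hom_points[OF f] by auto
  ultimately obtain I :: "'u gorder" and \<phi> \<psi> where I: "I \<in> Obj CHausLoc"
    and "homeomorphic_maps (space_of I) ?S \<phi> \<psi>"
    using Obj_of_space[OF _ Hausdorff_space_subtopology[OF Y(2)] small_weight_subtopology[OF Y(3)], of ?K]
    by blast
  note hm = homeomorphic_mapsD[OF this(2), unfolded top]
  have "continuous_map (space_of X) ?S (ptmap f)"
    using hom_continuous[OF f] by (simp add: continuous_map_in_subtopology)
  then have "continuous_map (space_of X) (space_of I) (\<psi> \<circ> ptmap f)"
    using hm(2) continuous_map_compose by blast
  then obtain e where e: "e \<in> hom CHausLoc X I" "\<And>x. x \<in> points X \<Longrightarrow> ptmap e x = \<psi> (ptmap f x)"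
    using hom_of_continuous[OF Obj(1) I] by (metis comp_apply)
  have "continuous_map (space_of I) (space_of Y) \<phi>"
    using hm(1) continuous_map_in_subtopology by blast
  then obtain m where m: "m \<in> hom CHausLoc I Y" "\<And>x. x \<in> points I \<Longrightarrow> ptmap m x = \<phi> x"
    using hom_of_continuous[OF I Obj(2)] by metis
  show thesis
  proof (rule that[OF e(1) m(1)])
    show "Comp CHausLoc m e = f"
    proof (rule hom_eqI[OF Comp_hom_CHausLoc[OF e(1) m(1)] f])
      fix x assume x: "x \<in> points X"
      then show "ptmap (Comp CHausLoc m e) x = ptmap f x"
        using ptmap_Comp[OF e(1) m(1) x] m(2)[OF hom_points[OF e(1) x]] e(2)[OF x]
          hm(4)[of "ptmap f x"] by simp
    qed
    show "ptmap e ` points X = points I"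
    proof
      show "ptmap e ` points X \<subseteq> points I"
        using hom_points[OF e(1)] by blast
      show "points I \<subseteq> ptmap e ` points X"
      proof
        fix y assume y: "y \<in> points I"
        then obtain x where x: "x \<in> points X" "\<phi> y = ptmap f x"
          using hm(5) by blast
        then have "y = ptmap e x"
          using e(2)[OF x(1)] hm(3)[OF y] by simp
        then show "y \<in> ptmap e ` points X"
          using x(1) by blast
      qed
    qed
    show "inj_on (ptmap m) (points I)"
      by (rule inj_onI) (metis m(2) hm(3))
  qed
qed

text \<open>If \<open>q\<close> is a coequalizer of \<open>d\<close> and \<open>c\<close> with image factorization \<open>m \<circ> e\<close>, then \<open>e\<close> also
  coequalizes \<open>d\<close> and \<open>c\<close>, so it factors through \<open>q\<close>. This gives a section of \<open>m\<close>, and \<open>m\<close> is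
  surjective.\<close>

lemma regular_epi_imp_surj:
  assumes "regular_epi CHausLoc q" "q \<in> hom CHausLoc X Q"
  shows "ptmap q ` points X = points Q"
proof -
  note q = assms(2)
  obtain d c where coeq: "is_coequalizer CHausLoc d c q"
    using assms(1) by (auto simp: regular_epi_def)
  define R where "R = src d"
  have d: "d \<in> hom CHausLoc R X" and c: "c \<in> hom CHausLoc R X"
    and eq: "Comp CHausLoc q d = Comp CHausLoc q c"
    using coeq q by (auto simp: is_coequalizer_def CHausLoc_sel Arr_CHausLoc hom_CHausLoc R_def)
  have univ: "\<exists>!h. h \<in> hom CHausLoc Q T \<and> Comp CHausLoc h q = a"
    if "a \<in> hom CHausLoc X T" "Comp CHausLoc a d = Comp CHausLoc a c" for T a
    using coeq that q d by (auto simp: is_coequalizer_def CHausLoc_sel hom_CHausLoc)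
  obtain I e m where e: "e \<in> hom CHausLoc X I" and m: "m \<in> hom CHausLoc I Q"
    and me: "Comp CHausLoc m e = q" and e_surj: "ptmap e ` points X = points I"
    and m_inj: "inj_on (ptmap m) (points I)"
    using image_factorization[OF q] by metis
  have "Comp CHausLoc e d = Comp CHausLoc e c"
  proof (rule hom_eqI[OF Comp_hom_CHausLoc[OF d e] Comp_hom_CHausLoc[OF c e]])
    fix z assume z: "z \<in> points R"
    have "ptmap m (ptmap e (ptmap d z)) = ptmap q (ptmap d z)"
      using ptmap_Comp[OF e m hom_points[OF d z]] me by simp
    also have "\<dots> = ptmap q (ptmap c z)"
      using ptmap_Comp[OF d q z] ptmap_Comp[OF c q z] eq by simp
    also have "\<dots> = ptmap m (ptmap e (ptmap c z))"
      using ptmap_Comp[OF e m hom_points[OF c z]] me by simp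
    finally show "ptmap (Comp CHausLoc e d) z = ptmap (Comp CHausLoc e c) z"
      using m_inj hom_points[OF e hom_points[OF d z]] hom_points[OF e hom_points[OF c z]]
      by (simp add: ptmap_Comp[OF d e z] ptmap_Comp[OF c e z] inj_on_eq_iff)
  qed
  then obtain h where h: "h \<in> hom CHausLoc Q I" "Comp CHausLoc h q = e"
    using univ[OF e] by blast
  have mh: "Comp CHausLoc m h \<in> hom CHausLoc Q Q"
    using Comp_hom_CHausLoc[OF h(1) m] .
  have Q: "Q \<in> Obj CHausLoc"
    using q by (simp add: hom_CHausLoc)
  have "Comp CHausLoc (Comp CHausLoc m h) q = q"
    using category.Comp_assoc[OF category_CHausLoc q h(1) m] h(2) me by simp
  moreover have "Comp CHausLoc (Id CHausLoc Q) q = q"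
    using category.Id_left[OF category_CHausLoc q] .
  ultimately have "Comp CHausLoc m h = Id CHausLoc Q"
    using univ[OF q eq] mh Id_hom_CHausLoc[OF Q] by blast
  then have mh_pt: "ptmap m (ptmap h y) = y" if "y \<in> points Q" for y
    using ptmap_Comp[OF h(1) m that] ptmap_Id[OF Q that] by simp
  have "points Q \<subseteq> ptmap q ` points X"
  proof
    fix y assume y: "y \<in> points Q"
    then obtain x where x: "x \<in> points X" "ptmap h y = ptmap e x"
      using hom_points[OF h(1) y] e_surj by blast
    then have "y = ptmap q x"
      using mh_pt[OF y] ptmap_Comp[OF e m x(1)] me by simp
    then show "y \<in> ptmap q ` points X"
      using x(1) by blast
  qed
  then show ?thesis
    using hom_points[OF q] by blast
qed


subsection \<open>Points as maps from the one-point locale\<close>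

text \<open>The maps from the one-point locale to \<open>Y\<close> are the points of \<open>Y\<close>, so universal properties
  of pullbacks and joint monicity can be evaluated at points.\<close>

lemma ex_one_point:
  assumes "infinite (UNIV :: 'u set)"
  obtains pt :: "'u gorder" and o1 where "pt \<in> Obj CHausLoc" "points pt = {o1}"
proof -
  let ?S = "discrete_topology {()}"
  have "small_weight ?S (UNIV :: 'u set)"
  proof (rule small_weightI)
    show "Pow {{()}} \<lesssim> (UNIV :: 'u set)"
      using assms finite_Pow_lepoll by blast
  qed auto
  moreover have "compact_space ?S"
    by (simp add: compact_space_discrete_topology)
  ultimately obtain X :: "'u gorder" and \<phi> \<psi> where X: "X \<in> Obj CHausLoc"
    and "homeomorphic_maps (space_of X) ?S \<phi> \<psi>"
    using Obj_of_space[OF _ Hausdorff_space_discrete_topology] by blast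
  note hm = homeomorphic_mapsD[OF this(2)]
  have "points X = {\<psi> ()}"
  proof
    show "points X \<subseteq> {\<psi> ()}"
      using hm(3) by fastforce
    show "{\<psi> ()} \<subseteq> points X"
      using hm(6)[of "()"] by simp
  qed
  then show thesis
    using that X by blast
qed

lemma ex_hom_to_point:
  assumes "pt \<in> Obj CHausLoc" "points pt = {o1}" "Y \<in> Obj CHausLoc" "y \<in> points Y"
  obtains f where "f \<in> hom CHausLoc pt Y" "ptmap f o1 = y"
proof -
  have "continuous_map (space_of pt) (space_of Y) (\<lambda>_. y)"
    using assms(4) by simp
  then show thesis
    using hom_of_continuous[OF assms(1,3)] that assms(2) by (metis singletonI)
qed

lemma pullback_points:
  fixes f :: "('u, 'u) locmap"
  assumes inf: "infinite (UNIV :: 'u set)"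
    and pb: "is_pullback CHausLoc f g p q"
    and f: "f \<in> hom CHausLoc A Z" and g: "g \<in> hom CHausLoc B Z"
    and p: "p \<in> hom CHausLoc P A" and q: "q \<in> hom CHausLoc P B"
    and xy: "x \<in> points A" "y \<in> points B" "ptmap f x = ptmap g y"
  obtains z where "z \<in> points P" "ptmap p z = x" "ptmap q z = y"
proof -
  obtain pt :: "'u gorder" and o1 where pt: "pt \<in> Obj CHausLoc" "points pt = {o1}"
    using ex_one_point[OF inf] by blast
  obtain a where a: "a \<in> hom CHausLoc pt A" "ptmap a o1 = x"
    using ex_hom_to_point[OF pt hom_Obj(1)[OF f] xy(1)] by blast
  obtain b where b: "b \<in> hom CHausLoc pt B" "ptmap b o1 = y"
    using ex_hom_to_point[OF pt hom_Obj(1)[OF g] xy(2)] by blast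
  have "Comp CHausLoc f a = Comp CHausLoc g b"
    by (rule hom_eqI[OF Comp_hom_CHausLoc[OF a(1) f] Comp_hom_CHausLoc[OF b(1) g]])
      (simp add: ptmap_Comp[OF a(1) f] ptmap_Comp[OF b(1) g] pt(2) a(2) b(2) xy(3))
  moreover have "\<forall>T. \<forall>a\<in>hom CHausLoc T A. \<forall>b\<in>hom CHausLoc T B. Comp CHausLoc f a = Comp CHausLoc g b \<longrightarrow>
      (\<exists>!h. h \<in> hom CHausLoc T P \<and> Comp CHausLoc p h = a \<and> Comp CHausLoc q h = b)"
    using pb unfolding is_pullback_def homD[OF f] homD[OF g] homD[OF p] by blast
  ultimately obtain h where h: "h \<in> hom CHausLoc pt P" "Comp CHausLoc p h = a" "Comp CHausLoc q h = b"
    using a(1) b(1) by blast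
  have o1: "o1 \<in> points pt"
    using pt(2) by simp
  show thesis
    by (rule that[of "ptmap h o1"])
      (use hom_points[OF h(1) o1] ptmap_Comp[OF h(1) p o1] ptmap_Comp[OF h(1) q o1] h(2,3) a(2) b(2) in auto)
qed

lemma jointly_monic_points:
  fixes d :: "('u, 'u) locmap"
  assumes inf: "infinite (UNIV :: 'u set)"
    and jm: "jointly_monic CHausLoc d c"
    and d: "d \<in> hom CHausLoc R X" and c: "c \<in> hom CHausLoc R X"
    and zw: "z \<in> points R" "w \<in> points R" "ptmap d z = ptmap d w" "ptmap c z = ptmap c w"
  shows "z = w"
proof -
  obtain pt :: "'u gorder" and o1 where pt: "pt \<in> Obj CHausLoc" "points pt = {o1}"
    using ex_one_point[OF inf] by blast
  obtain a where a: "a \<in> hom CHausLoc pt R" "ptmap a o1 = z"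
    using ex_hom_to_point[OF pt hom_Obj(1)[OF d] zw(1)] by blast
  obtain b where b: "b \<in> hom CHausLoc pt R" "ptmap b o1 = w"
    using ex_hom_to_point[OF pt hom_Obj(1)[OF d] zw(2)] by blast
  have "Comp CHausLoc d a = Comp CHausLoc d b"
    by (rule hom_eqI[OF Comp_hom_CHausLoc[OF a(1) d] Comp_hom_CHausLoc[OF b(1) d]])
      (simp add: ptmap_Comp[OF a(1) d] ptmap_Comp[OF b(1) d] pt(2) a(2) b(2) zw(3))
  moreover have "Comp CHausLoc c a = Comp CHausLoc c b"
    by (rule hom_eqI[OF Comp_hom_CHausLoc[OF a(1) c] Comp_hom_CHausLoc[OF b(1) c]])
      (simp add: ptmap_Comp[OF a(1) c] ptmap_Comp[OF b(1) c] pt(2) a(2) b(2) zw(4))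
  ultimately have "a = b"
    using jm a(1) b(1) unfolding jointly_monic_def homD[OF d] by blast
  then show ?thesis
    using a(2) b(2) by simp
qed

text \<open>The induced map into \<open>P\<close> exists on points; it is continuous because \<open>P\<close> is embedded in
  \<open>A \<times> B\<close>.\<close>

lemma is_pullback_if_points:
  assumes f: "f \<in> hom CHausLoc A Z" and g: "g \<in> hom CHausLoc B Z"
    and p: "p \<in> hom CHausLoc P A" and q: "q \<in> hom CHausLoc P B"
    and comm: "Comp CHausLoc f p = Comp CHausLoc g q"
    and ex: "\<And>x y. x \<in> points A \<Longrightarrow> y \<in> points B \<Longrightarrow> ptmap f x = ptmap g y \<Longrightarrow>
      \<exists>z\<in>points P. ptmap p z = x \<and> ptmap q z = y"
    and inj: "\<And>z w. z \<in> points P \<Longrightarrow> w \<in> points P \<Longrightarrow> ptmap p z = ptmap p w \<Longrightarrow>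
      ptmap q z = ptmap q w \<Longrightarrow> z = w"
  shows "is_pullback CHausLoc f g p q"
proof -
  note Obj = hom_Obj(1)[OF f] hom_Obj(1)[OF g] hom_Obj(1)[OF p]
  have "\<exists>!h. h \<in> hom CHausLoc T P \<and> Comp CHausLoc p h = a \<and> Comp CHausLoc q h = b"
    if a: "a \<in> hom CHausLoc T A" and b: "b \<in> hom CHausLoc T B"
      and ab: "Comp CHausLoc f a = Comp CHausLoc g b" for T a b
  proof -
    have "ptmap f (ptmap a t) = ptmap g (ptmap b t)" if t: "t \<in> points T" for t
      using ptmap_Comp[OF a f t] ptmap_Comp[OF b g t] ab by simp
    then have "\<forall>t\<in>points T. \<exists>z. z \<in> points P \<and> ptmap p z = ptmap a t \<and> ptmap q z = ptmap b t"
      using ex hom_points[OF a] hom_points[OF b] by blast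
    from bchoice[OF this] obtain k where k: "\<And>t. t \<in> points T \<Longrightarrow> k t \<in> points P"
      "\<And>t. t \<in> points T \<Longrightarrow> ptmap p (k t) = ptmap a t" "\<And>t. t \<in> points T \<Longrightarrow> ptmap q (k t) = ptmap b t"
      by blast
    let ?j = "\<lambda>z. (ptmap p z, ptmap q z)"
    have "continuous_map (space_of T) (space_of P) k"
    proof (rule continuous_map_lift_injective)
      show "compact_space (space_of P)"
        using space_of_Obj(1)[OF Obj(3)] .
      show "Hausdorff_space (prod_topology (space_of A) (space_of B))"
        using space_of_Obj(2)[OF Obj(1)] space_of_Obj(2)[OF Obj(2)]
          by (simp add: Hausdorff_space_prod_topology)
      show "continuous_map (space_of P) (prod_topology (space_of A) (space_of B)) ?j"
        using hom_continuous[OF p] hom_continuous[OF q] by (simp add: continuous_map_paired)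
      show "inj_on ?j (points P)"
        by (rule inj_onI) (use inj in simp)
      show "k \<in> points T \<rightarrow> points P"
        using k(1) by blast
      show "continuous_map (space_of T) (prod_topology (space_of A) (space_of B)) (?j \<circ> k)"
      proof (rule continuous_map_eq)
        show "continuous_map (space_of T) (prod_topology (space_of A) (space_of B)) (\<lambda>t. (ptmap a t, ptmap b t))"
          using hom_continuous[OF a] hom_continuous[OF b] by (simp add: continuous_map_paired)
      qed (use k in simp)
    qed
    then obtain h where h: "h \<in> hom CHausLoc T P" "\<And>t. t \<in> points T \<Longrightarrow> ptmap h t = k t"
      using hom_of_continuous[OF hom_Obj(1)[OF a] Obj(3)] by blast
    show ?thesis
    proof (rule ex1I[of _ h])
      have "Comp CHausLoc p h = a"
        by (rule hom_eqI[OF Comp_hom_CHausLoc[OF h(1) p] a]) (simp add: ptmap_Comp[OF h(1) p] h(2) k)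
      moreover have "Comp CHausLoc q h = b"
        by (rule hom_eqI[OF Comp_hom_CHausLoc[OF h(1) q] b]) (simp add: ptmap_Comp[OF h(1) q] h(2) k)
      ultimately show "h \<in> hom CHausLoc T P \<and> Comp CHausLoc p h = a \<and> Comp CHausLoc q h = b"
        using h(1) by blast
      fix h' assume h': "h' \<in> hom CHausLoc T P \<and> Comp CHausLoc p h' = a \<and> Comp CHausLoc q h' = b"
      then have hom': "h' \<in> hom CHausLoc T P"
        by blast
      show "h' = h"
      proof (rule hom_eqI[OF hom' h(1)])
        fix t assume t: "t \<in> points T"
        have "ptmap p (ptmap h' t) = ptmap a t" "ptmap q (ptmap h' t) = ptmap b t"
          using ptmap_Comp[OF hom' p t] ptmap_Comp[OF hom' q t] h' by simp_all
        then show "ptmap h' t = ptmap h t"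
          using inj[OF hom_points[OF hom' t] k(1)[OF t]] k(2,3)[OF t] h(2)[OF t] by simp
      qed
    qed
  qed
  then show ?thesis
    unfolding is_pullback_def by (simp add: homD[OF f] homD[OF g] homD[OF p] homD[OF q] comm)
qed

subsection \<open>Finite limits\<close>

lemma Obj_of_closed_subset_of_product:
  fixes X :: "'i \<Rightarrow> 'u gorder"
  assumes inf: "infinite (UNIV :: 'u set)" and fin: "finite I"
    and X: "\<And>i. i \<in> I \<Longrightarrow> X i \<in> Obj CHausLoc"
    and K: "closedin (product_topology (\<lambda>i. space_of (X i)) I) K"
  obtains L :: "'u gorder" and \<phi> \<psi> where "L \<in> Obj CHausLoc"
    "homeomorphic_maps (space_of L) (subtopology (product_topology (\<lambda>i. space_of (X i)) I) K) \<phi> \<psi>"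
proof -
  let ?P = "product_topology (\<lambda>i. space_of (X i)) I"
  have "compact_space ?P"
    using space_of_Obj(1)[OF X] by (simp add: compact_space_product_topology)
  then have "compact_space (subtopology ?P K)"
    using K by (simp add: closedin_compact_space compact_space_subtopology)
  moreover have "Hausdorff_space (subtopology ?P K)"
    using space_of_Obj(2)[OF X] by (intro Hausdorff_space_subtopology)
      (simp add: Hausdorff_space_product_topology)
  moreover have "small_weight (subtopology ?P K) (UNIV :: 'u set)"
    using space_of_Obj(3)[OF X]
      by (intro small_weight_subtopology small_weight_product_topology[OF fin _ inf])
  ultimately show thesis
    using Obj_of_space[of "subtopology ?P K"] that by blast
qed

text \<open>The limit of a finite diagram is the closed subspace of compatible families in the product of
  the spaces of points.\<close>

lemma has_finite_limits_CHausLoc: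
  assumes inf: "infinite (UNIV :: 'u set)"
  shows "has_finite_limits (CHausLoc :: ('u gorder, ('u, 'u) locmap) cat)"
  unfolding has_finite_limits_def
proof (intro allI impI)
  fix J :: "(nat, nat) cat" and Fo :: "nat \<Rightarrow> 'u gorder" and Fa :: "nat \<Rightarrow> ('u, 'u) locmap"
  assume *: "category J \<and> finite (Obj J) \<and> finite (Arr J) \<and> is_functor J CHausLoc Fo Fa"
  then interpret J: category J
    by blast
  have fin: "finite (Obj J)" and F: "is_functor J CHausLoc Fo Fa"
    using * by auto
  have Fo: "Fo i \<in> Obj CHausLoc" if "i \<in> Obj J" for i
    using F that by (simp add: is_functor_def)
  have Fa: "Fa u \<in> hom CHausLoc (Fo (Dom J u)) (Fo (Cod J u))" if "u \<in> Arr J" for u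
    using F that by (simp add: is_functor_def)
  let ?P = "product_topology (\<lambda>i. space_of (Fo i)) (Obj J)"
  let ?E = "\<lambda>u. {x \<in> topspace ?P. ptmap (Fa u) (x (Dom J u)) = x (Cod J u)}"
  define K where "K = \<Inter>(insert (topspace ?P) (?E ` Arr J))"
  have proj: "continuous_map ?P (space_of (Fo i)) (\<lambda>x. x i)" if "i \<in> Obj J" for i
    using that by (rule continuous_map_product_projection)
  have E: "closedin ?P (?E u)" if u: "u \<in> Arr J" for u
  proof (rule closedin_continuous_maps_eq)
    show "Hausdorff_space (space_of (Fo (Cod J u)))"
      using space_of_Obj(2)[OF Fo[OF J.Cod_Obj[OF u]]] .
    show "continuous_map ?P (space_of (Fo (Cod J u))) (\<lambda>x. ptmap (Fa u) (x (Dom J u)))"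
      using continuous_map_compose[OF proj[OF J.Dom_Obj[OF u]] hom_continuous[OF Fa[OF u]]]
        by (simp add: o_def)
    show "continuous_map ?P (space_of (Fo (Cod J u))) (\<lambda>x. x (Cod J u))"
      using proj[OF J.Cod_Obj[OF u]] .
  qed
  have K: "closedin ?P K"
    unfolding K_def
  proof (rule closedin_Inter)
    show "closedin ?P S" if "S \<in> insert (topspace ?P) (?E ` Arr J)" for S
      using that E closedin_topspace[of ?P] by blast
  qed simp
  have mem_K: "x \<in> K \<longleftrightarrow> x \<in> topspace ?P \<and> (\<forall>u\<in>Arr J. ptmap (Fa u) (x (Dom J u)) = x (Cod J u))" for x
    unfolding K_def by auto
  have topK: "topspace (subtopology ?P K) = K"
    using closedin_subset[OF K] unfolding topspace_subtopology by blast
  obtain L :: "'u gorder" and \<phi> \<psi> where L: "L \<in> Obj CHausLoc" and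
    "homeomorphic_maps (space_of L) (subtopology ?P K) \<phi> \<psi>"
    using Obj_of_closed_subset_of_product[OF inf fin Fo K] by blast
  note hm = homeomorphic_mapsD[OF this(2), unfolded topK]
  have \<phi>: "continuous_map (space_of L) ?P \<phi>"
    using hm(1) by (simp add: continuous_map_in_subtopology)
  have "\<exists>f. f \<in> hom CHausLoc L (Fo i) \<and> (\<forall>z\<in>points L. ptmap f z = \<phi> z i)" if i: "i \<in> Obj J" for i
  proof -
    have "continuous_map (space_of L) (space_of (Fo i)) (\<lambda>z. \<phi> z i)"
      using continuous_map_compose[OF \<phi> proj[OF i]] by (simp add: o_def)
    then show ?thesis
      using hom_of_continuous[OF L Fo[OF i]] by metis
  qed
  then have "\<forall>i\<in>Obj J. \<exists>f. f \<in> hom CHausLoc L (Fo i) \<and> (\<forall>z\<in>points L. ptmap f z = \<phi> z i)"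
    by blast
  from bchoice[OF this] obtain p where p: "\<And>i. i \<in> Obj J \<Longrightarrow> p i \<in> hom CHausLoc L (Fo i)"
    "\<And>i z. i \<in> Obj J \<Longrightarrow> z \<in> points L \<Longrightarrow> ptmap (p i) z = \<phi> z i"
    by blast
  have "Comp CHausLoc (Fa u) (p (Dom J u)) = p (Cod J u)" if u: "u \<in> Arr J" for u
  proof (rule hom_eqI[OF Comp_hom_CHausLoc[OF p(1)[OF J.Dom_Obj[OF u]] Fa[OF u]] p(1)[OF J.Cod_Obj[OF u]]])
    fix z assume z: "z \<in> points L"
    have "\<phi> z \<in> K"
      using hm(5)[OF z] .
    then show "ptmap (Comp CHausLoc (Fa u) (p (Dom J u))) z = ptmap (p (Cod J u)) z"
      using ptmap_Comp[OF p(1)[OF J.Dom_Obj[OF u]] Fa[OF u] z] p(2)[OF J.Dom_Obj[OF u] z]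
        p(2)[OF J.Cod_Obj[OF u] z] u by (simp add: mem_K)
  qed
  then have cone: "is_cone J CHausLoc Fo Fa L p"
    unfolding is_cone_def using L p(1) by blast
  have "\<exists>!h. h \<in> hom CHausLoc M L \<and> (\<forall>i\<in>Obj J. Comp CHausLoc (p i) h = q i)"
    if "is_cone J CHausLoc Fo Fa M q" for M q
  proof -
    have M: "M \<in> Obj CHausLoc" and q: "\<And>i. i \<in> Obj J \<Longrightarrow> q i \<in> hom CHausLoc M (Fo i)"
      and q_eq: "\<And>u. u \<in> Arr J \<Longrightarrow> Comp CHausLoc (Fa u) (q (Dom J u)) = q (Cod J u)"
      using that by (auto simp: is_cone_def)
    define g where "g m = (\<lambda>i\<in>Obj J. ptmap (q i) m)" for m
    have gK: "g m \<in> K" if m: "m \<in> points M" for m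
    proof -
      have "ptmap (Fa u) (g m (Dom J u)) = g m (Cod J u)" if u: "u \<in> Arr J" for u
        using ptmap_Comp[OF q[OF J.Dom_Obj[OF u]] Fa[OF u] m] q_eq[OF u] J.Dom_Obj[OF u] J.Cod_Obj[OF u]
        by (simp add: g_def)
      then show ?thesis
        using hom_points[OF q m] by (simp add: mem_K g_def PiE_iff)
    qed
    have "continuous_map (space_of M) ?P g"
      unfolding continuous_map_componentwise
    proof (intro conjI ballI)
      show "g ` points M \<subseteq> extensional (Obj J)"
        by (auto simp: g_def)
      fix i assume i: "i \<in> Obj J"
      then show "continuous_map (space_of M) (space_of (Fo i)) (\<lambda>m. g m i)"
        using hom_continuous[OF q[OF i]] by (simp add: g_def)
    qed
    then have "continuous_map (space_of M) (subtopology ?P K) g"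
      using gK by (simp add: continuous_map_in_subtopology image_subset_iff)
    then have "continuous_map (space_of M) (space_of L) (\<psi> \<circ> g)"
      using hm(2) continuous_map_compose by blast
    then obtain h where h: "h \<in> hom CHausLoc M L" "\<And>m. m \<in> points M \<Longrightarrow> ptmap h m = \<psi> (g m)"
      using hom_of_continuous[OF M L] by (metis comp_apply)
    have h_eq: "Comp CHausLoc (p i) h = q i" if i: "i \<in> Obj J" for i
    proof (rule hom_eqI[OF Comp_hom_CHausLoc[OF h(1) p(1)[OF i]] q[OF i]])
      fix m assume m: "m \<in> points M"
      have "\<phi> (\<psi> (g m)) = g m"
        using hm(4)[OF gK[OF m]] .
      then show "ptmap (Comp CHausLoc (p i) h) m = ptmap (q i) m"
        using ptmap_Comp[OF h(1) p(1)[OF i] m] p(2)[OF i hom_points[OF h(1) m]] h(2)[OF m] i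
        by (simp add: g_def)
    qed
    show ?thesis
    proof (rule ex1I[of _ h])
      show "h \<in> hom CHausLoc M L \<and> (\<forall>i\<in>Obj J. Comp CHausLoc (p i) h = q i)"
        using h(1) h_eq by blast
      fix h' assume h': "h' \<in> hom CHausLoc M L \<and> (\<forall>i\<in>Obj J. Comp CHausLoc (p i) h' = q i)"
      then have hom': "h' \<in> hom CHausLoc M L"
        by blast
      show "h' = h"
      proof (rule hom_eqI[OF hom' h(1)])
        fix m assume m: "m \<in> points M"
        have m': "ptmap h' m \<in> points L"
          using hom_points[OF hom' m] .
        have "\<phi> (ptmap h' m) = g m"
        proof (rule PiE_ext)
          show "\<phi> (ptmap h' m) \<in> PiE (Obj J) (\<lambda>i. points (Fo i))"
            "g m \<in> PiE (Obj J) (\<lambda>i. points (Fo i))"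
            using hm(5)[OF m'] gK[OF m] by (auto simp: mem_K)
          fix i assume i: "i \<in> Obj J"
          then show "\<phi> (ptmap h' m) i = g m i"
            using p(2)[OF i m'] ptmap_Comp[OF hom' p(1)[OF i] m] h' by (simp add: g_def)
        qed
        then show "ptmap h' m = ptmap h m"
          using hm(3)[OF m'] h(2)[OF m] by simp
      qed
    qed
  qed
  then show "\<exists>L p. is_limit J CHausLoc Fo Fa L p"
    unfolding is_limit_def using cone by blast
qed

subsection \<open>Regular epimorphisms\<close>

text \<open>The kernel pair of \<open>q\<close> is the closed subspace of \<open>X \<times> X\<close>, here a product over the index set
  \<open>{0, 1}\<close>, on which \<open>q\<close> takes equal values; \<open>q\<close> is its coequalizer.\<close>

lemma regular_epi_if_surj:
  fixes q :: "('u, 'u) locmap"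
  assumes inf: "infinite (UNIV :: 'u set)" and q: "q \<in> hom CHausLoc X Q"
    and surj: "ptmap q ` points X = points Q"
  shows "regular_epi CHausLoc q"
proof -
  note Obj = hom_Obj[OF q]
  let ?I = "{0, 1 :: nat}"
  let ?P = "product_topology (\<lambda>i. space_of X) ?I"
  define K where "K = {x \<in> topspace ?P. ptmap q (x 0) = ptmap q (x 1)}"
  have proj: "continuous_map ?P (space_of X) (\<lambda>x. x i)" if "i \<in> ?I" for i
    using that by (rule continuous_map_product_projection)
  have comp: "continuous_map ?P (space_of Q) (\<lambda>x. ptmap q (x i))" if "i \<in> ?I" for i
    using continuous_map_compose[OF proj[OF that] hom_continuous[OF q]] by (simp add: o_def)
  have K: "closedin ?P K"
    unfolding K_def using space_of_Obj(2)[OF Obj(2)] by (rule closedin_continuous_maps_eq)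
      (use comp in auto)
  have topK: "topspace (subtopology ?P K) = K"
    using closedin_subset[OF K] unfolding topspace_subtopology by blast
  obtain R :: "'u gorder" and \<phi> \<psi> where R: "R \<in> Obj CHausLoc" and
    "homeomorphic_maps (space_of R) (subtopology ?P K) \<phi> \<psi>"
    using Obj_of_closed_subset_of_product[OF inf _ _ K] Obj(1) by blast
  note hm = homeomorphic_mapsD[OF this(2), unfolded topK]
  have \<phi>: "continuous_map (space_of R) ?P \<phi>"
    using hm(1) by (simp add: continuous_map_in_subtopology)
  have cont: "continuous_map (space_of R) (space_of X) (\<lambda>z. \<phi> z i)" if "i \<in> ?I" for i
    using continuous_map_compose[OF \<phi> proj[OF that]] by (simp add: o_def)
  obtain d where d: "d \<in> hom CHausLoc R X" "\<And>z. z \<in> points R \<Longrightarrow> ptmap d z = \<phi> z 0"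
    using hom_of_continuous[OF R Obj(1) cont[of 0]] by auto
  obtain c where c: "c \<in> hom CHausLoc R X" "\<And>z. z \<in> points R \<Longrightarrow> ptmap c z = \<phi> z 1"
    using hom_of_continuous[OF R Obj(1) cont[of 1]] by auto
  have "is_coequalizer CHausLoc d c q"
  proof (rule is_coequalizer_if_points[OF d(1) c(1) q _ surj])
    show "Comp CHausLoc q d = Comp CHausLoc q c"
      by (rule hom_eqI[OF Comp_hom_CHausLoc[OF d(1) q] Comp_hom_CHausLoc[OF c(1) q]])
        (use hm(5) in \<open>simp add: ptmap_Comp[OF d(1) q] ptmap_Comp[OF c(1) q] d(2) c(2) K_def\<close>)
    fix x y assume xy: "x \<in> points X" "y \<in> points X" "ptmap q x = ptmap q y"
    define k where "k = (\<lambda>i\<in>?I. if i = 0 then x else y)"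
    have "k \<in> K"
      using xy by (auto simp: K_def k_def PiE_iff)
    then show "\<exists>z\<in>points R. ptmap d z = x \<and> ptmap c z = y"
      using hm(4,6) d(2) c(2) by (intro bexI[of _ "\<psi> k"]) (auto simp: k_def)
  qed
  then show ?thesis
    by (auto simp: regular_epi_def)
qed

lemma kernel_pair_has_coequalizer:
  fixes f :: "('u, 'u) locmap"
  assumes inf: "infinite (UNIV :: 'u set)" and kp: "is_kernel_pair CHausLoc f d c"
  shows "\<exists>q. is_coequalizer CHausLoc d c q"
proof -
  let ?X = "Dom CHausLoc f" and ?Y = "Cod CHausLoc f" and ?R = "Dom CHausLoc d"
  have pb: "is_pullback CHausLoc f f d c"
    using kp by (simp add: is_kernel_pair_def)
  have f: "f \<in> hom CHausLoc ?X ?Y" and d: "d \<in> hom CHausLoc ?R ?X" and c: "c \<in> hom CHausLoc ?R ?X"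
    and eq: "Comp CHausLoc f d = Comp CHausLoc f c"
    using pb by (auto simp: is_pullback_def hom_def)
  obtain I e m where e: "e \<in> hom CHausLoc ?X I" and m: "m \<in> hom CHausLoc I ?Y"
    and me: "Comp CHausLoc m e = f" and e_surj: "ptmap e ` points ?X = points I"
    and m_inj: "inj_on (ptmap m) (points I)"
    using image_factorization[OF f] by metis
  have e_iff: "ptmap e x = ptmap e y \<longleftrightarrow> ptmap f x = ptmap f y" if "x \<in> points ?X" "y \<in> points ?X" for x y
    using ptmap_Comp[OF e m] me m_inj hom_points[OF e] that by (auto simp: inj_on_eq_iff)
  have "is_coequalizer CHausLoc d c e"
  proof (rule is_coequalizer_if_points[OF d c e _ e_surj])
    show "Comp CHausLoc e d = Comp CHausLoc e c"
    proof (rule hom_eqI[OF Comp_hom_CHausLoc[OF d e] Comp_hom_CHausLoc[OF c e]])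
      fix z assume z: "z \<in> points ?R"
      have "ptmap f (ptmap d z) = ptmap f (ptmap c z)"
        using ptmap_Comp[OF d f z] ptmap_Comp[OF c f z] eq by simp
      then show "ptmap (Comp CHausLoc e d) z = ptmap (Comp CHausLoc e c) z"
        using e_iff[OF hom_points[OF d z] hom_points[OF c z]]
          by (simp add: ptmap_Comp[OF d e z] ptmap_Comp[OF c e z])
    qed
    fix x y assume xy: "x \<in> points ?X" "y \<in> points ?X" "ptmap e x = ptmap e y"
    then show "\<exists>z\<in>points ?R. ptmap d z = x \<and> ptmap c z = y"
      using pullback_points[OF inf pb f f d c xy(1,2)] e_iff by blast
  qed
  then show ?thesis
    by blast
qed

theorem regular_category_CHausLoc:
  assumes inf: "infinite (UNIV :: 'u set)"
  shows "regular_category (CHausLoc :: ('u gorder, ('u, 'u) locmap) cat)"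
  unfolding regular_category_def
proof (intro conjI allI impI)
  fix f g p q :: "('u, 'u) locmap"
  assume *: "is_pullback CHausLoc f g p q \<and> regular_epi CHausLoc f"
  let ?A = "Dom CHausLoc f" and ?Z = "Cod CHausLoc f" and ?B = "Dom CHausLoc g" and ?P =
    "Dom CHausLoc p"
  have pb: "is_pullback CHausLoc f g p q"
    using * by blast
  then have f: "f \<in> hom CHausLoc ?A ?Z" and g: "g \<in> hom CHausLoc ?B ?Z"
    and p: "p \<in> hom CHausLoc ?P ?A" and q: "q \<in> hom CHausLoc ?P ?B"
    by (auto simp: is_pullback_def hom_def)
  have f_surj: "ptmap f ` points ?A = points ?Z"
    using regular_epi_imp_surj[OF _ f] * by blast
  have "points ?B \<subseteq> ptmap q ` points ?P"
  proof
    fix y assume y: "y \<in> points ?B"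
    then obtain x where x: "x \<in> points ?A" "ptmap f x = ptmap g y"
      using f_surj hom_points[OF g y] by (metis imageE)
    obtain z where "z \<in> points ?P" "ptmap q z = y"
      using pullback_points[OF inf pb f g p q x(1) y x(2)] by blast
    then show "y \<in> ptmap q ` points ?P"
      by blast
  qed
  then have "ptmap q ` points ?P = points ?B"
    using hom_points[OF q] by blast
  then show "regular_epi CHausLoc q"
    using regular_epi_if_surj[OF inf q] by blast
qed (use category_CHausLoc has_finite_limits_CHausLoc[OF inf] kernel_pair_has_coequalizer[OF inf] in auto)

section \<open>Effectivity of equivalence relations\<close>

text \<open>The points of \<open>R\<close> form a closed equivalence relation \<open>E\<close> on the points of \<open>X\<close>, and the
  quotient by \<open>E\<close> is the required map: pairs of points it identifies come from a unique point of
  \<open>R\<close>.\<close>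

theorem equivalence_relation_effective:
  fixes d :: "('u, 'u) locmap"
  assumes inf: "infinite (UNIV :: 'u set)" and eqr: "equivalence_relation CHausLoc X d c"
  shows "\<exists>f. is_kernel_pair CHausLoc f d c"
proof -
  let ?R = "Dom CHausLoc d"
  have d: "d \<in> hom CHausLoc ?R X" and c: "c \<in> hom CHausLoc ?R X" and jm: "jointly_monic CHausLoc d c"
    using eqr by (auto simp: equivalence_relation_def hom_def)
  obtain r where r: "r \<in> hom CHausLoc X ?R" "Comp CHausLoc d r = Id CHausLoc X"
    "Comp CHausLoc c r = Id CHausLoc X"
    using eqr by (auto simp: equivalence_relation_def)
  obtain s where s: "s \<in> hom CHausLoc ?R ?R" "Comp CHausLoc d s = c" "Comp CHausLoc c s = d"
    using eqr by (auto simp: equivalence_relation_def)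
  obtain p q t where pb: "is_pullback CHausLoc c d p q" and t: "t \<in> hom CHausLoc (Dom CHausLoc p) ?R"
    "Comp CHausLoc d t = Comp CHausLoc d p" "Comp CHausLoc c t = Comp CHausLoc c q"
    using eqr by (auto simp: equivalence_relation_def)
  let ?P = "Dom CHausLoc p"
  have p: "p \<in> hom CHausLoc ?P ?R" and q: "q \<in> hom CHausLoc ?P ?R"
    using pb homD(2)[OF c] by (auto simp: is_pullback_def hom_def)
  have X: "X \<in> Obj CHausLoc" and R: "?R \<in> Obj CHausLoc"
    using hom_Obj[OF d] by auto
  let ?j = "\<lambda>z. (ptmap d z, ptmap c z)"
  define E where "E = ?j ` points ?R"
  have E_I: "(ptmap d z, ptmap c z) \<in> E" if "z \<in> points ?R" for z
    using that by (auto simp: E_def)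
  have E_E: "\<exists>z\<in>points ?R. ptmap d z = x \<and> ptmap c z = y" if "(x, y) \<in> E" for x y
    using that by (auto simp: E_def)
  have sub: "E \<subseteq> points X \<times> points X"
    using hom_points[OF d] hom_points[OF c] by (auto simp: E_def)
  have "equiv (points X) E"
  proof (rule equivI)
    show "E \<subseteq> points X \<times> points X"
      by fact
    show "refl_on (points X) E"
    proof (rule refl_onI)
      fix x assume x: "x \<in> points X"
      then show "(x, x) \<in> E"
        using E_I[OF hom_points[OF r(1) x]] ptmap_Comp[OF r(1) d x] ptmap_Comp[OF r(1) c x] r(2,3)
          ptmap_Id[OF X x]
        by simp
    qed
    show "sym E"
    proof (rule symI)
      fix x y assume "(x, y) \<in> E"
      then obtain z where z: "z \<in> points ?R" "ptmap d z = x" "ptmap c z = y"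
        using E_E by blast
      then show "(y, x) \<in> E"
        using E_I[OF hom_points[OF s(1) z(1)]] ptmap_Comp[OF s(1) d z(1)]
          ptmap_Comp[OF s(1) c z(1)] s(2,3) by simp
    qed
    show "trans E"
    proof (rule transI)
      fix x y z assume "(x, y) \<in> E" "(y, z) \<in> E"
      then obtain v w where v: "v \<in> points ?R" "ptmap d v = x" "ptmap c v = y"
        and w: "w \<in> points ?R" "ptmap d w = y" "ptmap c w = z"
        using E_E by metis
      obtain u where u: "u \<in> points ?P" "ptmap p u = v" "ptmap q u = w"
        using pullback_points[OF inf pb c d p q v(1) w(1) trans[OF v(3) w(2)[symmetric]]] by blast
      have "ptmap d (ptmap t u) = x" "ptmap c (ptmap t u) = z"
        using ptmap_Comp[OF t(1) d u(1)] ptmap_Comp[OF p d u(1)] ptmap_Comp[OF t(1) c u(1)]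
          ptmap_Comp[OF q c u(1)]
          t(2,3) u(2,3) v(2) w(3) by simp_all
      then show "(x, z) \<in> E"
        using E_I[OF hom_points[OF t(1) u(1)]] by simp
    qed
  qed
  moreover have "closedin (prod_topology (space_of X) (space_of X)) E"
  proof (rule compactin_imp_closedin)
    show "Hausdorff_space (prod_topology (space_of X) (space_of X))"
      using space_of_Obj(2)[OF X] by (simp add: Hausdorff_space_prod_topology)
    have "continuous_map (space_of ?R) (prod_topology (space_of X) (space_of X)) ?j"
      using hom_continuous[OF d] hom_continuous[OF c] by (simp add: continuous_map_paired)
    then show "compactin (prod_topology (space_of X) (space_of X)) E"
      unfolding E_def using space_of_Obj(1)[OF R] image_compactin unfolding compact_space_def by blast
  qed
  ultimately obtain T :: "'u set topology" and h where T: "compact_space T" "Hausdorff_space T"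
    "small_weight T (UNIV :: 'u set)" and h: "continuous_map (space_of X) T h"
      "h ` points X = topspace T"
    and h_eq: "\<And>x y. x \<in> points X \<Longrightarrow> y \<in> points X \<Longrightarrow> h x = h y \<longleftrightarrow> (x, y) \<in> E"
    using compact_Hausdorff_quotient[OF space_of_Obj[OF X] inf, of E] by metis
  obtain Q :: "'u gorder" and \<phi> \<psi> where Q: "Q \<in> Obj CHausLoc" and "homeomorphic_maps (space_of Q) T \<phi> \<psi>"
    using Obj_of_space[OF T] by blast
  note hm = homeomorphic_mapsD[OF this(2)]
  have "continuous_map (space_of X) (space_of Q) (\<psi> \<circ> h)"
    using h(1) hm(2) continuous_map_compose by blast
  then obtain f where f: "f \<in> hom CHausLoc X Q" "\<And>x. x \<in> points X \<Longrightarrow> ptmap f x = \<psi> (h x)"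
    using hom_of_continuous[OF X Q] by (metis comp_apply)
  have f_eq: "ptmap f x = ptmap f y \<longleftrightarrow> (x, y) \<in> E" if xy: "x \<in> points X" "y \<in> points X" for x y
  proof -
    have "h x \<in> topspace T" "h y \<in> topspace T"
      using h(2) xy by auto
    then have "\<psi> (h x) = \<psi> (h y) \<longleftrightarrow> h x = h y"
      using hm(4) by metis
    then show ?thesis
      using f(2) xy h_eq by simp
  qed
  have "is_pullback CHausLoc f f d c"
  proof (rule is_pullback_if_points[OF f(1) f(1) d c])
    show "Comp CHausLoc f d = Comp CHausLoc f c"
    proof (rule hom_eqI[OF Comp_hom_CHausLoc[OF d f(1)] Comp_hom_CHausLoc[OF c f(1)]])
      fix z assume z: "z \<in> points ?R"
      then show "ptmap (Comp CHausLoc f d) z = ptmap (Comp CHausLoc f c) z"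
        using f_eq[OF hom_points[OF d z] hom_points[OF c z]] E_I[OF z]
        by (simp add: ptmap_Comp[OF d f(1) z] ptmap_Comp[OF c f(1) z])
    qed
    show "\<exists>z\<in>points ?R. ptmap d z = x \<and> ptmap c z = y"
      if "x \<in> points X" "y \<in> points X" "ptmap f x = ptmap f y" for x y
      using E_E f_eq that by blast
    show "z = w" if "z \<in> points ?R" "w \<in> points ?R" "ptmap d z = ptmap d w"
      "ptmap c z = ptmap c w" for z w
      using jointly_monic_points[OF inf jm d c that] .
  qed
  then show ?thesis
    by (auto simp: is_kernel_pair_def)
qed

theorem theorem4p3:
  assumes "infinite (UNIV :: 'u set)"
  shows "barr_exact (CHausLoc :: ('u gorder, ('u, 'u) locmap) cat)"
  unfolding barr_exact_def
  using regular_category_CHausLoc[OF assms] equivalence_relation_effective[OF assms] by blast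

end
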